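(* Let $d\ge3$ and $s\in(d+2,2d)$. Let $\mathfrak p\colon\mathbb Z^d\to[0,1]$ satisfy $\mathfrak p(x)=\mathfrak p(-x)$ for all $x$, $\mathfrak p(0)=0$, $\mathfrak p(x)=1$ whenever $|x|=1$, and $\mathfrak p(x)=|x|^{-s+o(1)}$ as $|x|\to\infty$. Consider the long-range percolation graph with vertex set $\mathbb Z^d$ in which the unoriented edge between $x$ and $y$ is present with probability $\mathfrak p(y-x)$, independently of all other edges, and let $C_{x,y}=C_{y,x}\in\{0,1\}$ be the indicator that this edge is present; let $\mathbb P$ be the law of $\{C_{x,y}\}$. Then the corrector $\chi$ associated with these conductances is well defined, yet it is not sublinear everywhere; that is, the statement $$\lim_{n\to\infty}\frac1n\max_{x\colon|x|\le n}|\chi(x)|=0\qquad\mathbb P\text{-a.s.}$$ fails.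
   Context: $|\cdot|$ is the Euclidean norm. Let $\{C_{x,y}=C_{y,x}\colon x,y\in\mathbb Z^d\}$ be non-negative random conductances whose law $\mathbb P$ (with expectation $\mathbb E$) is stationary and jointly ergodic with respect to the shifts of $\mathbb Z^d$, with $\mathbb E\,C_{0,0}<\infty$ and $\pi(x):=\sum_{y\in\mathbb Z^d}C_{x,y}\in(0,\infty)$ a.s. Set $$(\mathsf Lf)(x):=\frac1{\pi(x)}\sum_{y\in\mathbb Z^d}C_{x,y}\bigl[f(y)-f(x)\bigr].$$ Corrector. The conditions $\mathbb E\bigl(\sum_{x\in\mathbb Z^d}C_{0,x}|x|^2\bigr)<\infty$ and $\mathbb E(1/C_{0,x})<\infty$ whenever $|x|=1$ permit the construction of the corrector, the basic object of stochastic homogenization. It is a random function $\chi\colon\mathbb Z^d\to\mathbb R^d$ characterized by the following properties: (1) normalization: $\chi(0)=0$; (2) stationarity of increments under the shifts of $\mathbb Z^d$: $\{\chi(x)-\chi(y)\colon x,y\in\mathbb Z^d\}$ is equal in law to $\{\chi(x-y)\colon x,y\in\mathbb Z^d\}$; (3) weighted square-integrability: $\mathbb E\bigl(\sum_{x\in\mathbb Z^d}C_{0,x}|\chi(x)|^2\bigr)<\infty$; (4) harmonicity of $\Psi(x):=x+\chi(x)$, in the sense that $(\mathsf L\Psi)(x)=0$ for all $x\in\mathbb Z^d$.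
   Formalization: Properties (1)–(4) do not determine χ (χ(x) = −x satisfies them), so the corrector is also required to have E χ(x) = 0; (2) is read jointly with the conductances. Non-sublinearity is proved for every χ satisfying (1)–(4). *)

theory Defs
  imports "HOL-Probability.Probability" "HOL-Library.Uprod"
begin

text \<open>The lattice is \<open>int ^ 'd\<close>, of dimension \<open>CARD('d)\<close>; Euclidean geometry is inherited from
  \<open>real ^ 'd\<close> through the canonical embedding.\<close>

definition emb :: "int ^ 'd \<Rightarrow> real ^ 'd" where
  "emb x = (\<chi> i. real_of_int (x $ i))"

abbreviation lnorm :: "int ^ 'd \<Rightarrow> real" where
  "lnorm x \<equiv> norm (emb x)"

definition lattice_at_infinity :: "(int ^ 'd) filter" where
  "lattice_at_infinity = filtercomap lnorm at_top"

text \<open>\<open>p(x) = |x|^(-s + o(1))\<close> as \<open>|x|\<close> tends to infinity.\<close>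

definition decays_with_exponent :: "(int ^ 'd \<Rightarrow> real) \<Rightarrow> real \<Rightarrow> bool" where
  "decays_with_exponent p s \<longleftrightarrow>
     (\<exists>\<epsilon>. (\<epsilon> \<longlongrightarrow> 0) lattice_at_infinity \<and>
          (\<forall>\<^sub>F x in lattice_at_infinity. p x = lnorm x powr (- s + \<epsilon> x)))"

text \<open>An environment assigns a conductance to every unordered pair of vertices (including the
  degenerate pairs \<open>Upair x x\<close>), so that the symmetry \<open>C\<^sub>x\<^sub>,\<^sub>y = C\<^sub>y\<^sub>,\<^sub>x\<close> is built in. We work on the
  canonical space: the law of the conductances is a probability measure on environments, and a
  random function is a measurable function of the environment.\<close>

type_synonym 'd env = "(int ^ 'd) uprod \<Rightarrow> real"

definition cond :: "('d::finite) env \<Rightarrow> int ^ 'd \<Rightarrow> int ^ 'd \<Rightarrow> real" where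
  "cond \<omega> x y = \<omega> (Upair x y)"

definition env_algebra :: "('d::finite) env measure" where
  "env_algebra = (\<Pi>\<^sub>M e\<in>UNIV. borel)"

text \<open>\<open>cond (env_shift z \<omega>) x y = cond \<omega> (x + z) (y + z)\<close>.\<close>

definition env_shift :: "int ^ 'd \<Rightarrow> 'd env \<Rightarrow> 'd env" where
  "env_shift z \<omega> = (\<lambda>e. \<omega> (map_uprod (\<lambda>x. x + z) e))"

definition long_range_percolation :: "(int ^ 'd \<Rightarrow> real) \<Rightarrow> ('d::finite) env measure \<Rightarrow> bool" where
  "long_range_percolation p P \<longleftrightarrow>
     prob_space P \<and> sets P = sets env_algebra \<and>
     prob_space.indep_vars P (\<lambda>_. borel) (\<lambda>e \<omega>. \<omega> e) UNIV \<and>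
     (\<forall>x y. measure P {\<omega> \<in> space P. cond \<omega> x y = 1} = p (y - x) \<and>
            measure P {\<omega> \<in> space P. cond \<omega> x y = 0} = 1 - p (y - x))"

definition total_cond :: "('d::finite) env \<Rightarrow> int ^ 'd \<Rightarrow> real" where
  "total_cond \<omega> x = (\<Sum>\<^sub>\<infinity>y. cond \<omega> x y)"

definition generator ::
    "('d::finite) env \<Rightarrow> (int ^ 'd \<Rightarrow> 'b::real_normed_vector) \<Rightarrow> int ^ 'd \<Rightarrow> 'b" where
  "generator \<omega> f x = (1 / total_cond \<omega> x) *\<^sub>R (\<Sum>\<^sub>\<infinity>y. cond \<omega> x y *\<^sub>R (f y - f x))"

text \<open>The summability conditions exclude spurious solutions, since an infinite sum that does not
  converge has the default value \<open>0\<close>.\<close>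

definition harmonic_at ::
    "('d::finite) env \<Rightarrow> (int ^ 'd \<Rightarrow> 'b::real_normed_vector) \<Rightarrow> int ^ 'd \<Rightarrow> bool" where
  "harmonic_at \<omega> f x \<longleftrightarrow>
     (\<lambda>y. cond \<omega> x y) summable_on UNIV \<and>
     (\<lambda>y. cond \<omega> x y *\<^sub>R (f y - f x)) summable_on UNIV \<and>
     generator \<omega> f x = 0"

text \<open>The four listed properties of the corrector. Increments are stationary with respect to the
  shifts acting on the environment, i.e. jointly with the conductances: for every \<open>z\<close>, the pair
  consisting of the shifted environment and of the increments of \<open>X\<close> from \<open>z\<close> has the same law as
  the pair \<open>(\<omega>, X)\<close>. (For \<open>X\<close> a function of the environment this amounts to the cocycle relation
  \<open>X \<omega> (x + z) - X \<omega> z = X (env_shift z \<omega>) x\<close> almost surely.)\<close>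

definition corrector_properties ::
    "('d::finite) env measure \<Rightarrow> ('d env \<Rightarrow> int ^ 'd \<Rightarrow> real ^ 'd) \<Rightarrow> bool" where
  "corrector_properties P X \<longleftrightarrow>
     (\<forall>x. (\<lambda>\<omega>. X \<omega> x) \<in> borel_measurable P) \<and>
     (AE \<omega> in P. X \<omega> 0 = 0) \<and>
     (\<forall>z. distr P (env_algebra \<Otimes>\<^sub>M (\<Pi>\<^sub>M x\<in>UNIV. borel))
              (\<lambda>\<omega>. (env_shift z \<omega>, \<lambda>x. X \<omega> (x + z) - X \<omega> z))
          = distr P (env_algebra \<Otimes>\<^sub>M (\<Pi>\<^sub>M x\<in>UNIV. borel)) (\<lambda>\<omega>. (\<omega>, X \<omega>))) \<and>
     (\<integral>\<^sup>+ \<omega>. (\<Sum>\<^sub>\<infinity>x. ennreal (cond \<omega> 0 x * (norm (X \<omega> x))\<^sup>2)) \<partial>P) < \<infinity> \<and>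
     (AE \<omega> in P. \<forall>x. harmonic_at \<omega> (\<lambda>y. emb y + X \<omega> y) x)"

text \<open>The four properties alone do not determine \<open>X\<close>: they are also satisfied by \<open>X \<omega> x = - emb x\<close>,
  for which \<open>emb + X\<close> vanishes, and more generally they allow \<open>emb + X\<close> to be replaced by any linear
  image of itself. As usual, the corrector is singled out by requiring its increments to be
  centred.\<close>

definition is_corrector ::
    "('d::finite) env measure \<Rightarrow> ('d env \<Rightarrow> int ^ 'd \<Rightarrow> real ^ 'd) \<Rightarrow> bool" where
  "is_corrector P X \<longleftrightarrow>
     corrector_properties P X \<and>
     (\<forall>x. integrable P (\<lambda>\<omega>. X \<omega> x) \<and> (\<integral>\<omega>. X \<omega> x \<partial>P) = 0)"

definition corrector_well_defined :: "('d::finite) env measure \<Rightarrow> bool" where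
  "corrector_well_defined P \<longleftrightarrow>
     (\<exists>X. is_corrector P X) \<and>
     (\<forall>X Y. is_corrector P X \<longrightarrow> is_corrector P Y \<longrightarrow> (AE \<omega> in P. \<forall>x. X \<omega> x = Y \<omega> x))"

definition sublinear_everywhere :: "(int ^ 'd \<Rightarrow> real ^ 'd) \<Rightarrow> bool" where
  "sublinear_everywhere f \<longleftrightarrow>
     (\<lambda>n. (1 / real n) * Max ((\<lambda>x. norm (f x)) ` {x. lnorm x \<le> real n})) \<longlonglongrightarrow> 0"

end

theory Submission
  imports Defs
begin

text \<open>
  The corrector is the minimiser of the energy of \<open>x + X(x)\<close> over fields with stationary, centred
  increments. The edges at the origin are collected in one finite measure \<open>edge_measure\<close> on pairs of an
  environment and a displacement. A function \<open>f\<close> of the environment has a gradient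
  \<open>f (env_shift z \<omega>) - f \<omega>\<close>, and minus the projection of the linear functions \<open>z $ i\<close> onto the
  \<open>L\<^sup>2\<close>-closure of these gradients is the corrector on the open edges (\<open>minimizing_sequence\<close>). Since the
  nearest-neighbour edges are open and an increment over any displacement is a sum of nearest-neighbour
  increments, a minimising sequence converges almost surely for every displacement; its limit is a
  centred cocycle (\<open>scalar_corrector_exists\<close>). Reversing an edge preserves \<open>edge_measure\<close>, by stationarity and
  symmetry of the conductances, so orthogonality to all gradients amounts to vanishing divergence,
  that is, to harmonicity (\<open>integration_by_parts\<close>).

  For uniqueness, a harmonic centred cocycle \<open>Z\<close> of finite energy must vanish. It is orthogonal to
  gradients, so it suffices that it is nearly a gradient. By the ergodic theorem, which for independent
  edges follows from the independence of distant cylinder events (\<open>L1_mean_ergodic\<close>), \<open>Z\<close> is sublinear in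
  \<open>L\<^sup>1\<close>. Let \<open>f\<close> be minus the average of \<open>Z\<close> over a window of radius of order \<open>n\<close>, where the values of \<open>Z\<close>
  are truncated at height \<open>n\<close>. The gradient of \<open>f\<close> differs from \<open>Z\<close> by the effect of the truncation, which
  is rarely active, and by the effect of moving the window, which is at most a constant times the
  displacement and tends to 0 in probability (\<open>gradient_approximation\<close>). The truncation is what makes these errors dominated:
  the displacement is square integrable for \<open>edge_measure\<close> because \<open>s > d + 2\<close>, whereas no moment bound is
  available for \<open>Z\<close> at distant points on the event that a given long edge is open (\<open>centred_cocycle_eq_0\<close>).

  Sublinearity fails because of long edges. Two boxes of side \<open>m\<close> at distance of order \<open>m\<close> are joined
  by many edges, as \<open>s < 2 d\<close> makes the expected number, of order \<open>m\<close> to the power \<open>2 d - s - o(1)\<close>,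
  diverge. With probability bounded below, one of these edges starts at a point \<open>x\<close> all of whose other
  edges are of bounded length or lead to the same remote box (\<open>prob_isolated_long_edge_ge\<close>). If \<open>X\<close> were
  sublinear, the harmonic function \<open>x + X(x)\<close> would have increments of order \<open>m\<close> in a fixed direction
  along the long edges at \<open>x\<close> and of order \<open>o(m)\<close> along the boundedly many others, and their sum could not
  be 0 (\<open>no_isolated_long_edge_if_sublinear\<close>).
\<close>

section \<open>Lattice sums\<close>

text \<open>The number of nearest-neighbour steps from the origin to \<open>x\<close>: the bounds on cocycles below are obtained by
  adding up increments along such paths.\<close>

abbreviation l1 :: "int ^ 'd::finite \<Rightarrow> real" where
  "l1 x \<equiv> \<Sum>i\<in>UNIV. \<bar>real_of_int (x $ i)\<bar>"

lemma l1_triangle: "l1 (x + y) \<le> l1 x + l1 y"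
  by (simp add: sum.distrib [symmetric] sum_mono)

lemma l1_nonneg [simp]: "0 \<le> l1 x"
  by (simp add: sum_nonneg)

lemma abs_component_le_l1: "\<bar>real_of_int (x $ i)\<bar> \<le> l1 x"
  by (rule member_le_sum) auto

lemma emb_add: "emb (x + y) = emb x + emb y"
  by (simp add: emb_def vec_eq_iff)

lemma emb_nth [simp]: "emb x $ i = real_of_int (x $ i)"
  by (simp add: emb_def)

lemma lnorm_le_l1: "lnorm x \<le> l1 x"
  using norm_le_l1_cart [of "emb x"] by simp

lemma abs_component_le_lnorm: "\<bar>real_of_int (x $ i)\<bar> \<le> lnorm x"
  using component_le_norm_cart [of "emb x" i] by simp

lemma l1_le_lnorm: "l1 x \<le> real CARD('d) * lnorm (x :: int ^ 'd::finite)"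
proof -
  have "l1 x \<le> (\<Sum>i\<in>(UNIV :: 'd set). lnorm x)"
    by (intro sum_mono abs_component_le_lnorm)
  then show ?thesis by simp
qed

lemma lnorm_eq_1_if_l1:
  assumes "l1 x = 1"
  shows "lnorm x = 1"
proof -
  have "(real_of_int (x $ i))\<^sup>2 = \<bar>real_of_int (x $ i)\<bar>" for i
  proof -
    have "\<bar>real_of_int (x $ i)\<bar> \<le> 1" using abs_component_le_l1 [of x i] assms by simp
    then have "\<bar>x $ i\<bar> \<le> 1" by linarith
    then have "x $ i = -1 \<or> x $ i = 0 \<or> x $ i = 1" by linarith
    then show ?thesis by auto
  qed
  then show ?thesis using assms by (simp add: norm_vec_def L2_set_def)
qed

lemma bij_betw_vec_nth_box:
  "bij_betw (\<lambda>v::'a ^ 'n::finite. ($) v) {v. \<forall>i. v $ i \<in> K} (PiE UNIV (\<lambda>_. K))"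
  by (rule bij_betw_byWitness [where f' = vec_lambda]) auto

lemma finite_box:
  assumes "finite K"
  shows "finite {v :: 'a ^ 'n::finite. \<forall>i. v $ i \<in> K}"
  using bij_betw_finite [OF bij_betw_vec_nth_box, of K] assms by (simp add: finite_PiE)

lemma sum_box_prod:
  fixes g :: "'a \<Rightarrow> 'b::comm_semiring_1"
  assumes "finite K"
  shows "(\<Sum>v\<in>{v :: 'a ^ 'n::finite. \<forall>i. v $ i \<in> K}. \<Prod>i\<in>UNIV. g (v $ i))
    = (\<Sum>k\<in>K. g k) ^ CARD('n)"
proof -
  have "(\<Sum>k\<in>K. g k) ^ CARD('n) = (\<Prod>i\<in>(UNIV::'n set). \<Sum>k\<in>K. g k)"
    by simp
  also have "\<dots> = (\<Sum>v\<in>PiE UNIV (\<lambda>_::'n. K). \<Prod>i\<in>UNIV. g (v i))"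
    by (rule prod_sum_PiE) (use assms in auto)
  also have "\<dots> = (\<Sum>v\<in>{v :: 'a ^ 'n. \<forall>i. v $ i \<in> K}. \<Prod>i\<in>UNIV. g (v $ i))"
    by (rule sum.reindex_bij_betw [OF bij_betw_vec_nth_box, symmetric])
  finally show ?thesis by simp
qed

lemma card_box:
  assumes "finite K"
  shows "card {v :: 'a ^ 'n::finite. \<forall>i. v $ i \<in> K} = card K ^ CARD('n)"
  using sum_box_prod [OF assms, where g = "\<lambda>_. 1::nat" and 'n = 'n] by simp

lemma finite_l1_ball: "finite {x :: int ^ 'd::finite. l1 x \<le> r}"
proof (rule finite_subset)
  show "{x :: int ^ 'd. l1 x \<le> r} \<subseteq> {x. \<forall>i. x $ i \<in> {- \<lceil>r\<rceil>..\<lceil>r\<rceil>}}"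
  proof safe
    fix x :: "int ^ 'd" and i assume "l1 x \<le> r"
    then have "\<bar>real_of_int (x $ i)\<bar> \<le> r"
      using abs_component_le_l1 [of x i] by linarith
    then show "x $ i \<in> {- \<lceil>r\<rceil>..\<lceil>r\<rceil>}" by (auto simp: abs_le_iff) linarith+
  qed
qed (rule finite_box, simp)

lemma finite_lnorm_ball: "finite {x :: int ^ 'd::finite. lnorm x \<le> r}"
proof (rule finite_subset)
  show "{x :: int ^ 'd. lnorm x \<le> r} \<subseteq> {x. l1 x \<le> real CARD('d) * r}"
  proof safe
    fix x :: "int ^ 'd" assume "lnorm x \<le> r"
    then have "real CARD('d) * lnorm x \<le> real CARD('d) * r" by (intro mult_left_mono) auto
    then show "l1 x \<le> real CARD('d) * r" using l1_le_lnorm [of x] by linarith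
  qed
qed (rule finite_l1_ball)

text \<open>As \<open>|x|\<close> dominates every coordinate, \<open>(1 + |x|) powr (-r)\<close> is at most the product over the coordinates of
  \<open>(1 + |x\<^sub>i|) powr (-r/d)\<close>, and the sum of such products over a box factorises into one-dimensional sums
  with exponent \<open>r/d > 1\<close>.\<close>

lemma summable_lnorm_powr:
  assumes r: "real CARD('d) < r"
  shows "(\<lambda>x :: int ^ 'd::finite. (1 + lnorm x) powr (- r)) summable_on UNIV"
proof (rule nonneg_bdd_above_summable_on)
  let ?d = "real CARD('d)"
  define g :: "int \<Rightarrow> real" where "g k = (1 + \<bar>real_of_int k\<bar>) powr (- (r / ?d))" for k
  have d: "?d > 0" by simp
  have "summable (\<lambda>n. real n powr (- (r / ?d)))"
    using r d by (subst summable_real_powr_iff) (simp add: field_simps)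
  then have "summable (\<lambda>n. real (Suc n) powr (- (r / ?d)))"
    by (subst summable_Suc_iff)
  then have sm: "summable (\<lambda>n. (1 + real n) powr (- (r / ?d)))"
    by (simp add: add.commute)
  define S where "S = (\<Sum>n. (1 + real n) powr (- (r / ?d)))"
  have S0: "0 \<le> S" unfolding S_def by (intro suminf_nonneg sm) auto
  have one_dim: "(\<Sum>k\<in>{-int N..int N}. g k) \<le> 2 * S" for N
  proof -
    have "(\<Sum>k\<in>{-int N..int N}. g k) \<le> (\<Sum>k\<in>int ` {..N} \<union> (\<lambda>n. - int n) ` {..N}. g k)"
    proof (rule sum_mono2)
      show "{-int N..int N} \<subseteq> int ` {..N} \<union> (\<lambda>n. - int n) ` {..N}"
      proof
        fix k assume "k \<in> {-int N..int N}"
        then show "k \<in> int ` {..N} \<union> (\<lambda>n. - int n) ` {..N}"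
          by (cases k rule: int_cases2) auto
      qed
    qed (auto simp: g_def)
    also have "\<dots> \<le> (\<Sum>k\<in>int ` {..N}. g k) + (\<Sum>k\<in>(\<lambda>n. - int n) ` {..N}. g k)"
      by (subst sum_Un) (auto simp: g_def intro!: sum_nonneg)
    also have "\<dots> = 2 * (\<Sum>n\<le>N. (1 + real n) powr (- (r / ?d)))"
      by (simp add: sum.reindex inj_on_def g_def)
    also have "(\<Sum>n\<le>N. (1 + real n) powr (- (r / ?d))) \<le> S"
      unfolding S_def by (intro sum_le_suminf sm) auto
    finally show ?thesis by simp
  qed
  have prod_bound: "(1 + lnorm x) powr (- r) \<le> (\<Prod>i\<in>UNIV. g (x $ i))" for x :: "int ^ 'd"
  proof -
    have "0 < 1 + lnorm x" by (simp add: add_pos_nonneg)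
    then have "((1 + lnorm x) powr (- (r / ?d))) ^ CARD('d) = (1 + lnorm x) powr (- (r / ?d) * ?d)"
      by (subst powr_realpow [symmetric]) (auto simp: powr_powr)
    then have "(1 + lnorm x) powr (- r) = (\<Prod>i\<in>(UNIV::'d set). (1 + lnorm x) powr (- (r / ?d)))"
      using d by simp
    also have "\<dots> \<le> (\<Prod>i\<in>UNIV. g (x $ i))"
      unfolding g_def using r d abs_component_le_lnorm [of x]
      by (intro prod_mono conjI powr_mono2') (auto simp: field_simps intro: add_pos_nonneg)
    finally show ?thesis .
  qed
  have "sum (\<lambda>x :: int ^ 'd. (1 + lnorm x) powr (- r)) F \<le> (2 * S) ^ CARD('d)" if "finite F" for F
  proof -
    define N where "N = nat \<lceil>Max (insert 0 (l1 ` F))\<rceil>"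
    have F: "F \<subseteq> {x. \<forall>i. x $ i \<in> {-int N..int N}}"
    proof safe
      fix x i assume "x \<in> F"
      then have "\<bar>real_of_int (x $ i)\<bar> \<le> Max (insert 0 (l1 ` F))"
        using abs_component_le_l1 [of x i] that by (intro order.trans [OF _ Max_ge]) auto
      then have "\<bar>x $ i\<bar> \<le> int N" unfolding N_def by linarith
      then show "x $ i \<in> {-int N..int N}" by auto
    qed
    have "sum (\<lambda>x :: int ^ 'd. (1 + lnorm x) powr (- r)) F \<le> (\<Sum>x\<in>F. \<Prod>i\<in>UNIV. g (x $ i))"
      by (intro sum_mono prod_bound)
    also have "\<dots> \<le> (\<Sum>x\<in>{x :: int ^ 'd. \<forall>i. x $ i \<in> {-int N..int N}}. \<Prod>i\<in>UNIV. g (x $ i))"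
      by (rule sum_mono2 [OF finite_box F]) (auto simp: g_def intro!: prod_nonneg)
    also have "\<dots> = (\<Sum>k\<in>{-int N..int N}. g k) ^ CARD('d)"
      by (rule sum_box_prod) simp
    also have "\<dots> \<le> (2 * S) ^ CARD('d)"
      by (intro power_mono one_dim) (auto simp: g_def intro!: sum_nonneg)
    finally show ?thesis .
  qed
  then show "bdd_above (sum (\<lambda>x :: int ^ 'd. (1 + lnorm x) powr (- r)) ` {F. F \<subseteq> UNIV \<and> finite F})"
    by (auto simp: bdd_above_def)
qed auto

lemma eventually_lattice_at_infinity:
  "eventually Q (lattice_at_infinity :: (int ^ 'd::finite) filter) \<longleftrightarrow> (\<exists>r. \<forall>x. r \<le> lnorm x \<longrightarrow> Q x)"
  unfolding lattice_at_infinity_def eventually_filtercomap eventually_at_top_linorder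
  by (metis (mono_tags, lifting))

lemma decays_with_exponent_bounds:
  assumes "decays_with_exponent p s" and "\<delta> > 0"
  obtains r where "r \<ge> 1"
    "\<And>x :: int ^ 'd::finite. r \<le> lnorm x \<Longrightarrow> p x \<le> lnorm x powr (- s + \<delta>)"
    "\<And>x :: int ^ 'd. r \<le> lnorm x \<Longrightarrow> lnorm x powr (- s - \<delta>) \<le> p x"
proof -
  obtain \<epsilon> where \<epsilon>: "(\<epsilon> \<longlongrightarrow> 0) lattice_at_infinity"
    and p: "\<forall>\<^sub>F x in lattice_at_infinity. p x = lnorm x powr (- s + \<epsilon> x)"
    using assms(1) unfolding decays_with_exponent_def by blast
  have "\<forall>\<^sub>F x in lattice_at_infinity. p x = lnorm x powr (- s + \<epsilon> x) \<and> \<bar>\<epsilon> x\<bar> < \<delta>"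
    using p tendstoD [OF \<epsilon> assms(2)] by eventually_elim (simp add: dist_real_def)
  then obtain r where r: "\<And>x. r \<le> lnorm x \<Longrightarrow> p x = lnorm x powr (- s + \<epsilon> x) \<and> \<bar>\<epsilon> x\<bar> < \<delta>"
    unfolding eventually_lattice_at_infinity by blast
  show ?thesis
  proof (rule that [of "max r 1"])
    fix x :: "int ^ 'd" assume "max r 1 \<le> lnorm x"
    then have x: "r \<le> lnorm x" "1 \<le> lnorm x" by auto
    show "p x \<le> lnorm x powr (- s + \<delta>)" "lnorm x powr (- s - \<delta>) \<le> p x"
      using r [OF x(1)] x(2) by (auto intro!: powr_mono)
  qed simp
qed

text \<open>Half of the margin between \<open>s\<close> and \<open>d + 2\<close> absorbs the \<open>o(1)\<close> in the exponent, the other half makes the series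
  converge.\<close>

lemma decay_second_moment:
  fixes p :: "int ^ 'd::finite \<Rightarrow> real"
  assumes p0: "\<And>x. 0 \<le> p x" and dec: "decays_with_exponent p s" and s: "real CARD('d) + 2 < s"
  shows "(\<lambda>x. p x * (l1 x)\<^sup>2) summable_on UNIV"
proof -
  let ?d = "real CARD('d)"
  define \<delta> where "\<delta> = (s - 2 - ?d) / 2"
  have "\<delta> > 0" using s by (simp add: \<delta>_def)
  then obtain r where r: "r \<ge> 1" "\<And>x. r \<le> lnorm x \<Longrightarrow> p x \<le> lnorm x powr (- s + \<delta>)"
    using decays_with_exponent_bounds [OF dec] by metis
  define t where "t = s - 2 - \<delta>"
  have t: "?d < t" "0 < t" using s by (simp_all add: t_def \<delta>_def field_simps)
  have fin: "finite {x :: int ^ 'd. lnorm x < r}"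
    by (rule finite_subset [OF _ finite_lnorm_ball [of r]]) auto
  have "(\<lambda>x. ?d\<^sup>2 * 2 powr t * (1 + lnorm (x :: int ^ 'd)) powr (- t)) summable_on UNIV"
    by (intro summable_on_cmult_right summable_lnorm_powr t)
  then have "(\<lambda>x. ?d\<^sup>2 * 2 powr t * (1 + lnorm (x :: int ^ 'd)) powr (- t)) summable_on (UNIV - {x. lnorm x < r})"
    by (rule summable_on_subset_banach) auto
  then have "(\<lambda>x. p x * (l1 x)\<^sup>2) summable_on (UNIV - {x. lnorm x < r})"
  proof (rule summable_on_comparison_test)
    fix x :: "int ^ 'd" assume "x \<in> UNIV - {x. lnorm x < r}"
    then have x: "r \<le> lnorm x" "1 \<le> lnorm x" using r(1) by auto
    have "p x * (l1 x)\<^sup>2 \<le> lnorm x powr (- s + \<delta>) * (?d * lnorm x)\<^sup>2"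
      by (intro mult_mono r(2) x power_mono l1_le_lnorm l1_nonneg) auto
    also have "\<dots> = ?d\<^sup>2 * (lnorm x powr (- s + \<delta>) * lnorm x powr 2)"
      using x by (simp add: power_mult_distrib)
    also have "lnorm x powr (- s + \<delta>) * lnorm x powr 2 = lnorm x powr (- t)"
      by (subst powr_add [symmetric]) (simp add: t_def algebra_simps)
    also have "lnorm x powr (- t) = 2 powr t * (2 * lnorm x) powr (- t)"
      using x by (simp add: powr_mult powr_minus field_simps)
    also have "(2 * lnorm x) powr (- t) \<le> (1 + lnorm x) powr (- t)"
      using x t by (intro powr_mono2') auto
    finally show "p x * (l1 x)\<^sup>2 \<le> ?d\<^sup>2 * 2 powr t * (1 + lnorm x) powr (- t)"
      by (simp add: mult_left_mono mult.assoc)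
  qed (use p0 in auto)
  then have "(\<lambda>x. p x * (l1 x)\<^sup>2) summable_on ((UNIV - {x. lnorm x < r}) \<union> {x. lnorm x < r})"
    by (rule summable_on_Un_disjoint [OF _ summable_on_finite [OF fin]]) auto
  then show ?thesis by (simp add: Un_commute)
qed

section \<open>An ergodic theorem in L1\<close>

definition L1_mean_converges :: "'a measure \<Rightarrow> (nat \<Rightarrow> 'a \<Rightarrow> 'a) \<Rightarrow> ('a \<Rightarrow> real) \<Rightarrow> bool" where
  "L1_mean_converges M T g \<longleftrightarrow>
     (\<lambda>n. \<integral>\<omega>. \<bar>(\<Sum>k<n. g (T k \<omega>)) / real n - (\<integral>\<omega>. g \<omega> \<partial>M)\<bar> \<partial>M) \<longlonglongrightarrow> 0"

locale measure_preserving_iterates = prob_space M for M :: "'a measure" +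
  fixes T :: "nat \<Rightarrow> 'a \<Rightarrow> 'a"
  assumes T_measurable [measurable]: "T k \<in> measurable M M"
    and T_preserves: "distr M M (T k) = M"
begin

lemma integral_comp_T:
  fixes g :: "'a \<Rightarrow> real"
  assumes [measurable]: "g \<in> borel_measurable M"
  shows "(\<integral>\<omega>. g (T k \<omega>) \<partial>M) = (\<integral>\<omega>. g \<omega> \<partial>M)"
  using integral_distr [OF T_measurable assms, of k] by (simp add: T_preserves)

lemma integrable_comp_T:
  fixes g :: "'a \<Rightarrow> real"
  assumes "integrable M g"
  shows "integrable M (\<lambda>\<omega>. g (T k \<omega>))"
  using integrable_distr [OF T_measurable, of k g] assms by (simp add: T_preserves)

lemma L1_mean_converges_add:
  assumes f: "integrable M f" "L1_mean_converges M T f"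
    and g: "integrable M g" "L1_mean_converges M T g"
  shows "L1_mean_converges M T (\<lambda>\<omega>. f \<omega> + g \<omega>)"
proof -
  have int: "integrable M (\<lambda>\<omega>. \<bar>(\<Sum>k<n. h (T k \<omega>)) / real n - c\<bar>)"
    if "integrable M h" for h :: "'a \<Rightarrow> real" and n c
    using integrable_comp_T [OF that] by simp
  have "(\<integral>\<omega>. \<bar>(\<Sum>k<n. f (T k \<omega>) + g (T k \<omega>)) / real n - (\<integral>\<omega>. f \<omega> + g \<omega> \<partial>M)\<bar> \<partial>M)
    \<le> (\<integral>\<omega>. \<bar>(\<Sum>k<n. f (T k \<omega>)) / real n - (\<integral>\<omega>. f \<omega> \<partial>M)\<bar> \<partial>M)
      + (\<integral>\<omega>. \<bar>(\<Sum>k<n. g (T k \<omega>)) / real n - (\<integral>\<omega>. g \<omega> \<partial>M)\<bar> \<partial>M)" (is "?L n \<le> ?R n") for n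
  proof -
    have "?L n \<le> (\<integral>\<omega>. \<bar>(\<Sum>k<n. f (T k \<omega>)) / real n - (\<integral>\<omega>. f \<omega> \<partial>M)\<bar>
        + \<bar>(\<Sum>k<n. g (T k \<omega>)) / real n - (\<integral>\<omega>. g \<omega> \<partial>M)\<bar> \<partial>M)"
    proof (rule integral_mono)
      show "integrable M (\<lambda>\<omega>. \<bar>(\<Sum>k<n. f (T k \<omega>) + g (T k \<omega>)) / real n - (\<integral>\<omega>. f \<omega> + g \<omega> \<partial>M)\<bar>)"
        using int [of "\<lambda>\<omega>. f \<omega> + g \<omega>"] f(1) g(1) by simp
      show "integrable M (\<lambda>\<omega>. \<bar>(\<Sum>k<n. f (T k \<omega>)) / real n - (\<integral>\<omega>. f \<omega> \<partial>M)\<bar>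
        + \<bar>(\<Sum>k<n. g (T k \<omega>)) / real n - (\<integral>\<omega>. g \<omega> \<partial>M)\<bar>)"
        by (intro Bochner_Integration.integrable_add int f g)
      show "\<bar>(\<Sum>k<n. f (T k \<omega>) + g (T k \<omega>)) / real n - (\<integral>\<omega>. f \<omega> + g \<omega> \<partial>M)\<bar>
        \<le> \<bar>(\<Sum>k<n. f (T k \<omega>)) / real n - (\<integral>\<omega>. f \<omega> \<partial>M)\<bar>
        + \<bar>(\<Sum>k<n. g (T k \<omega>)) / real n - (\<integral>\<omega>. g \<omega> \<partial>M)\<bar>" for \<omega>
        using f(1) g(1) by (simp add: sum.distrib add_divide_distrib)
    qed
    also have "\<dots> = ?R n"
      by (rule Bochner_Integration.integral_add [OF int [OF f(1)] int [OF g(1)]])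
    finally show ?thesis .
  qed
  moreover have "?R \<longlonglongrightarrow> 0 + 0"
    using f(2) g(2) unfolding L1_mean_converges_def by (rule tendsto_add)
  ultimately have "\<forall>n. ?L n \<le> ?R n" "?R \<longlonglongrightarrow> 0" by auto
  then show ?thesis
    unfolding L1_mean_converges_def by (auto intro: tendsto_sandwich [OF _ _ tendsto_const, where h = ?R])
qed

lemma L1_mean_converges_scale:
  assumes "L1_mean_converges M T f"
  shows "L1_mean_converges M T (\<lambda>\<omega>. c * f \<omega>)"
proof -
  have "(\<integral>\<omega>. \<bar>(\<Sum>k<n. c * f (T k \<omega>)) / real n - (\<integral>\<omega>. c * f \<omega> \<partial>M)\<bar> \<partial>M)
    = \<bar>c\<bar> * (\<integral>\<omega>. \<bar>(\<Sum>k<n. f (T k \<omega>)) / real n - (\<integral>\<omega>. f \<omega> \<partial>M)\<bar> \<partial>M)" for n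
  proof -
    have "(\<Sum>k<n. c * f (T k \<omega>)) / real n - (\<integral>\<omega>. c * f \<omega> \<partial>M)
      = c * ((\<Sum>k<n. f (T k \<omega>)) / real n - (\<integral>\<omega>. f \<omega> \<partial>M))" for \<omega>
      by (simp only: sum_distrib_left [symmetric] right_diff_distrib times_divide_eq_right
          Bochner_Integration.integral_mult_right_zero)
    then show ?thesis by (simp only: abs_mult Bochner_Integration.integral_mult_right_zero)
  qed
  with tendsto_mult_left [OF assms [unfolded L1_mean_converges_def], of "\<bar>c\<bar>"]
  show ?thesis unfolding L1_mean_converges_def by simp
qed

lemma L1_mean_converges_const: "L1_mean_converges M T (\<lambda>\<omega>. c)"
  unfolding L1_mean_converges_def
  by (rule tendsto_eventually) (use eventually_gt_at_top [of 0] in eventually_elim, simp add: prob_space)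

text \<open>Averaging does not increase the \<open>L\<^sup>1\<close> norm, so convergence passes to \<open>L\<^sup>1\<close> limits.\<close>

lemma L1_mean_converges_closed:
  assumes g: "integrable M g"
    and approx: "\<And>\<epsilon>. \<epsilon> > 0 \<Longrightarrow> \<exists>h. integrable M h \<and> L1_mean_converges M T h \<and> (\<integral>\<omega>. \<bar>g \<omega> - h \<omega>\<bar> \<partial>M) < \<epsilon>"
  shows "L1_mean_converges M T g"
  unfolding L1_mean_converges_def
proof (rule LIMSEQ_I)
  fix \<epsilon> :: real assume "\<epsilon> > 0"
  then obtain h where h: "integrable M h" "L1_mean_converges M T h" "(\<integral>\<omega>. \<bar>g \<omega> - h \<omega>\<bar> \<partial>M) < \<epsilon> / 3"
    using approx [of "\<epsilon> / 3"] by auto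
  let ?h = "\<lambda>n. \<integral>\<omega>. \<bar>(\<Sum>k<n. h (T k \<omega>)) / real n - (\<integral>\<omega>. h \<omega> \<partial>M)\<bar> \<partial>M"
  let ?g = "\<lambda>n. \<integral>\<omega>. \<bar>(\<Sum>k<n. g (T k \<omega>)) / real n - (\<integral>\<omega>. g \<omega> \<partial>M)\<bar> \<partial>M"
  have "eventually (\<lambda>n. norm (?h n - 0) < \<epsilon> / 3) sequentially"
    using tendstoD [OF h(2) [unfolded L1_mean_converges_def], of "\<epsilon> / 3"] \<open>\<epsilon> > 0\<close>
    by (simp add: dist_norm)
  then obtain N where N: "\<And>n. n \<ge> N \<Longrightarrow> ?h n < \<epsilon> / 3"
    unfolding eventually_sequentially by fastforce
  have ih: "integrable M (\<lambda>\<omega>. h (T k \<omega>))" and ig: "integrable M (\<lambda>\<omega>. g (T k \<omega>))" for k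
    using integrable_comp_T h(1) g by auto
  note igh = g h(1)
  have bound: "?g n \<le> ?h n + 2 * (\<integral>\<omega>. \<bar>g \<omega> - h \<omega>\<bar> \<partial>M)" if "n > 0" for n
  proof -
    have ptw: "\<bar>(\<Sum>k<n. g (T k \<omega>)) / real n - (\<integral>\<omega>. g \<omega> \<partial>M)\<bar>
      \<le> \<bar>(\<Sum>k<n. h (T k \<omega>)) / real n - (\<integral>\<omega>. h \<omega> \<partial>M)\<bar>
        + (\<Sum>k<n. \<bar>g (T k \<omega>) - h (T k \<omega>)\<bar>) / real n + (\<integral>\<omega>. \<bar>g \<omega> - h \<omega>\<bar> \<partial>M)" for \<omega>
    proof -
      have "\<bar>(\<Sum>k<n. g (T k \<omega>)) / real n - (\<Sum>k<n. h (T k \<omega>)) / real n\<bar>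
        = \<bar>\<Sum>k<n. g (T k \<omega>) - h (T k \<omega>)\<bar> / real n"
        by (simp add: sum_subtractf diff_divide_distrib [symmetric])
      also have "\<dots> \<le> (\<Sum>k<n. \<bar>g (T k \<omega>) - h (T k \<omega>)\<bar>) / real n"
        by (intro divide_right_mono sum_abs) auto
      finally have 1: "\<bar>(\<Sum>k<n. g (T k \<omega>)) / real n - (\<Sum>k<n. h (T k \<omega>)) / real n\<bar>
        \<le> (\<Sum>k<n. \<bar>g (T k \<omega>) - h (T k \<omega>)\<bar>) / real n" .
      have "\<bar>(\<integral>\<omega>. g \<omega> \<partial>M) - (\<integral>\<omega>. h \<omega> \<partial>M)\<bar> = \<bar>\<integral>\<omega>. g \<omega> - h \<omega> \<partial>M\<bar>"
        using igh by simp
      also have "\<dots> \<le> (\<integral>\<omega>. \<bar>g \<omega> - h \<omega>\<bar> \<partial>M)"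
        by (rule integral_abs_bound)
      finally show ?thesis using 1 by linarith
    qed
    have "?g n \<le> (\<integral>\<omega>. \<bar>(\<Sum>k<n. h (T k \<omega>)) / real n - (\<integral>\<omega>. h \<omega> \<partial>M)\<bar>
        + (\<Sum>k<n. \<bar>g (T k \<omega>) - h (T k \<omega>)\<bar>) / real n + (\<integral>\<omega>. \<bar>g \<omega> - h \<omega>\<bar> \<partial>M) \<partial>M)"
      using ih ig by (intro integral_mono ptw) auto
    also have "\<dots> = ?h n + (\<Sum>k<n. \<integral>\<omega>. \<bar>g (T k \<omega>) - h (T k \<omega>)\<bar> \<partial>M) / real n + (\<integral>\<omega>. \<bar>g \<omega> - h \<omega>\<bar> \<partial>M)"
      using ih ig by (simp add: prob_space)
    also have "(\<Sum>k<n. \<integral>\<omega>. \<bar>g (T k \<omega>) - h (T k \<omega>)\<bar> \<partial>M) = real n * (\<integral>\<omega>. \<bar>g \<omega> - h \<omega>\<bar> \<partial>M)"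
      using igh by (subst integral_comp_T [where g = "\<lambda>\<omega>. \<bar>g \<omega> - h \<omega>\<bar>"]) auto
    finally show ?thesis using that by simp
  qed
  show "\<exists>N. \<forall>n\<ge>N. norm (?g n - 0) < \<epsilon>"
  proof (intro exI allI impI)
    fix n assume n: "n \<ge> max N 1"
    then have "?g n < \<epsilon>" using bound [of n] N [of n] h(3) by auto
    then show "norm (?g n - 0) < \<epsilon>" by simp
  qed
qed

text \<open>If the correlations of an event with its translates vanish beyond a finite range, the
  variance of the sum of \<open>n\<close> translates is of order \<open>n\<close>, hence the mean converges even in \<open>L\<^sup>2\<close>.\<close>

lemma L1_mean_converges_indicator:
  assumes semigroup: "\<And>k l \<omega>. T (k + l) \<omega> = T l (T k \<omega>)"
    and A [measurable]: "A \<in> sets M"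
    and fin: "finite {k. prob (T 0 -` A \<inter> T k -` A \<inter> space M) \<noteq> (prob A)\<^sup>2}"
  shows "L1_mean_converges M T (indicator A)"
proof -
  define N where "N = {k. prob (T 0 -` A \<inter> T k -` A \<inter> space M) \<noteq> (prob A)\<^sup>2}"
  define V where "V k \<omega> = indicator A (T k \<omega>) - prob A" for k \<omega>
  have V [measurable]: "V k \<in> borel_measurable M" for k
    unfolding V_def by measurable
  have V1: "\<bar>V k \<omega>\<bar> \<le> 1" for k \<omega>
    using prob_le_1 [of A] measure_nonneg [of M A]
    by (auto simp: V_def indicator_def abs_if simp del: measure_nonneg prob_le_1)
  have iV: "integrable M (\<lambda>\<omega>. V k \<omega> * V l \<omega>)" for k l
    using V1 by (intro integrable_const_bound [of _ 1]) (auto simp: abs_mult mult_le_one)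
  have EI: "(\<integral>\<omega>. indicator A (T k \<omega>) \<partial>M) = prob A" for k
    by (subst integral_comp_T) auto
  have iI: "integrable M (\<lambda>\<omega>. indicator A (T k \<omega>) :: real)" for k
    by (rule integrable_const_bound [of _ 1]) auto
  have iII: "integrable M (\<lambda>\<omega>. indicator A (T k \<omega>) * indicator A (T l \<omega>) :: real)" for k l
    by (rule integrable_const_bound [of _ 1]) (auto simp: indicator_def)
  have cov0: "(\<integral>\<omega>. V 0 \<omega> * V k \<omega> \<partial>M) = 0" if "k \<notin> N" for k
  proof -
    have "(\<integral>\<omega>. V 0 \<omega> * V k \<omega> \<partial>M)
      = (\<integral>\<omega>. indicator A (T 0 \<omega>) * indicator A (T k \<omega>) - prob A * indicator A (T 0 \<omega>)
          - prob A * indicator A (T k \<omega>) + prob A * prob A \<partial>M)"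
      by (intro Bochner_Integration.integral_cong) (auto simp: V_def algebra_simps)
    also have "\<dots> = (\<integral>\<omega>. indicator A (T 0 \<omega>) * indicator A (T k \<omega>) \<partial>M) - prob A * prob A"
      using iI iII by (simp add: EI prob_space)
    also have "(\<integral>\<omega>. indicator A (T 0 \<omega>) * indicator A (T k \<omega>) \<partial>M)
      = (\<integral>\<omega>. indicat_real (T 0 -` A \<inter> T k -` A \<inter> space M) \<omega> \<partial>M)"
      by (intro Bochner_Integration.integral_cong) (auto simp: indicator_def)
    also have "\<dots> = prob (T 0 -` A \<inter> T k -` A \<inter> space M)"
      by (subst Bochner_Integration.integral_indicator) (auto simp: Int_assoc intro!: sets.Int)
    finally show ?thesis using that by (simp add: N_def power2_eq_square)
  qed
  have cov: "(\<integral>\<omega>. V k \<omega> * V l \<omega> \<partial>M) \<le> (if \<bar>int k - int l\<bar> \<in> int ` N then 1 else 0)" for k l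
  proof -
    have le: "(\<integral>\<omega>. V k \<omega> * V l \<omega> \<partial>M) \<le> (if l - k \<in> N then 1 else 0)" if "k \<le> l" for k l
    proof -
      have eq: "V k \<omega> * V l \<omega> = V 0 (T k \<omega>) * V (l - k) (T k \<omega>)" for \<omega>
      proof -
        have "T 0 (T k \<omega>) = T k \<omega>" "T (l - k) (T k \<omega>) = T l \<omega>"
          using semigroup [of k 0 \<omega>, symmetric] semigroup [of k "l - k" \<omega>, symmetric] that by simp_all
        then show ?thesis by (simp add: V_def)
      qed
      have "(\<integral>\<omega>. V k \<omega> * V l \<omega> \<partial>M) = (\<integral>\<omega>. V 0 \<omega> * V (l - k) \<omega> \<partial>M)"
        unfolding eq by (subst integral_comp_T [where g = "\<lambda>\<omega>. V 0 \<omega> * V (l - k) \<omega>"]) auto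
      moreover have "(\<integral>\<omega>. V 0 \<omega> * V (l - k) \<omega> \<partial>M) \<le> (\<integral>\<omega>. 1 \<partial>M)"
        by (intro integral_mono iV) (auto intro: order.trans [OF abs_ge_self] simp: abs_mult V1 mult_le_one)
      ultimately show ?thesis using cov0 [of "l - k"] by (auto simp: prob_space)
    qed
    show ?thesis
    proof (cases "k \<le> l")
      case True
      then have "\<bar>int k - int l\<bar> = int (l - k)" by simp
      with le [OF True] show ?thesis by (simp add: inj_image_mem_iff del: of_nat_diff)
    next
      case False
      then have "\<bar>int k - int l\<bar> = int (k - l)" by simp
      with le [of l k] False show ?thesis by (simp add: inj_image_mem_iff mult.commute del: of_nat_diff)
    qed
  qed
  have card: "(\<Sum>l<n. if \<bar>int k - int l\<bar> \<in> int ` N then 1 else 0) \<le> 2 * real (card N)" for k n :: nat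
  proof -
    have finN: "finite N" using fin by (simp add: N_def)
    have sub: "{l \<in> {..<n}. \<bar>int k - int l\<bar> \<in> int ` N} \<subseteq> (\<lambda>m. k + m) ` N \<union> (\<lambda>m. k - m) ` N"
    proof safe
      fix l m assume "\<bar>int k - int l\<bar> = int m" "m \<in> N" "l \<notin> (\<lambda>m. k - m) ` N"
      then show "l \<in> (\<lambda>m. k + m) ` N"
        by (cases "l \<le> k") (auto simp: image_iff intro!: bexI [of _ m])
    qed
    have "(\<Sum>l<n. if \<bar>int k - int l\<bar> \<in> int ` N then 1 else 0)
      = real (card {l \<in> {..<n}. \<bar>int k - int l\<bar> \<in> int ` N})"
      by (simp add: sum.If_cases Int_def)
    also have "\<dots> \<le> real (card ((\<lambda>m. k + m) ` N \<union> (\<lambda>m. k - m) ` N))"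
      using finN by (intro of_nat_mono card_mono sub) auto
    also have "\<dots> \<le> real (card N + card N)"
      by (intro of_nat_mono order.trans [OF card_Un_le] add_mono card_image_le finN)
    finally show ?thesis by simp
  qed
  have L2: "(\<integral>\<omega>. (\<Sum>k<n. V k \<omega>)\<^sup>2 \<partial>M) \<le> real n * (2 * real (card N))" for n
  proof -
    have "(\<integral>\<omega>. (\<Sum>k<n. V k \<omega>)\<^sup>2 \<partial>M) = (\<Sum>k<n. \<Sum>l<n. \<integral>\<omega>. V k \<omega> * V l \<omega> \<partial>M)"
      using iV by (simp add: power2_eq_square sum_product)
    also have "\<dots> \<le> (\<Sum>k<n. \<Sum>l<n. if \<bar>int k - int l\<bar> \<in> int ` N then 1 else 0)"
      by (intro sum_mono cov)
    also have "\<dots> \<le> (\<Sum>k<n. 2 * real (card N))"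
      by (intro sum_mono card)
    finally show ?thesis by simp
  qed
  have bound: "(\<integral>\<omega>. \<bar>(\<Sum>k<n. indicator A (T k \<omega>)) / real n - prob A\<bar> \<partial>M)
    \<le> sqrt (2 * real (card N) / real n)" if n: "n > 0" for n
  proof -
    let ?Y = "\<lambda>\<omega>. \<bar>\<Sum>k<n. V k \<omega>\<bar>"
    have Y: "\<bar>?Y \<omega>\<bar> \<le> real n" for \<omega>
      using order.trans [OF sum_abs sum_mono [of "{..<n}" "\<lambda>k. \<bar>V k \<omega>\<bar>" "\<lambda>_. 1"]] V1 by simp
    have Y2: "(?Y \<omega>)\<^sup>2 \<le> (real n)\<^sup>2" for \<omega>
      using Y [of \<omega>] by (intro power_mono) auto
    have iY: "integrable M ?Y" "integrable M (\<lambda>\<omega>. (?Y \<omega>)\<^sup>2)"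
    proof -
      show "integrable M ?Y" using Y by (intro integrable_const_bound [of _ "real n"]) auto
      show "integrable M (\<lambda>\<omega>. (?Y \<omega>)\<^sup>2)" using Y2 by (intro integrable_const_bound [of _ "(real n)\<^sup>2"]) auto
    qed
    have "(expectation ?Y)\<^sup>2 \<le> expectation (\<lambda>\<omega>. (?Y \<omega>)\<^sup>2)"
      using variance_positive [of ?Y] variance_eq [OF iY] by simp
    also have "\<dots> \<le> real n * (2 * real (card N))"
      using L2 [of n] by simp
    finally have "expectation ?Y \<le> sqrt (real n * (2 * real (card N)))"
      by (rule real_le_rsqrt)
    then have "expectation ?Y / real n \<le> sqrt (real n * (2 * real (card N))) / real n"
      by (rule divide_right_mono) simp
    also have "\<dots> = sqrt (2 * real (card N) / real n)"
    proof -
      have "real n * (2 * real (card N)) / (real n)\<^sup>2 = 2 * real (card N) / real n"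
        using n by (simp add: power2_eq_square)
      then show ?thesis by (metis real_sqrt_divide real_sqrt_abs abs_of_nat)
    qed
    also have "expectation ?Y / real n
      = (\<integral>\<omega>. \<bar>(\<Sum>k<n. indicator A (T k \<omega>)) / real n - prob A\<bar> \<partial>M)"
    proof -
      have "(\<Sum>k<n. V k \<omega>) / real n = (\<Sum>k<n. indicator A (T k \<omega>)) / real n - prob A" for \<omega>
        using n by (simp add: V_def sum_subtractf diff_divide_distrib)
      then have "?Y \<omega> / real n = \<bar>(\<Sum>k<n. indicator A (T k \<omega>)) / real n - prob A\<bar>" for \<omega>
        using n by (metis abs_divide abs_of_nat)
      then show ?thesis by (simp flip: integral_divide_zero)
    qed
    finally show ?thesis .
  qed
  have "(\<lambda>n. sqrt (2 * real (card N) / real n)) \<longlonglongrightarrow> sqrt 0"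
    by (intro tendsto_real_sqrt lim_const_over_n)
  then have lim: "(\<lambda>n. sqrt (2 * real (card N) / real n)) \<longlonglongrightarrow> 0" by simp
  show ?thesis
    unfolding L1_mean_converges_def
  proof (rule tendsto_sandwich [OF _ _ tendsto_const lim])
    show "\<forall>\<^sub>F n in sequentially. (\<integral>\<omega>. \<bar>(\<Sum>k<n. indicator A (T k \<omega>)) / real n
        - (\<integral>\<omega>. indicator A \<omega> \<partial>M)\<bar> \<partial>M) \<le> sqrt (2 * real (card N) / real n)"
      using eventually_gt_at_top [of 0] by eventually_elim (use bound in simp)
  qed simp
qed

text \<open>The functions whose means converge form an \<open>L\<^sup>1\<close>-closed linear space, so the events among them form a
  Dynkin system; it contains the generator because events of the generator decorrelate.\<close>

theorem L1_mean_ergodic: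
  assumes semigroup: "\<And>k l \<omega>. T (k + l) \<omega> = T l (T k \<omega>)"
    and G: "Int_stable G" "G \<subseteq> Pow (space M)" "sets M = sigma_sets (space M) G"
    and mixing: "\<And>A. A \<in> G \<Longrightarrow> finite {k. prob (T 0 -` A \<inter> T k -` A \<inter> space M) \<noteq> (prob A)\<^sup>2}"
    and g: "integrable M g"
  shows "L1_mean_converges M T g"
  using g
proof (induction rule: integrable_induct)
  case (base A c)
  have "L1_mean_converges M T (indicator A)" if "A \<in> sigma_sets (space M) G" for A
    using G(1,2) that
  proof (induction rule: sigma_sets_induct_disjoint)
    case (basic A)
    then show ?case using G(3) by (intro L1_mean_converges_indicator semigroup mixing) auto
  next
    case empty
    show ?case using L1_mean_converges_const [of 0] by simp
  next
    case (compl A)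
    have [measurable]: "A \<in> sets M" using compl G(3) by simp
    have "integrable M (indicat_real A)"
      by (rule integrable_const_bound [of _ 1]) auto
    then have "L1_mean_converges M T (\<lambda>\<omega>. 1 + (- 1) * indicator A \<omega>)"
      by (intro L1_mean_converges_add L1_mean_converges_const L1_mean_converges_scale compl) auto
    moreover have "(1 + (- 1) * indicator A \<omega> :: real) = indicator (space M - A) \<omega>" if "\<omega> \<in> space M" for \<omega>
      using that by (auto simp: indicator_def)
    ultimately show ?case
      using measurable_space [OF T_measurable]
      by (simp add: L1_mean_converges_def cong: Bochner_Integration.integral_cong)
  next
    case (union A)
    have A [measurable]: "A i \<in> sets M" for i using union(2) G(3) by auto
    let ?U = "\<Union>i. A i"
    have iA: "integrable M (indicat_real (A i))" for i
      by (rule integrable_const_bound [of _ 1]) auto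
    have iU: "integrable M (indicat_real ?U)"
      by (rule integrable_const_bound [of _ 1]) auto
    have partial: "L1_mean_converges M T (\<lambda>\<omega>. \<Sum>i<n. indicator (A i) \<omega>)" for n
    proof (induction n)
      case 0 show ?case using L1_mean_converges_const [of 0] by simp
    next
      case (Suc n)
      then show ?case
        using union(3) iA by (auto intro!: L1_mean_converges_add)
    qed
    show ?case
    proof (rule L1_mean_converges_closed)
      fix \<epsilon> :: real assume "\<epsilon> > 0"
      have "(\<lambda>n. \<Sum>i<n. prob (A i)) \<longlonglongrightarrow> prob ?U"
        using finite_measure_UNION [OF image_subsetI union(1)] A by (auto simp: sums_def)
      then obtain n where n: "\<bar>(\<Sum>i<n. prob (A i)) - prob ?U\<bar> < \<epsilon>"
        using LIMSEQ_D [of _ _ \<epsilon>] \<open>\<epsilon> > 0\<close> by fastforce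
      have le: "(\<Sum>i<n. indicator (A i) \<omega>) \<le> (indicator ?U \<omega> :: real)" for \<omega>
      proof -
        have "(\<Sum>i<n. indicator (A i) \<omega>) = (indicator (\<Union>i<n. A i) \<omega> :: real)"
          by (rule indicator_UN_disjoint [symmetric]) (auto intro: disjoint_family_on_mono [OF _ union(1)])
        also have "\<dots> \<le> indicator ?U \<omega>" by (auto simp: indicator_def)
        finally show ?thesis .
      qed
      have "(\<integral>\<omega>. \<bar>indicat_real ?U \<omega> - (\<Sum>i<n. indicator (A i) \<omega>)\<bar> \<partial>M)
        = (\<integral>\<omega>. indicat_real ?U \<omega> - (\<Sum>i<n. indicator (A i) \<omega>) \<partial>M)"
        using le by (intro Bochner_Integration.integral_cong) auto
      also have "\<dots> = prob ?U - (\<Sum>i<n. prob (A i))"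
        using iA iU by simp
      finally have "(\<integral>\<omega>. \<bar>indicat_real ?U \<omega> - (\<Sum>i<n. indicator (A i) \<omega>)\<bar> \<partial>M) < \<epsilon>" using n by simp
      then show "\<exists>h. integrable M h \<and> L1_mean_converges M T h \<and> (\<integral>\<omega>. \<bar>indicator ?U \<omega> - h \<omega>\<bar> \<partial>M) < \<epsilon>"
        using partial iA by (intro exI [of _ "\<lambda>\<omega>. \<Sum>i<n. indicator (A i) \<omega>"]) auto
    qed (rule iU)
  qed
  from L1_mean_converges_scale [OF this, of A c] base(1) G(3) show ?case by (simp add: mult.commute)
next
  case (add f g)
  then show ?case by (intro L1_mean_converges_add)
next
  case (lim f s)
  show ?case
  proof (rule L1_mean_converges_closed)
    fix \<epsilon> :: real assume "\<epsilon> > 0"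
    have [measurable]: "f \<in> borel_measurable M" "s i \<in> borel_measurable M" for i
      using lim by auto
    have "(\<lambda>i. \<integral>\<omega>. \<bar>f \<omega> - s i \<omega>\<bar> \<partial>M) \<longlonglongrightarrow> (\<integral>\<omega>. 0 \<partial>M)"
    proof (rule integral_dominated_convergence [where w = "\<lambda>\<omega>. 3 * \<bar>f \<omega>\<bar>"])
      show "AE \<omega> in M. (\<lambda>i. \<bar>f \<omega> - s i \<omega>\<bar>) \<longlonglongrightarrow> 0"
      proof (rule AE_I2)
        fix \<omega> assume "\<omega> \<in> space M"
        then have "(\<lambda>i. \<bar>f \<omega> - s i \<omega>\<bar>) \<longlonglongrightarrow> \<bar>f \<omega> - f \<omega>\<bar>"
          by (intro tendsto_intros lim)
        then show "(\<lambda>i. \<bar>f \<omega> - s i \<omega>\<bar>) \<longlonglongrightarrow> 0" by simp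
      qed
      show "AE \<omega> in M. norm \<bar>f \<omega> - s i \<omega>\<bar> \<le> 3 * \<bar>f \<omega>\<bar>" for i
      proof (rule AE_I2)
        fix \<omega> assume "\<omega> \<in> space M"
        then have "norm (s i \<omega>) \<le> 2 * norm (f \<omega>)" using lim by blast
        then show "norm \<bar>f \<omega> - s i \<omega>\<bar> \<le> 3 * \<bar>f \<omega>\<bar>" by simp
      qed
    qed (use lim in auto)
    then obtain i where "(\<integral>\<omega>. \<bar>f \<omega> - s i \<omega>\<bar> \<partial>M) < \<epsilon>"
      using LIMSEQ_D [of _ _ \<epsilon>] \<open>\<epsilon> > 0\<close> by fastforce
    then show "\<exists>h. integrable M h \<and> L1_mean_converges M T h \<and> (\<integral>\<omega>. \<bar>f \<omega> - h \<omega>\<bar> \<partial>M) < \<epsilon>"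
      using lim by blast
  qed (use lim in auto)
qed

end

section \<open>Stationary environments and long-range percolation\<close>

lemma space_env_algebra [simp]: "space env_algebra = UNIV"
  by (auto simp: env_algebra_def space_PiM)

lemma measurable_component_env [measurable]: "(\<lambda>\<omega>. \<omega> e) \<in> borel_measurable env_algebra"
  unfolding env_algebra_def by (rule measurable_component_singleton) simp

lemma measurable_cond [measurable]: "(\<lambda>\<omega>. cond \<omega> x y) \<in> borel_measurable env_algebra"
  unfolding cond_def by measurable

lemma measurable_env_shift [measurable]: "env_shift z \<in> measurable env_algebra env_algebra"
proof -
  have "env_shift z \<in> measurable env_algebra (\<Pi>\<^sub>M e\<in>UNIV. borel)"
    unfolding env_shift_def by (rule measurable_abs_UNIV) (rule measurable_component_env)
  then show ?thesis by (simp add: env_algebra_def)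
qed

lemma cond_commute: "cond \<omega> x y = cond \<omega> y x"
proof -
  have "Upair x y = Upair y x" by simp
  then show ?thesis unfolding cond_def by (rule arg_cong)
qed

lemma cond_env_shift [simp]: "cond (env_shift z \<omega>) x y = cond \<omega> (x + z) (y + z)"
  by (simp add: cond_def env_shift_def)

lemma env_shift_env_shift [simp]: "env_shift z (env_shift w \<omega>) = env_shift (z + w) \<omega>"
  by (simp add: env_shift_def uprod.map_comp o_def add.assoc)

lemma env_shift_0 [simp]: "env_shift 0 \<omega> = \<omega>"
  by (simp add: env_shift_def uprod.map_ident)

text \<open>The properties of percolation on which the corrector rests. Ergodicity enters only through the
  mean ergodic theorem along the coordinate axes.\<close>

locale random_environment = prob_space P for P :: "('d::finite) env measure" +
  assumes sets_P: "sets P = sets env_algebra"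
    and shift_invariant: "distr P env_algebra (env_shift z) = P"
    and conductances_01: "AE \<omega> in P. \<forall>x y. cond \<omega> x y = 0 \<or> cond \<omega> x y = 1"
    and nearest_neighbours_open: "AE \<omega> in P. \<forall>x y. l1 (y - x) = 1 \<longrightarrow> cond \<omega> x y = 1"
    and second_moment: "(\<lambda>z. prob {\<omega> \<in> space P. cond \<omega> 0 z = 1} * (l1 z)\<^sup>2) summable_on UNIV"
    and mean_ergodic: "integrable P g \<Longrightarrow> L1_mean_converges P (\<lambda>k. env_shift (axis i (int k))) g"

text \<open>The two prescribed probabilities add up to 1, so no mass is left for other values.\<close>

lemma (in prob_space) prob_vimage_01:
  assumes X [measurable]: "X \<in> borel_measurable M"
    and 1: "prob {\<omega> \<in> space M. X \<omega> = (1::real)} = q" and 0: "prob {\<omega> \<in> space M. X \<omega> = 0} = 1 - q"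
    and A [measurable]: "A \<in> sets borel"
  shows "prob (X -` A \<inter> space M) = q * indicator A 1 + (1 - q) * indicator A 0"
    and "AE \<omega> in M. X \<omega> = 0 \<or> X \<omega> = 1"
proof -
  have "prob ({\<omega> \<in> space M. X \<omega> = 1} \<union> {\<omega> \<in> space M. X \<omega> = 0}) = 1"
    by (subst finite_measure_Union) (auto simp: 1 0)
  then have "AE \<omega> in M. \<omega> \<in> {\<omega> \<in> space M. X \<omega> = 1} \<union> {\<omega> \<in> space M. X \<omega> = 0}"
    by (subst (asm) prob_eq_1) auto
  then show ae: "AE \<omega> in M. X \<omega> = 0 \<or> X \<omega> = 1" by eventually_elim auto
  have "prob (X -` A \<inter> space M)
    = prob ((if 1 \<in> A then {\<omega> \<in> space M. X \<omega> = 1} else {}) \<union> (if 0 \<in> A then {\<omega> \<in> space M. X \<omega> = 0} else {}))"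
    using ae by (intro finite_measure_eq_AE) (auto split: if_splits)
  also have "\<dots> = prob (if 1 \<in> A then {\<omega> \<in> space M. X \<omega> = 1} else {})
      + prob (if 0 \<in> A then {\<omega> \<in> space M. X \<omega> = 0} else {})"
    by (rule finite_measure_Union) auto
  also have "\<dots> = q * indicator A 1 + (1 - q) * indicator A 0"
    by (simp add: 1 0)
  finally show "prob (X -` A \<inter> space M) = q * indicator A 1 + (1 - q) * indicator A 0" .
qed

locale percolation =
  fixes p :: "int ^ ('d::finite) \<Rightarrow> real" and P :: "('d::finite) env measure"
  assumes percolation: "long_range_percolation p P"
begin

sublocale prob_space P
  using percolation by (simp add: long_range_percolation_def)

lemma sets_P [measurable_cong]: "sets P = sets env_algebra"
  using percolation by (simp add: long_range_percolation_def)

lemma space_P [simp]: "space P = UNIV"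
  using sets_eq_imp_space_eq [OF sets_P] by simp

lemma indep: "indep_vars (\<lambda>_. borel) (\<lambda>e \<omega>. \<omega> e) UNIV"
  using percolation by (simp add: long_range_percolation_def)

lemma prob_open: "prob {\<omega>. cond \<omega> x y = 1} = p (y - x)"
  and prob_closed: "prob {\<omega>. cond \<omega> x y = 0} = 1 - p (y - x)"
  using percolation by (auto simp: long_range_percolation_def)

lemma AE_01: "AE \<omega> in P. \<forall>x y. cond \<omega> x y = 0 \<or> cond \<omega> x y = 1"
  unfolding AE_all_countable
proof (intro allI)
  fix x y :: "int ^ 'd"
  show "AE \<omega> in P. cond \<omega> x y = 0 \<or> cond \<omega> x y = 1"
    by (rule prob_vimage_01 (2) [where X = "\<lambda>\<omega>. cond \<omega> x y" and A = "{}" and q = "p (y - x)"])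
      (simp_all add: prob_open prob_closed)
qed

lemma distr_edge_shift:
  "distr P borel (\<lambda>\<omega>. \<omega> (map_uprod (\<lambda>x. x + z) e)) = distr P borel (\<lambda>\<omega>. \<omega> e)"
proof (rule measure_eqI)
  fix A assume "A \<in> sets (distr P borel (\<lambda>\<omega>. \<omega> (map_uprod (\<lambda>x. x + z) e)))"
  then have A [measurable]: "A \<in> sets borel" by simp
  obtain x y where e: "e = Upair x y" by (cases e)
  have "prob ((\<lambda>\<omega>. \<omega> (Upair x y)) -` A \<inter> space P) = p (y - x) * indicator A 1 + (1 - p (y - x)) * indicator A 0" for x y
    using prob_open [of x y] prob_closed [of x y]
    by (intro prob_vimage_01) (auto simp: cond_def)
  from this [of x y] this [of "x + z" "y + z"]
  show "emeasure (distr P borel (\<lambda>\<omega>. \<omega> (map_uprod (\<lambda>x. x + z) e))) A = emeasure (distr P borel (\<lambda>\<omega>. \<omega> e)) A"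
    by (simp add: emeasure_distr emeasure_eq_measure e)
qed simp

text \<open>A shift permutes the factors of the product measure \<open>P\<close>, and the law of an edge depends only on
  its displacement.\<close>

lemma distr_env_shift: "distr P env_algebra (env_shift z) = P"
proof -
  let ?\<sigma> = "map_uprod (\<lambda>x. x + z)"
  have inj: "inj ?\<sigma>" by (rule uprod.inj_map) simp
  let ?\<mu> = "\<lambda>e. distr P borel (\<lambda>\<omega>. \<omega> e)"
  have "distr P (\<Pi>\<^sub>M e\<in>UNIV. borel) (\<lambda>\<omega>. \<lambda>e\<in>UNIV. \<omega> e) = (\<Pi>\<^sub>M e\<in>UNIV. ?\<mu> e)"
    using indep by (subst (asm) indep_vars_iff_distr_eq_PiM) auto
  moreover have "distr P (\<Pi>\<^sub>M e\<in>UNIV. borel) (\<lambda>\<omega>. \<lambda>e\<in>UNIV. \<omega> e) = distr P P (\<lambda>\<omega>. \<omega>)"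
    by (intro distr_cong) (simp_all add: sets_P env_algebra_def restrict_def)
  ultimately have P: "(\<Pi>\<^sub>M e\<in>UNIV. ?\<mu> e) = P" by simp
  have "distr (\<Pi>\<^sub>M e\<in>UNIV. ?\<mu> e) (\<Pi>\<^sub>M e\<in>UNIV. ?\<mu> (?\<sigma> e)) (\<lambda>\<omega>. \<lambda>e\<in>UNIV. \<omega> (?\<sigma> e)) = (\<Pi>\<^sub>M e\<in>UNIV. ?\<mu> (?\<sigma> e))"
    using inj by (intro distr_PiM_reindex prob_space_distr) auto
  then have "distr P P (\<lambda>\<omega>. \<lambda>e\<in>UNIV. \<omega> (?\<sigma> e)) = P"
    by (simp only: distr_edge_shift P)
  moreover have "distr P env_algebra (env_shift z) = distr P P (\<lambda>\<omega>. \<lambda>e\<in>UNIV. \<omega> (?\<sigma> e))"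
    by (intro distr_cong) (simp_all add: sets_P env_shift_def restrict_def)
  ultimately show ?thesis by simp
qed

lemma indep_disjoint_edges:
  assumes JK: "J \<inter> K = {}"
    and [measurable]: "A \<in> sets (\<Pi>\<^sub>M e\<in>J. borel)" "B \<in> sets (\<Pi>\<^sub>M e\<in>K. borel)"
  shows "prob {\<omega>. restrict \<omega> J \<in> A \<and> restrict \<omega> K \<in> B} = prob {\<omega>. restrict \<omega> J \<in> A} * prob {\<omega>. restrict \<omega> K \<in> B}"
proof -
  have "indep_var (\<Pi>\<^sub>M e\<in>J. borel) (\<lambda>\<omega>. restrict \<omega> J) (\<Pi>\<^sub>M e\<in>K. borel) (\<lambda>\<omega>. restrict \<omega> K)"
    using indep_var_restrict [OF indep JK] by simp
  from indep_varD [OF this assms(2,3)]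
  show ?thesis by (simp add: vimage_def Int_def)
qed

text \<open>A cylinder event and its translate depend on disjoint sets of edges, unless the translation is
  one of finitely many.\<close>

lemma cylinder_mixing:
  assumes A: "A \<in> prod_algebra UNIV (\<lambda>_::(int ^ 'd) uprod. borel)"
  shows "finite {k. prob (env_shift (axis i (int 0)) -` A \<inter> env_shift (axis i (int k)) -` A \<inter> space P) \<noteq> (prob A)\<^sup>2}"
proof -
  obtain J X where AJ: "A = prod_emb UNIV (\<lambda>_. borel) J (Pi\<^sub>E J X)" and J: "finite J"
    and X [measurable]: "\<And>e. e \<in> J \<Longrightarrow> X e \<in> sets borel"
    using prod_algebraE [OF A] by metis
  have A_eq: "\<omega> \<in> A \<longleftrightarrow> (\<forall>e\<in>J. \<omega> e \<in> X e)" for \<omega>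
    by (auto simp: AJ prod_emb_def PiE_iff)
  then have A_Collect: "{\<omega>. \<forall>e\<in>J. \<omega> e \<in> X e} = A" by blast
  have A_sets [measurable]: "A \<in> sets P"
    using A by (simp add: sets_P env_algebra_def sets_PiM)
  let ?\<sigma> = "\<lambda>k::nat. map_uprod (\<lambda>x. x + axis i (int k)) :: (int ^ 'd) uprod \<Rightarrow> _"
  have "finite {k. ?\<sigma> k e = e'}" for e e'
  proof -
    obtain x y where e: "e = Upair x y" by (cases e)
    have "{k. ?\<sigma> k e = e'} \<subseteq> (\<lambda>k. x + axis i (int k)) -` set_uprod e' \<inter> UNIV"
      by (auto simp: e)
    moreover have "inj (\<lambda>k. x + axis i (int k))"
      by (auto simp: inj_on_def axis_eq_axis)
    ultimately show ?thesis
      by (meson finite_set_uprod finite_subset finite_vimage_IntI)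
  qed
  then have "finite (\<Union>e\<in>J. \<Union>e'\<in>J. {k. ?\<sigma> k e = e'})" using J by blast
  moreover have "{k. prob (env_shift (axis i (int 0)) -` A \<inter> env_shift (axis i (int k)) -` A \<inter> space P) \<noteq> (prob A)\<^sup>2}
    \<subseteq> (\<Union>e\<in>J. \<Union>e'\<in>J. {k. ?\<sigma> k e = e'})"
  proof (rule ccontr)
    assume "\<not> ?thesis"
    then obtain k where k: "prob (env_shift (axis i (int 0)) -` A \<inter> env_shift (axis i (int k)) -` A \<inter> space P) \<noteq> (prob A)\<^sup>2"
      and notin: "k \<notin> (\<Union>e\<in>J. \<Union>e'\<in>J. {k. ?\<sigma> k e = e'})" by blast
    from notin have disj: "J \<inter> ?\<sigma> k ` J = {}" by blast
    have zero: "axis i (0::int) = 0"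
      by (simp add: axis_def vec_eq_iff)
    let ?K = "?\<sigma> k ` J"
    let ?B = "{f \<in> space (\<Pi>\<^sub>M e\<in>?K. borel). \<forall>e\<in>J. f (?\<sigma> k e) \<in> X e}"
    have K_borel: "(\<lambda>f. f (?\<sigma> k e)) \<in> borel_measurable (\<Pi>\<^sub>M e\<in>?K. borel)" if "e \<in> J" for e
      using that by (intro measurable_component_singleton) auto
    have B: "?B \<in> sets (\<Pi>\<^sub>M e\<in>?K. borel)"
    proof (rule sets.sets_Collect_finite_All [OF _ J])
      fix e assume "e \<in> J"
      then show "{f \<in> space (\<Pi>\<^sub>M e\<in>?K. borel). f (?\<sigma> k e) \<in> X e} \<in> sets (\<Pi>\<^sub>M e\<in>?K. borel)"
        using measurable_sets [OF K_borel X] by (simp add: vimage_def Int_def conj_commute)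
    qed
    have "Pi\<^sub>E J X \<in> sets (\<Pi>\<^sub>M e\<in>J. borel)"
      using J X by (intro sets_PiM_I_finite) auto
    from indep_disjoint_edges [OF disj this B]
    have "prob {\<omega>. \<omega> \<in> A \<and> env_shift (axis i (int k)) \<omega> \<in> A} = prob A * prob {\<omega>. env_shift (axis i (int k)) \<omega> \<in> A}"
      by (simp add: A_eq A_Collect env_shift_def space_PiM PiE_iff Collect_conj_eq cong: ball_cong)
    also have "prob {\<omega>. env_shift (axis i (int k)) \<omega> \<in> A} = prob A"
    proof -
      have "measure (distr P env_algebra (env_shift (axis i (int k)))) A = prob (env_shift (axis i (int k)) -` A \<inter> space P)"
        using A_sets by (intro measure_distr) (auto simp: sets_P)
      then show ?thesis by (simp add: distr_env_shift vimage_def)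
    qed
    finally show False
      using k zero by (simp add: power2_eq_square vimage_def Int_def)
  qed
  ultimately show ?thesis by (rule rev_finite_subset)
qed

lemma mean_ergodic:
  assumes "integrable P g"
  shows "L1_mean_converges P (\<lambda>k. env_shift (axis i (int k))) g"
proof -
  have "env_shift z \<in> measurable P P" for z
    using measurable_env_shift measurable_cong_sets [OF sets_P sets_P] by blast
  moreover have "distr P P (env_shift z) = P" for z
  proof -
    have "distr P P (env_shift z) = distr P env_algebra (env_shift z)"
      by (rule distr_cong) (simp_all add: sets_P)
    then show ?thesis by (simp add: distr_env_shift)
  qed
  ultimately interpret measure_preserving_iterates P "\<lambda>k. env_shift (axis i (int k))"
    by unfold_locales
  show ?thesis
  proof (rule L1_mean_ergodic [OF _ Int_stable_prod_algebra _ _ cylinder_mixing assms])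
    show "env_shift (axis i (int (k + l))) \<omega> = env_shift (axis i (int l)) (env_shift (axis i (int k)) \<omega>)" for k l \<omega>
    proof -
      have "axis i (int (k + l)) = axis i (int l) + axis i (int k)"
        by (simp add: axis_def vec_eq_iff)
      then show ?thesis by (simp only: env_shift_env_shift)
    qed
  qed (auto simp: sets_P env_algebra_def sets_PiM)
qed

lemma random_environment_percolation:
  assumes p_nn: "\<And>x. lnorm x = 1 \<Longrightarrow> p x = 1"
    and moment: "(\<lambda>x. p x * (l1 x)\<^sup>2) summable_on UNIV"
  shows "random_environment P"
proof
  show "sets P = sets env_algebra" by (rule sets_P)
  show "distr P env_algebra (env_shift z) = P" for z by (rule distr_env_shift)
  show "AE \<omega> in P. \<forall>x y. cond \<omega> x y = 0 \<or> cond \<omega> x y = 1" by (rule AE_01)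
  show "AE \<omega> in P. \<forall>x y. l1 (y - x) = 1 \<longrightarrow> cond \<omega> x y = 1"
    unfolding AE_all_countable
  proof (intro allI)
    fix x y :: "int ^ 'd"
    show "AE \<omega> in P. l1 (y - x) = 1 \<longrightarrow> cond \<omega> x y = 1"
    proof (cases "l1 (y - x) = 1")
      case True
      then have "prob {\<omega>. cond \<omega> x y = 1} = 1"
        by (simp only: prob_open p_nn lnorm_eq_1_if_l1)
      then have "AE \<omega> in P. \<omega> \<in> {\<omega>. cond \<omega> x y = 1}"
        using measurable_sets [OF measurable_cond, of "{1}" x y]
        by (subst (asm) prob_eq_1) (auto simp: sets_P vimage_def)
      then show ?thesis by simp
    qed simp
  qed
  show "(\<lambda>z. prob {\<omega> \<in> space P. cond \<omega> 0 z = 1} * (l1 z)\<^sup>2) summable_on UNIV"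
    using moment by (simp add: prob_open)
  show "L1_mean_converges P (\<lambda>k. env_shift (axis i (int k))) g" if "integrable P g" for g i
    using that by (rule mean_ergodic)
qed

end

section \<open>The measure of the open edges at the origin\<close>

lemma AE_pair_count_space:
  fixes Q :: "'a \<Rightarrow> 'b::countable \<Rightarrow> bool"
  assumes "sigma_finite_measure M" and ae: "\<And>z. AE \<omega> in M. Q \<omega> z"
  shows "AE x in M \<Otimes>\<^sub>M count_space UNIV. Q (fst x) (snd x)"
proof -
  interpret sigma_finite_measure M by fact
  interpret C: sigma_finite_measure "count_space (UNIV :: 'b set)"
    by (rule sigma_finite_measure_count_space_countable) simp
  interpret pair_sigma_finite M "count_space (UNIV :: 'b set)" ..
  have "\<exists>N. N \<in> null_sets M \<and> (\<forall>\<omega>\<in>space M. \<not> Q \<omega> z \<longrightarrow> \<omega> \<in> N)" for z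
    using ae [of z] by (auto elim!: AE_E3)
  then obtain N where N: "\<And>z. N z \<in> null_sets M" "\<And>z. \<forall>\<omega>\<in>space M. \<not> Q \<omega> z \<longrightarrow> \<omega> \<in> N z"
    by metis
  then have [measurable]: "N z \<in> sets M" for z by auto
  let ?U = "\<Union>z. N z \<times> {z}"
  have "N z \<times> {z} \<in> null_sets (M \<Otimes>\<^sub>M count_space UNIV)" for z
  proof -
    have "emeasure (M \<Otimes>\<^sub>M count_space UNIV) (N z \<times> {z}) = emeasure M (N z) * emeasure (count_space UNIV) {z}"
      by (rule C.emeasure_pair_measure_Times) auto
    then show ?thesis using N(1) [of z] by (auto simp: null_sets_def)
  qed
  then have "?U \<in> null_sets (M \<Otimes>\<^sub>M count_space UNIV)"
    by (intro null_sets_UN) auto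
  moreover have "{x \<in> space (M \<Otimes>\<^sub>M count_space UNIV). \<not> Q (fst x) (snd x)} \<subseteq> ?U"
    using N(2) by (auto simp: space_pair_measure)
  ultimately show ?thesis by (rule AE_I')
qed

lemma measurable_pair_count_space:
  fixes f :: "'a \<times> 'b::countable \<Rightarrow> 'c"
  assumes "\<And>z. (\<lambda>\<omega>. f (\<omega>, z)) \<in> measurable M N"
  shows "f \<in> measurable (M \<Otimes>\<^sub>M count_space UNIV) N"
proof -
  have "(\<lambda>x. f (fst x, snd x)) \<in> measurable (M \<Otimes>\<^sub>M count_space UNIV) N"
    by (rule measurable_compose_countable' [where f = "\<lambda>z x. f (fst x, z)" and g = snd and I = UNIV])
      (auto intro: measurable_compose [OF measurable_fst assms])
  then show ?thesis by simp
qed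

lemma integrable_mult_of_squares:
  fixes f g :: "'a \<Rightarrow> real"
  assumes [measurable]: "f \<in> borel_measurable M" "g \<in> borel_measurable M"
    and "integrable M (\<lambda>x. (f x)\<^sup>2)" "integrable M (\<lambda>x. (g x)\<^sup>2)"
  shows "integrable M (\<lambda>x. f x * g x)"
proof (rule Bochner_Integration.integrable_bound)
  show "integrable M (\<lambda>x. (f x)\<^sup>2 + (g x)\<^sup>2)" using assms by simp
  have "\<bar>a * b\<bar> \<le> a\<^sup>2 + b\<^sup>2" for a b :: real
  proof -
    have "2 * \<bar>a\<bar> * \<bar>b\<bar> \<le> a\<^sup>2 + b\<^sup>2" using sum_squares_bound [of "\<bar>a\<bar>" "\<bar>b\<bar>"] by simp
    moreover have "0 \<le> \<bar>a\<bar> * \<bar>b\<bar>" by simp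
    ultimately show ?thesis unfolding abs_mult by linarith
  qed
  then show "AE x in M. norm (f x * g x) \<le> norm ((f x)\<^sup>2 + (g x)\<^sup>2)"
    by (simp add: abs_of_nonneg)
qed measurable

lemma integrable_add_squares:
  fixes f g :: "'a \<Rightarrow> real"
  assumes [measurable]: "f \<in> borel_measurable M" "g \<in> borel_measurable M"
    and "integrable M (\<lambda>x. (f x)\<^sup>2)" "integrable M (\<lambda>x. (g x)\<^sup>2)"
  shows "integrable M (\<lambda>x. (f x + g x)\<^sup>2)"
  using integrable_mult_of_squares [OF assms] assms by (simp add: power2_sum mult.assoc)

lemma subadditive_le_l1:
  fixes N :: "int ^ 'd::finite \<Rightarrow> real"
  assumes sub: "\<And>x y. N (x + y) \<le> N x + N y" and zero: "N 0 = 0"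
    and unit: "\<And>e. l1 e = 1 \<Longrightarrow> N e \<le> c"
  shows "N x \<le> c * l1 x"
proof (induction "nat \<lfloor>l1 x\<rfloor>" arbitrary: x)
  case 0
  have "l1 x = of_int (\<Sum>i\<in>UNIV. \<bar>x $ i\<bar>)" by simp
  then have "l1 x = of_int \<lfloor>l1 x\<rfloor>" by (metis floor_of_int)
  with 0 have l0: "l1 x = 0" using l1_nonneg [of x] by linarith
  then have "x $ i = 0" for i using abs_component_le_l1 [of x i] by simp
  then have "x = 0" by (simp add: vec_eq_iff)
  then show ?case by (simp add: zero)
next
  case (Suc n)
  have "x \<noteq> 0" using Suc(2) by auto
  then obtain i where i: "x $ i \<noteq> 0" by (auto simp: vec_eq_iff)
  define e :: "int ^ 'd" where "e = axis i (sgn (x $ i))"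
  have l1_split: "l1 y = \<bar>real_of_int (y $ i)\<bar> + (\<Sum>j\<in>UNIV - {i}. \<bar>real_of_int (y $ j)\<bar>)" for y :: "int ^ 'd"
    by (simp add: sum.remove [of UNIV i])
  have "l1 e = 1" using i by (subst l1_split) (simp add: e_def axis_def sgn_if)
  have "l1 (x - e) = l1 x - 1"
    using i by (subst (1 2) l1_split) (simp add: e_def axis_def sgn_if abs_if)
  then have "n = nat \<lfloor>l1 (x - e)\<rfloor>" using Suc(2) by (simp only: ) linarith
  from Suc(1) [OF this] have "N (x - e) \<le> c * (l1 x - 1)"
    by (simp only: \<open>l1 (x - e) = l1 x - 1\<close>)
  then show ?case
    using sub [of "x - e" e] unit [OF \<open>l1 e = 1\<close>] by (simp add: algebra_simps)
qed

context random_environment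
begin

declare sets_P [measurable_cong]

lemma space_P [simp]: "space P = UNIV"
  using sets_eq_imp_space_eq [OF sets_P] by simp

lemma measurable_shift [measurable]: "env_shift z \<in> measurable P P"
  using measurable_env_shift measurable_cong_sets [OF sets_P sets_P] by blast

lemma distr_shift: "distr P P (env_shift z) = P"
proof -
  have "distr P P (env_shift z) = distr P env_algebra (env_shift z)"
    by (rule distr_cong) (simp_all add: sets_P)
  then show ?thesis by (simp add: shift_invariant)
qed

lemma AE_shift:
  assumes "AE \<omega> in P. Q \<omega>"
  shows "AE \<omega> in P. Q (env_shift z \<omega>)"
proof (rule AE_distrD [OF measurable_shift [of z]])
  show "AE \<omega> in distr P P (env_shift z). Q \<omega>"
    unfolding distr_shift by (rule assms)
qed

lemma nn_integral_shift:
  assumes "f \<in> borel_measurable P"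
  shows "(\<integral>\<^sup>+\<omega>. f (env_shift z \<omega>) \<partial>P) = (\<integral>\<^sup>+\<omega>. f \<omega> \<partial>P)"
  using nn_integral_distr [of "env_shift z" P P f] assms by (simp add: distr_shift)

lemma integral_shift:
  fixes f :: "_ \<Rightarrow> real"
  assumes "f \<in> borel_measurable P"
  shows "(\<integral>\<omega>. f (env_shift z \<omega>) \<partial>P) = (\<integral>\<omega>. f \<omega> \<partial>P)"
  using integral_distr [of "env_shift z" P P f] assms by (simp add: distr_shift)

lemma integrable_shift:
  fixes f :: "_ \<Rightarrow> real"
  assumes "integrable P f"
  shows "integrable P (\<lambda>\<omega>. f (env_shift z \<omega>))"
  using integrable_distr [of "env_shift z" P P f] assms by (simp add: distr_shift)

sublocale lattice: sigma_finite_measure "count_space (UNIV :: (int ^ 'd) set)"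
  by (rule sigma_finite_measure_count_space_countable) simp

sublocale pair_sigma_finite P "count_space (UNIV :: (int ^ 'd) set)" ..

abbreviation open_nbrs :: "'d env \<Rightarrow> (int ^ 'd) set" where
  "open_nbrs \<omega> \<equiv> {z. cond \<omega> 0 z = 1}"

text \<open>The measure of the open edges at the origin: a pair stands for an environment and the second
  endpoint of the edge.\<close>

definition edge_measure :: "('d env \<times> (int ^ 'd)) measure" where
  "edge_measure = density (P \<Otimes>\<^sub>M count_space UNIV) (\<lambda>x. ennreal (indicator (open_nbrs (fst x)) (snd x)))"

lemma sets_edge_measure [measurable_cong]: "sets edge_measure = sets (P \<Otimes>\<^sub>M count_space UNIV)"
  by (simp add: edge_measure_def)

lemma borel_measurable_edge:
  assumes "\<And>z. (\<lambda>\<omega>. f (\<omega>, z)) \<in> measurable P N"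
  shows "f \<in> measurable edge_measure N"
  using measurable_pair_count_space [OF assms] measurable_cong_sets [OF sets_edge_measure refl] by blast

lemma measurable_indicator_open [measurable]:
  "(\<lambda>x. indicator (open_nbrs (fst x)) (snd x) :: real) \<in> borel_measurable (P \<Otimes>\<^sub>M count_space UNIV)"
proof (rule measurable_pair_count_space)
  fix z :: "int ^ 'd"
  have "(\<lambda>\<omega>. indicator {1} (cond \<omega> 0 z) :: real) \<in> borel_measurable P" by measurable
  moreover have "(\<lambda>\<omega>. indicator {1} (cond \<omega> 0 z) :: real) = (\<lambda>\<omega>. indicator (open_nbrs \<omega>) z)"
    by (auto simp: indicator_def)
  ultimately show "(\<lambda>\<omega>. indicator (open_nbrs (fst (\<omega>, z))) (snd (\<omega>, z)) :: real) \<in> borel_measurable P" by simp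
qed

lemma nn_integral_edge:
  assumes f: "f \<in> borel_measurable edge_measure"
  shows "(\<integral>\<^sup>+x. f x \<partial>edge_measure) = (\<integral>\<^sup>+z. \<integral>\<^sup>+\<omega>. ennreal (indicator (open_nbrs \<omega>) z) * f (\<omega>, z) \<partial>P \<partial>count_space UNIV)"
    and "(\<integral>\<^sup>+x. f x \<partial>edge_measure) = (\<integral>\<^sup>+\<omega>. \<integral>\<^sup>+z. ennreal (indicator (open_nbrs \<omega>) z) * f (\<omega>, z) \<partial>count_space UNIV \<partial>P)"
proof -
  have [measurable]: "f \<in> borel_measurable (P \<Otimes>\<^sub>M count_space UNIV)" using f by simp
  have eq: "(\<integral>\<^sup>+x. f x \<partial>edge_measure)
    = (\<integral>\<^sup>+x. ennreal (indicator (open_nbrs (fst x)) (snd x)) * f x \<partial>(P \<Otimes>\<^sub>M count_space UNIV))"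
    unfolding edge_measure_def by (rule nn_integral_density) measurable
  show "(\<integral>\<^sup>+x. f x \<partial>edge_measure) = (\<integral>\<^sup>+z. \<integral>\<^sup>+\<omega>. ennreal (indicator (open_nbrs \<omega>) z) * f (\<omega>, z) \<partial>P \<partial>count_space UNIV)"
    unfolding eq by (subst nn_integral_snd [symmetric]) (auto simp: case_prod_beta)
  show "(\<integral>\<^sup>+x. f x \<partial>edge_measure) = (\<integral>\<^sup>+\<omega>. \<integral>\<^sup>+z. ennreal (indicator (open_nbrs \<omega>) z) * f (\<omega>, z) \<partial>count_space UNIV \<partial>P)"
    unfolding eq by (subst lattice.nn_integral_fst [symmetric]) auto
qed

lemma AE_edge:
  assumes "\<And>z. AE \<omega> in P. cond \<omega> 0 z = 1 \<longrightarrow> Q (\<omega>, z)"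
  shows "AE x in edge_measure. Q x"
proof -
  have "AE x in P \<Otimes>\<^sub>M count_space UNIV. cond (fst x) 0 (snd x) = 1 \<longrightarrow> Q (fst x, snd x)"
    using AE_pair_count_space [where Q = "\<lambda>\<omega> z. cond \<omega> 0 z = 1 \<longrightarrow> Q (\<omega>, z)", OF prob_space_imp_sigma_finite [OF prob_space_axioms] assms]
    by simp
  then have "AE x in P \<Otimes>\<^sub>M count_space UNIV. 0 < ennreal (indicator (open_nbrs (fst x)) (snd x)) \<longrightarrow> Q x"
    by eventually_elim (auto simp: indicator_def split: if_splits)
  then show ?thesis
    unfolding edge_measure_def by (subst AE_density) auto
qed

definition reverse_edge :: "'d env \<times> (int ^ 'd) \<Rightarrow> 'd env \<times> (int ^ 'd)" where
  "reverse_edge x = (env_shift (snd x) (fst x), - snd x)"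

lemma measurable_reverse_edge [measurable]: "reverse_edge \<in> measurable edge_measure edge_measure"
proof (rule borel_measurable_edge)
  fix z :: "int ^ 'd"
  have "(\<lambda>\<omega>. (env_shift z \<omega>, - z)) \<in> measurable P (P \<Otimes>\<^sub>M count_space UNIV)" by measurable
  then show "(\<lambda>\<omega>. reverse_edge (\<omega>, z)) \<in> measurable P edge_measure"
    unfolding reverse_edge_def using measurable_cong_sets [OF refl sets_edge_measure] by simp
qed

text \<open>By symmetry of the conductances and stationarity, an edge looks the same from both endpoints.\<close>

lemma distr_reverse_edge: "distr edge_measure edge_measure reverse_edge = edge_measure"
proof (rule measure_eqI)
  fix A assume "A \<in> sets (distr edge_measure edge_measure reverse_edge)"
  then have A [measurable]: "A \<in> sets edge_measure" by simp
  let ?g = "\<lambda>z \<omega>. ennreal (indicator (open_nbrs \<omega>) z) * indicator A (\<omega>, z)"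
  have [measurable]: "A \<in> sets (P \<Otimes>\<^sub>M count_space UNIV)" using A by (simp add: sets_edge_measure)
  have [measurable]: "?g z \<in> borel_measurable P" for z by measurable
  have "emeasure (distr edge_measure edge_measure reverse_edge) A
    = (\<integral>\<^sup>+x. indicator A (reverse_edge x) \<partial>edge_measure)"
    using nn_integral_distr [OF measurable_reverse_edge, of "indicator A"] A by simp
  also have "\<dots> = (\<integral>\<^sup>+z. \<integral>\<^sup>+\<omega>. ennreal (indicator (open_nbrs \<omega>) z) * indicator A (env_shift z \<omega>, - z) \<partial>P \<partial>count_space UNIV)"
    by (subst nn_integral_edge(1)) (auto simp: reverse_edge_def intro!: measurable_compose [OF measurable_reverse_edge])
  also have "\<dots> = (\<integral>\<^sup>+z. \<integral>\<^sup>+\<omega>. ?g (- z) (env_shift z \<omega>) \<partial>P \<partial>count_space UNIV)"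
    by (simp add: indicator_def cond_commute [of _ z for z])
  also have "\<dots> = (\<integral>\<^sup>+z. \<integral>\<^sup>+\<omega>. ?g (- z) \<omega> \<partial>P \<partial>count_space UNIV)"
    by (intro nn_integral_cong nn_integral_shift) measurable
  also have "\<dots> = (\<integral>\<^sup>+z. \<integral>\<^sup>+\<omega>. ?g z \<omega> \<partial>P \<partial>count_space UNIV)"
    by (rule nn_integral_bij_count_space [where g = uminus and f = "\<lambda>z. \<integral>\<^sup>+\<omega>. ?g z \<omega> \<partial>P"])
      (simp add: bij_betw_def)
  also have "\<dots> = emeasure edge_measure A"
    using nn_integral_edge(1) [of "indicator A"] A by simp
  finally show "emeasure (distr edge_measure edge_measure reverse_edge) A = emeasure edge_measure A" .
qed simp

lemma integral_reverse_edge: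
  fixes f :: "_ \<Rightarrow> real"
  assumes "f \<in> borel_measurable edge_measure"
  shows "(\<integral>x. f (reverse_edge x) \<partial>edge_measure) = (\<integral>x. f x \<partial>edge_measure)"
  using integral_distr [OF measurable_reverse_edge assms] by (simp add: distr_reverse_edge)

lemma integrable_reverse_edge:
  fixes f :: "_ \<Rightarrow> real"
  assumes "integrable edge_measure f"
  shows "integrable edge_measure (\<lambda>x. f (reverse_edge x))"
  using integrable_distr [OF measurable_reverse_edge, of f] assms by (simp add: distr_reverse_edge)

text \<open>The nearest-neighbour edges are open, so on them the edge measure is not smaller than \<open>P\<close>.\<close>

lemma nn_integral_section_le_edge:
  assumes f: "f \<in> borel_measurable edge_measure" and z: "l1 z = 1"
  shows "(\<integral>\<^sup>+\<omega>. f (\<omega>, z) \<partial>P) \<le> (\<integral>\<^sup>+x. f x \<partial>edge_measure)"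
proof -
  have "AE \<omega> in P. cond \<omega> 0 z = 1"
    using nearest_neighbours_open by eventually_elim (use z in simp)
  then have "(\<integral>\<^sup>+\<omega>. f (\<omega>, z) \<partial>P) = (\<integral>\<^sup>+\<omega>. ennreal (indicator (open_nbrs \<omega>) z) * f (\<omega>, z) \<partial>P)"
    by (intro nn_integral_cong_AE) (auto simp: indicator_def)
  also have "\<dots> \<le> (\<integral>\<^sup>+z. \<integral>\<^sup>+\<omega>. ennreal (indicator (open_nbrs \<omega>) z) * f (\<omega>, z) \<partial>P \<partial>count_space UNIV)"
    by (rule nn_integral_ge_point) simp
  also have "\<dots> = (\<integral>\<^sup>+x. f x \<partial>edge_measure)" by (rule nn_integral_edge(1) [OF f, symmetric])
  finally show ?thesis .
qed

lemma nn_integral_l1_sq_edge: "(\<integral>\<^sup>+x. ennreal ((l1 (snd x))\<^sup>2) \<partial>edge_measure) < \<infinity>"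
proof -
  have "(\<integral>\<^sup>+x. ennreal ((l1 (snd x))\<^sup>2) \<partial>edge_measure)
    = (\<integral>\<^sup>+z. \<integral>\<^sup>+\<omega>. ennreal (indicator (open_nbrs \<omega>) z) * ennreal ((l1 z)\<^sup>2) \<partial>P \<partial>count_space UNIV)"
    by (subst nn_integral_edge(1)) (auto intro!: borel_measurable_edge)
  also have "\<dots> = (\<integral>\<^sup>+z. ennreal (prob {\<omega> \<in> space P. cond \<omega> 0 z = 1} * (l1 z)\<^sup>2) \<partial>count_space UNIV)"
  proof (intro nn_integral_cong)
    fix z :: "int ^ 'd"
    have "(\<integral>\<^sup>+\<omega>. ennreal (indicator (open_nbrs \<omega>) z) * ennreal ((l1 z)\<^sup>2) \<partial>P)
      = (\<integral>\<^sup>+\<omega>. ennreal (indicator (open_nbrs \<omega>) z) \<partial>P) * ennreal ((l1 z)\<^sup>2)"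
      by (rule nn_integral_multc) measurable
    also have "(\<integral>\<^sup>+\<omega>. ennreal (indicator (open_nbrs \<omega>) z) \<partial>P) = (\<integral>\<^sup>+\<omega>. indicator {\<omega> \<in> space P. cond \<omega> 0 z = 1} \<omega> \<partial>P)"
      by (intro nn_integral_cong) (auto simp: indicator_def)
    also have "\<dots> = emeasure P {\<omega> \<in> space P. cond \<omega> 0 z = 1}"
      by (rule nn_integral_indicator) measurable
    finally show "(\<integral>\<^sup>+\<omega>. ennreal (indicator (open_nbrs \<omega>) z) * ennreal ((l1 z)\<^sup>2) \<partial>P)
      = ennreal (prob {\<omega> \<in> space P. cond \<omega> 0 z = 1} * (l1 z)\<^sup>2)"
      by (simp only: emeasure_eq_measure ennreal_mult [OF measure_nonneg zero_le_power2])
  qed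
  also have "\<dots> < \<infinity>"
  proof -
    have "integrable (count_space UNIV) (\<lambda>z. prob {\<omega> \<in> space P. cond \<omega> 0 z = 1} * (l1 z)\<^sup>2)"
      using second_moment by (subst abs_summable_on_def [symmetric], subst abs_summable_equivalent [symmetric])
        (simp add: summable_on_iff_abs_summable_on_real [symmetric])
    then show ?thesis by (simp add: integrable_iff_bounded abs_mult)
  qed
  finally show ?thesis .
qed

lemma finite_edge_measure: "finite_measure edge_measure"
proof
  have space: "space edge_measure = UNIV"
    by (simp add: edge_measure_def space_pair_measure)
  have "emeasure edge_measure (space edge_measure) = (\<integral>\<^sup>+x. 1 \<partial>edge_measure)" by simp
  also have "\<dots> \<le> (\<integral>\<^sup>+x. ennreal ((l1 (snd x))\<^sup>2) + indicator {0} (snd x) \<partial>edge_measure)"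
  proof (rule nn_integral_mono)
    fix x :: "'d env \<times> (int ^ 'd)"
    show "1 \<le> ennreal ((l1 (snd x))\<^sup>2) + indicator {0} (snd x)"
    proof (cases "snd x = 0")
      case False
      then obtain i where "snd x $ i \<noteq> 0" by (auto simp: vec_eq_iff)
      then have "1 \<le> \<bar>real_of_int (snd x $ i)\<bar>" by simp
      also have "\<dots> \<le> l1 (snd x)" by (rule abs_component_le_l1)
      finally have "1 \<le> (l1 (snd x))\<^sup>2" by simp
      then show ?thesis using False by simp
    qed simp
  qed
  also have "\<dots> = (\<integral>\<^sup>+x. ennreal ((l1 (snd x))\<^sup>2) \<partial>edge_measure) + (\<integral>\<^sup>+x. indicator {0} (snd x) \<partial>edge_measure)"
    by (rule nn_integral_add) (auto intro!: borel_measurable_edge)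
  also have "(\<integral>\<^sup>+x. indicator {0} (snd x) \<partial>edge_measure)
    = (\<integral>\<^sup>+z. \<integral>\<^sup>+\<omega>. ennreal (indicator (open_nbrs \<omega>) z) * indicator {0} z \<partial>P \<partial>count_space UNIV)"
    by (subst nn_integral_edge(1)) (auto intro!: borel_measurable_edge)
  also have "\<dots> \<le> (\<integral>\<^sup>+z. \<integral>\<^sup>+\<omega>. indicator {0} z \<partial>P \<partial>count_space (UNIV :: (int ^ 'd) set))"
    by (intro nn_integral_mono) (auto simp: indicator_def)
  also have "\<dots> = (\<integral>\<^sup>+z. indicator {0} z \<partial>count_space (UNIV :: (int ^ 'd) set))"
    by (simp add: emeasure_space_1 [simplified])
  also have "\<dots> = 1" by (subst nn_integral_indicator) auto
  finally have "emeasure edge_measure (space edge_measure) \<le> (\<integral>\<^sup>+x. ennreal ((l1 (snd x))\<^sup>2) \<partial>edge_measure) + 1"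
    by (simp add: add_left_mono)
  also have "\<dots> < \<infinity>" using nn_integral_l1_sq_edge by (simp add: ennreal_add_less_top)
  finally show "emeasure edge_measure (space edge_measure) \<noteq> \<infinity>" by simp
qed

sublocale edge: finite_measure edge_measure by (rule finite_edge_measure)

lemma integrable_l1_sq: "integrable edge_measure (\<lambda>x. (l1 (snd x))\<^sup>2)"
  using nn_integral_l1_sq_edge by (intro integrableI_bounded) (auto intro!: borel_measurable_edge)

lemma integral_edge:
  fixes f :: "_ \<Rightarrow> real"
  assumes f: "integrable edge_measure f"
  shows "integrable P (\<lambda>\<omega>. \<integral>z. indicator (open_nbrs \<omega>) z * f (\<omega>, z) \<partial>count_space UNIV)"
    and "(\<integral>x. f x \<partial>edge_measure) = (\<integral>\<omega>. \<integral>z. indicator (open_nbrs \<omega>) z * f (\<omega>, z) \<partial>count_space UNIV \<partial>P)"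
    and "integrable (P \<Otimes>\<^sub>M count_space UNIV) (\<lambda>x. indicator (open_nbrs (fst x)) (snd x) * f x)"
    and "(\<integral>x. f x \<partial>edge_measure) = (\<integral>x. indicator (open_nbrs (fst x)) (snd x) * f x \<partial>(P \<Otimes>\<^sub>M count_space UNIV))"
proof -
  have [measurable]: "f \<in> borel_measurable (P \<Otimes>\<^sub>M count_space UNIV)" using f by simp
  show int: "integrable (P \<Otimes>\<^sub>M count_space UNIV) (\<lambda>x. indicator (open_nbrs (fst x)) (snd x) * f x)"
    using f unfolding edge_measure_def by (subst (asm) integrable_density) auto
  show eq: "(\<integral>x. f x \<partial>edge_measure) = (\<integral>x. indicator (open_nbrs (fst x)) (snd x) * f x \<partial>(P \<Otimes>\<^sub>M count_space UNIV))"
    unfolding edge_measure_def by (subst integral_density) auto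
  show "integrable P (\<lambda>\<omega>. \<integral>z. indicator (open_nbrs \<omega>) z * f (\<omega>, z) \<partial>count_space UNIV)"
    using integrable_fst' [OF int] by simp
  show "(\<integral>x. f x \<partial>edge_measure) = (\<integral>\<omega>. \<integral>z. indicator (open_nbrs \<omega>) z * f (\<omega>, z) \<partial>count_space UNIV \<partial>P)"
    unfolding eq by (subst integral_fst' [OF int, symmetric]) simp
qed

text \<open>The mass of the edge measure is the expected degree of the origin.\<close>

lemma AE_finite_open_nbrs: "AE \<omega> in P. finite (open_nbrs \<omega>)"
proof -
  have "(\<integral>\<^sup>+\<omega>. \<integral>\<^sup>+z. ennreal (indicator (open_nbrs \<omega>) z) \<partial>count_space UNIV \<partial>P) = (\<integral>\<^sup>+x. 1 \<partial>edge_measure)"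
    by (subst nn_integral_edge(2)) auto
  also have "\<dots> \<noteq> \<infinity>" using edge.emeasure_finite by simp
  finally have "AE \<omega> in P. (\<integral>\<^sup>+z. ennreal (indicator (open_nbrs \<omega>) z) \<partial>count_space UNIV) \<noteq> \<infinity>"
    by (intro nn_integral_PInf_AE lattice.borel_measurable_nn_integral) auto
  then show ?thesis
  proof eventually_elim
    case (elim \<omega>)
    have "(\<integral>\<^sup>+z. ennreal (indicator (open_nbrs \<omega>) z) \<partial>count_space UNIV) = (\<integral>\<^sup>+z. indicator (open_nbrs \<omega>) z \<partial>count_space UNIV)"
      by (intro nn_integral_cong) (simp add: indicator_def)
    also have "\<dots> = emeasure (count_space UNIV) (open_nbrs \<omega>)" by simp
    finally have "(\<integral>\<^sup>+z. ennreal (indicator (open_nbrs \<omega>) z) \<partial>count_space UNIV) = emeasure (count_space UNIV) (open_nbrs \<omega>)" .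
    then show ?case using elim by (cases "finite (open_nbrs \<omega>)") auto
  qed
qed

end

section \<open>Gradients and cocycles\<close>

text \<open>A minimising sequence for the distance of \<open>-h\<close> to the subspace \<open>G\<close> in \<open>L\<^sup>2\<close>. It is Cauchy by the
  parallelogram identity, and \<open>h + g k\<close> is nearly orthogonal to \<open>G\<close> because perturbing \<open>g k\<close> in a direction \<open>u\<close> cannot lower
  the distance below the infimum; the rates make the sequence converge pointwise later.\<close>

lemma minimizing_sequence:
  fixes h :: "'a \<Rightarrow> real" and G :: "('a \<Rightarrow> real) set"
  assumes h [measurable]: "h \<in> borel_measurable M" and h2: "integrable M (\<lambda>x. (h x)\<^sup>2)"
    and G: "\<And>g. g \<in> G \<Longrightarrow> g \<in> borel_measurable M" "\<And>g. g \<in> G \<Longrightarrow> integrable M (\<lambda>x. (g x)\<^sup>2)"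
    and zero: "(\<lambda>x. 0) \<in> G"
    and lin: "\<And>a b g u. g \<in> G \<Longrightarrow> u \<in> G \<Longrightarrow> (\<lambda>x. a * g x + b * u x) \<in> G"
  obtains g :: "nat \<Rightarrow> 'a \<Rightarrow> real" where "\<And>k. g k \<in> G"
    and "\<And>k l. k \<le> l \<Longrightarrow> (\<integral>x. (g l x - g k x)\<^sup>2 \<partial>M) \<le> (1/4) ^ k"
    and "\<And>k u. u \<in> G \<Longrightarrow> \<bar>\<integral>x. (h x + g k x) * u x \<partial>M\<bar> \<le> (1/2) ^ k * (1 + (\<integral>x. (u x)\<^sup>2 \<partial>M))"
proof -
  define J where "J g = (\<integral>x. (h x + g x)\<^sup>2 \<partial>M)" for g
  define m where "m = Inf (J ` G)"
  have m_le: "m \<le> J g" if "g \<in> G" for g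
    unfolding m_def by (rule cINF_lower [OF _ that]) (auto simp: J_def intro!: bdd_belowI2 [of _ 0])
  have "\<exists>g\<in>G. J g < m + (1/4) ^ k / 4" for k :: nat
    using cInf_lessD [of "J ` G" "m + (1/4) ^ k / 4"] zero unfolding m_def by auto
  then obtain g where g: "\<And>k. g k \<in> G" "\<And>k. J (g k) < m + (1/4) ^ k / 4"
    by metis
  have sq: "integrable M (\<lambda>x. (h x + u x)\<^sup>2)" if "u \<in> G" for u
    using h h2 G that by (intro integrable_add_squares)
  show ?thesis
  proof (rule that [OF g(1)])
    fix k l :: nat assume "k \<le> l"
    let ?mid = "\<lambda>x. 1/2 * g k x + 1/2 * g l x"
    have mid: "?mid \<in> G" by (rule lin) (rule g)+
    \<comment> \<open>the parallelogram identity\<close>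
    have "(\<integral>x. (g l x - g k x)\<^sup>2 \<partial>M)
      = (\<integral>x. 2 * (h x + g k x)\<^sup>2 + 2 * (h x + g l x)\<^sup>2 - 4 * (h x + ?mid x)\<^sup>2 \<partial>M)"
      by (intro Bochner_Integration.integral_cong) (auto simp: power2_eq_square field_simps)
    also have "\<dots> = 2 * J (g k) + 2 * J (g l) - 4 * J ?mid"
      unfolding J_def using sq [OF g(1) [of k]] sq [OF g(1) [of l]] sq [OF mid] by simp
    also have "\<dots> \<le> (1/4) ^ k"
    proof -
      have "(1/4 :: real) ^ l \<le> (1/4) ^ k" by (rule power_decreasing) (use \<open>k \<le> l\<close> in auto)
      then show ?thesis using m_le [OF mid] g(2) [of k] g(2) [of l] by linarith
    qed
    finally show "(\<integral>x. (g l x - g k x)\<^sup>2 \<partial>M) \<le> (1/4) ^ k" .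
  next
    fix k u assume u: "u \<in> G"
    define B where "B = (\<integral>x. (h x + g k x) * u x \<partial>M)"
    define Q where "Q = (\<integral>x. (u x)\<^sup>2 \<partial>M)"
    \<comment> \<open>a step against the sign of \<open>B\<close>, of the size of the square root of the allowed gap\<close>
    define t :: real where "t = - sgn B * (1/2) ^ k"
    have gt: "(\<lambda>x. g k x + t * u x) \<in> G" using lin [OF g(1) u, of 1 k t] by simp
    have [measurable]: "u \<in> borel_measurable M" "g k \<in> borel_measurable M" using G u g(1) by auto
    have iB: "integrable M (\<lambda>x. (h x + g k x) * u x)"
      using sq [OF g(1)] G(2) [OF u] by (intro integrable_mult_of_squares) auto
    have "J (\<lambda>x. g k x + t * u x) = (\<integral>x. (h x + g k x)\<^sup>2 + 2 * t * ((h x + g k x) * u x) + t\<^sup>2 * (u x)\<^sup>2 \<partial>M)"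
      unfolding J_def by (intro Bochner_Integration.integral_cong) (auto simp: power2_eq_square algebra_simps)
    also have "\<dots> = J (g k) + 2 * t * B + t\<^sup>2 * Q"
      unfolding J_def B_def Q_def using sq [OF g(1) [of k]] iB G(2) [OF u] by simp
    finally have "0 \<le> (1/4) ^ k / 4 + 2 * t * B + t\<^sup>2 * Q"
      using m_le [OF gt] g(2) [of k] by linarith
    moreover have "t * B = - (\<bar>B\<bar> * (1/2) ^ k)"
      by (simp add: t_def sgn_if)
    moreover have "t\<^sup>2 * Q \<le> (1/4) ^ k * Q"
    proof (rule mult_right_mono)
      have "t\<^sup>2 = (sgn B)\<^sup>2 * (1/4) ^ k"
        by (simp add: t_def power_mult_distrib power2_eq_square power_divide flip: power_mult_distrib)
      also have "\<dots> \<le> 1 * (1/4) ^ k" by (intro mult_right_mono) (auto simp: sgn_if)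
      finally show "t\<^sup>2 \<le> (1/4) ^ k" by simp
      show "0 \<le> Q" by (simp add: Q_def)
    qed
    moreover have quarter: "(1/4 :: real) ^ k = (1/2) ^ k * (1/2) ^ k"
      by (simp flip: power_mult_distrib)
    moreover have "0 < (1/4 :: real) ^ k" by simp
    ultimately have "\<bar>B\<bar> * (1/2) ^ k \<le> (1/4) ^ k * (1 + Q)"
    proof -
      assume *: "0 \<le> (1/4) ^ k / 4 + 2 * t * B + t\<^sup>2 * Q" "t * B = - (\<bar>B\<bar> * (1/2) ^ k)"
        "t\<^sup>2 * Q \<le> (1/4) ^ k * Q" "0 < (1/4 :: real) ^ k"
      have "0 \<le> (1/4) ^ k * Q" by (simp add: Q_def)
      moreover have "2 * t * B = 2 * (t * B)" by simp
      ultimately show ?thesis using * unfolding distrib_left by linarith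
    qed
    then have "\<bar>B\<bar> * (1/2) ^ k \<le> ((1/2) ^ k * (1 + Q)) * (1/2) ^ k"
      unfolding quarter by (simp add: algebra_simps)
    then have "\<bar>B\<bar> \<le> (1/2) ^ k * (1 + Q)"
      by (rule mult_right_le_imp_le) simp
    then show "\<bar>\<integral>x. (h x + g k x) * u x \<partial>M\<bar> \<le> (1/2) ^ k * (1 + (\<integral>x. (u x)\<^sup>2 \<partial>M))"
      by (simp add: B_def Q_def)
  qed
qed

lemma AE_summable_of_L1:
  fixes u :: "nat \<Rightarrow> 'a \<Rightarrow> real"
  assumes u: "\<And>k. integrable M (u k)" and sm: "summable (\<lambda>k. \<integral>x. \<bar>u k x\<bar> \<partial>M)"
  shows "AE x in M. summable (\<lambda>k. \<bar>u k x\<bar>)"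
proof -
  have [measurable]: "u k \<in> borel_measurable M" for k using u by auto
  have "(\<integral>\<^sup>+x. (\<Sum>k. ennreal \<bar>u k x\<bar>) \<partial>M) = (\<Sum>k. \<integral>\<^sup>+x. ennreal \<bar>u k x\<bar> \<partial>M)"
    by (rule nn_integral_suminf) measurable
  also have "\<dots> = (\<Sum>k. ennreal (\<integral>x. \<bar>u k x\<bar> \<partial>M))"
    using u by (simp add: nn_integral_eq_integral)
  also have "\<dots> = ennreal (\<Sum>k. \<integral>x. \<bar>u k x\<bar> \<partial>M)"
    by (rule suminf_ennreal2) (auto intro: sm)
  finally have "(\<integral>\<^sup>+x. (\<Sum>k. ennreal \<bar>u k x\<bar>) \<partial>M) \<noteq> \<infinity>" by simp
  then have "AE x in M. (\<Sum>k. ennreal \<bar>u k x\<bar>) \<noteq> \<infinity>"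
    by (intro nn_integral_PInf_AE) auto
  then show ?thesis
    by eventually_elim (rule summable_suminf_not_top, auto)
qed

context random_environment
begin

definition env_gradient :: "('d env \<Rightarrow> real) \<Rightarrow> 'd env \<times> (int ^ 'd) \<Rightarrow> real" where
  "env_gradient f x = f (env_shift (snd x) (fst x)) - f (fst x)"

definition bounded_functions :: "('d env \<Rightarrow> real) set" where
  "bounded_functions = {f \<in> borel_measurable P. \<exists>B. \<forall>\<omega>. \<bar>f \<omega>\<bar> \<le> B}"

text \<open>The fields whose increments are stationary functions of the environment.\<close>

definition cocycle :: "('d env \<Rightarrow> int ^ 'd \<Rightarrow> real) \<Rightarrow> bool" where
  "cocycle W \<longleftrightarrow> (\<forall>x. (\<lambda>\<omega>. W \<omega> x) \<in> borel_measurable P) \<and>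
     (\<forall>z. AE \<omega> in P. \<forall>x. W \<omega> (x + z) - W \<omega> z = W (env_shift z \<omega>) x)"

text \<open>For a cocycle \<open>W\<close> this is, almost surely, \<open>total_cond \<omega> 0\<close> times the generator applied to \<open>W \<omega>\<close> at the origin.\<close>

definition divergence :: "('d env \<Rightarrow> int ^ 'd \<Rightarrow> real) \<Rightarrow> 'd env \<Rightarrow> real" where
  "divergence W \<omega> = (\<Sum>z\<in>open_nbrs \<omega>. W \<omega> z)"

lemma bounded_functions_measurable [measurable_dest]: "f \<in> bounded_functions \<Longrightarrow> f \<in> borel_measurable P"
  by (simp add: bounded_functions_def)

lemma bounded_functions_linear:
  assumes "f \<in> bounded_functions" "g \<in> bounded_functions"
  shows "(\<lambda>\<omega>. a * f \<omega> + b * g \<omega>) \<in> bounded_functions"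
proof -
  obtain A B where "\<And>\<omega>. \<bar>f \<omega>\<bar> \<le> A" "\<And>\<omega>. \<bar>g \<omega>\<bar> \<le> B"
    using assms by (auto simp: bounded_functions_def)
  then have "\<bar>a * f \<omega> + b * g \<omega>\<bar> \<le> \<bar>a\<bar> * A + \<bar>b\<bar> * B" for \<omega>
    by (intro order.trans [OF abs_triangle_ineq] add_mono) (auto simp: abs_mult mult_left_mono)
  then show ?thesis using assms by (auto simp: bounded_functions_def)
qed

lemma integrable_bounded_function: "f \<in> bounded_functions \<Longrightarrow> integrable P f"
  unfolding bounded_functions_def by (force intro: integrable_const_bound)

lemma measurable_env_gradient [measurable]:
  "f \<in> borel_measurable P \<Longrightarrow> env_gradient f \<in> borel_measurable edge_measure"
  unfolding env_gradient_def by (rule borel_measurable_edge) simp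

lemma integrable_env_gradient_sq:
  assumes "f \<in> bounded_functions"
  shows "integrable edge_measure (\<lambda>x. (env_gradient f x)\<^sup>2)"
proof -
  have [measurable]: "f \<in> borel_measurable P" using assms by measurable
  obtain B where B: "\<And>\<omega>. \<bar>f \<omega>\<bar> \<le> B" using assms by (auto simp: bounded_functions_def)
  have "\<bar>env_gradient f x\<bar> \<le> 2 * B" for x
    using B [of "fst x"] B [of "env_shift (snd x) (fst x)"] by (simp add: env_gradient_def)
  then have "(env_gradient f x)\<^sup>2 \<le> (2 * B)\<^sup>2" for x
    by (metis abs_ge_zero power2_abs power_mono)
  then show ?thesis by (intro edge.integrable_const_bound [of _ "(2 * B)\<^sup>2"]) auto
qed

lemma cocycle_measurable [measurable_dest]: "cocycle W \<Longrightarrow> (\<lambda>\<omega>. W \<omega> x) \<in> borel_measurable P"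
  by (simp add: cocycle_def)

lemma cocycle_AE: "cocycle W \<Longrightarrow> AE \<omega> in P. \<forall>x. W \<omega> (x + z) - W \<omega> z = W (env_shift z \<omega>) x"
  by (simp add: cocycle_def)

lemma cocycle_measurable_edge:
  assumes "cocycle W"
  shows "(\<lambda>x. W (fst x) (snd x)) \<in> borel_measurable edge_measure"
  by (rule borel_measurable_edge) (simp add: cocycle_measurable [OF assms])

lemma cocycle_0:
  assumes "cocycle W"
  shows "AE \<omega> in P. W \<omega> 0 = 0"
  using cocycle_AE [OF assms, of 0]
proof eventually_elim
  case (elim \<omega>)
  from spec [OF this, of 0] show ?case by simp
qed

lemma cocycle_reverse:
  assumes "cocycle W"
  shows "AE x in edge_measure. W (fst (reverse_edge x)) (snd (reverse_edge x)) = - W (fst x) (snd x)"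
proof (rule AE_edge)
  fix z :: "int ^ 'd"
  show "AE \<omega> in P. cond \<omega> 0 z = 1 \<longrightarrow> W (fst (reverse_edge (\<omega>, z))) (snd (reverse_edge (\<omega>, z))) = - W (fst (\<omega>, z)) (snd (\<omega>, z))"
    using cocycle_AE [OF assms, of z] cocycle_0 [OF assms]
  proof eventually_elim
    case (elim \<omega>)
    from spec [OF elim(1), of "- z"] elim(2) show ?case by (simp add: reverse_edge_def)
  qed
qed

lemma integrable_bounded_times_cocycle:
  assumes W: "cocycle W" "integrable edge_measure (\<lambda>x. (W (fst x) (snd x))\<^sup>2)" and f: "f \<in> bounded_functions"
  shows "integrable edge_measure (\<lambda>x. f (fst x) * W (fst x) (snd x))"
proof (rule integrable_mult_of_squares [OF _ cocycle_measurable_edge [OF W(1)] _ W(2)])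
  have [measurable]: "f \<in> borel_measurable P" using f by measurable
  show [measurable]: "(\<lambda>x. f (fst x)) \<in> borel_measurable edge_measure"
    by (rule borel_measurable_edge) simp
  obtain B where "\<And>\<omega>. \<bar>f \<omega>\<bar> \<le> B" using f by (auto simp: bounded_functions_def)
  then have "(f \<omega>)\<^sup>2 \<le> B\<^sup>2" for \<omega> by (metis abs_ge_zero power2_abs power_mono)
  then show "integrable edge_measure (\<lambda>x. (f (fst x))\<^sup>2)"
    by (intro edge.integrable_const_bound [of _ "B\<^sup>2"]) auto
qed

lemma integral_divergence:
  assumes W: "cocycle W" "integrable edge_measure (\<lambda>x. (W (fst x) (snd x))\<^sup>2)" and f: "f \<in> bounded_functions"
  shows "(\<integral>x. f (fst x) * W (fst x) (snd x) \<partial>edge_measure) = (\<integral>\<omega>. f \<omega> * (\<integral>z. indicator (open_nbrs \<omega>) z * W \<omega> z \<partial>count_space UNIV) \<partial>P)"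
  using integral_edge(2) [OF integrable_bounded_times_cocycle [OF assms]]
  by (simp add: mult.left_commute [of "indicator _ _"])

lemma AE_divergence_eq:
  "AE \<omega> in P. (\<integral>z. indicator (open_nbrs \<omega>) z * W \<omega> z \<partial>count_space UNIV) = divergence W \<omega>"
  using AE_finite_open_nbrs
proof eventually_elim
  case (elim \<omega>)
  have "(\<integral>z. indicator (open_nbrs \<omega>) z * W \<omega> z \<partial>count_space UNIV)
    = (\<Sum>z | z \<in> UNIV \<and> indicator (open_nbrs \<omega>) z * W \<omega> z \<noteq> 0. indicator (open_nbrs \<omega>) z * W \<omega> z)"
    by (rule lebesgue_integral_count_space_finite_support, rule finite_subset [OF _ elim]) (auto simp: indicator_def)
  also have "\<dots> = divergence W \<omega>"
    unfolding divergence_def using elim by (intro sum.mono_neutral_cong_left) (auto simp: indicator_def)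
  finally show ?case .
qed

text \<open>Reversing the edge maps \<open>f (env_shift z \<omega>) * W \<omega> z\<close> to \<open>- f \<omega> * W \<omega> z\<close>, so both halves of the gradient contribute the
  same amount.\<close>

lemma integration_by_parts:
  assumes W: "cocycle W" "integrable edge_measure (\<lambda>x. (W (fst x) (snd x))\<^sup>2)" and f: "f \<in> bounded_functions"
  shows "(\<integral>x. W (fst x) (snd x) * env_gradient f x \<partial>edge_measure)
    = - 2 * (\<integral>x. f (fst x) * W (fst x) (snd x) \<partial>edge_measure)"
proof -
  let ?F = "\<lambda>x. - (f (fst x) * W (fst x) (snd x))"
  have F: "integrable edge_measure ?F"
    using integrable_bounded_times_cocycle [OF assms] by simp
  have FR: "integrable edge_measure (\<lambda>x. ?F (reverse_edge x))"
    by (rule integrable_reverse_edge [OF F])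
  have [measurable]: "f \<in> borel_measurable P" using f by measurable
  have [measurable]: "(\<lambda>x. W (fst x) (snd x)) \<in> borel_measurable edge_measure"
    by (rule cocycle_measurable_edge [OF W(1)])
  have "(\<integral>x. W (fst x) (snd x) * env_gradient f x \<partial>edge_measure) = (\<integral>x. ?F (reverse_edge x) + ?F x \<partial>edge_measure)"
  proof (rule integral_cong_AE)
    show "(\<lambda>x. ?F (reverse_edge x) + ?F x) \<in> borel_measurable edge_measure"
      using F FR by auto
    show "AE x in edge_measure. W (fst x) (snd x) * env_gradient f x = ?F (reverse_edge x) + ?F x"
      using cocycle_reverse [OF W(1)]
      by eventually_elim (simp add: env_gradient_def reverse_edge_def algebra_simps)
  qed measurable
  also have "\<dots> = (\<integral>x. ?F (reverse_edge x) \<partial>edge_measure) + (\<integral>x. ?F x \<partial>edge_measure)"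
    by (rule Bochner_Integration.integral_add [OF FR F])
  also have "(\<integral>x. ?F (reverse_edge x) \<partial>edge_measure) = (\<integral>x. ?F x \<partial>edge_measure)"
    using F by (intro integral_reverse_edge) auto
  finally show ?thesis by simp
qed

text \<open>The test function is the sign of the divergence.\<close>

lemma divergence_eq_0_if_orthogonal:
  assumes W: "cocycle W" "integrable edge_measure (\<lambda>x. (W (fst x) (snd x))\<^sup>2)"
    and orth: "\<And>f. f \<in> bounded_functions \<Longrightarrow> (\<integral>x. W (fst x) (snd x) * env_gradient f x \<partial>edge_measure) = 0"
  shows "AE \<omega> in P. divergence W \<omega> = 0"
proof -
  define D where "D \<omega> = (\<integral>z. indicator (open_nbrs \<omega>) z * W \<omega> z \<partial>count_space UNIV)" for \<omega>
  have one: "(\<lambda>_. 1) \<in> bounded_functions" by (auto simp: bounded_functions_def)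
  have D: "integrable P D"
    using integral_edge(1) [OF integrable_bounded_times_cocycle [OF W one]] by (simp add: D_def [abs_def])
  have "(\<lambda>\<omega>. sgn (D \<omega>)) \<in> bounded_functions"
    using D by (auto simp: bounded_functions_def sgn_if intro!: exI [of _ 1])
  note f = this
  have "0 = - 2 * (\<integral>\<omega>. sgn (D \<omega>) * D \<omega> \<partial>P)"
    using orth [OF f] integration_by_parts [OF W f] integral_divergence [OF W f] by (simp add: D_def)
  then have "(\<integral>\<omega>. \<bar>D \<omega>\<bar> \<partial>P) = 0" by (simp add: abs_sgn mult.commute)
  then have "AE \<omega> in P. \<bar>D \<omega>\<bar> = 0"
    using D by (subst (asm) integral_nonneg_eq_0_iff_AE) auto
  with AE_divergence_eq [of W] show ?thesis
    by eventually_elim (simp add: D_def)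
qed

lemma orthogonal_if_divergence_eq_0:
  assumes W: "cocycle W" "integrable edge_measure (\<lambda>x. (W (fst x) (snd x))\<^sup>2)"
    and div: "AE \<omega> in P. divergence W \<omega> = 0" and f: "f \<in> bounded_functions"
  shows "(\<integral>x. W (fst x) (snd x) * env_gradient f x \<partial>edge_measure) = 0"
proof -
  have "(\<integral>\<omega>. f \<omega> * (\<integral>z. indicator (open_nbrs \<omega>) z * W \<omega> z \<partial>count_space UNIV) \<partial>P) = 0"
  proof (rule integral_eq_zero_AE)
    show "AE \<omega> in P. f \<omega> * (\<integral>z. indicator (open_nbrs \<omega>) z * W \<omega> z \<partial>count_space UNIV) = 0"
      using AE_divergence_eq [of W] div by eventually_elim simp
  qed
  then show ?thesis
    using integration_by_parts [OF W f] integral_divergence [OF W f] by simp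
qed

end

section \<open>Existence of the corrector\<close>

context random_environment
begin

lemma integrable_section_of_nearest_neighbour:
  fixes f :: "_ \<Rightarrow> real"
  assumes f: "integrable edge_measure f" "\<And>x. 0 \<le> f x" and e: "l1 e = 1"
    and [measurable]: "(\<lambda>\<omega>. f (\<omega>, e)) \<in> borel_measurable P"
  shows "integrable P (\<lambda>\<omega>. f (\<omega>, e))" and "(\<integral>\<omega>. f (\<omega>, e) \<partial>P) \<le> (\<integral>x. f x \<partial>edge_measure)"
proof -
  have le: "(\<integral>\<^sup>+\<omega>. ennreal (f (\<omega>, e)) \<partial>P) \<le> ennreal (\<integral>x. f x \<partial>edge_measure)"
    using nn_integral_section_le_edge [of "\<lambda>x. ennreal (f x)" e] f e
    by (simp add: nn_integral_eq_integral)
  show int: "integrable P (\<lambda>\<omega>. f (\<omega>, e))"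
    using le f(2) by (intro integrableI_nonneg) (auto intro: order.strict_trans1)
  show "(\<integral>\<omega>. f (\<omega>, e) \<partial>P) \<le> (\<integral>x. f x \<partial>edge_measure)"
    using le f(2) by (simp add: nn_integral_eq_integral [OF int] integral_nonneg_AE)
qed

text \<open>Nearest-neighbour edges are open, and every displacement is a sum of such edges, so the \<open>L\<^sup>2\<close> norm of a gradient
  over the open edges controls its increments over all displacements in \<open>L\<^sup>1\<close>.\<close>

lemma L1_increment_le:
  assumes f: "f \<in> bounded_functions" and c: "(\<integral>x. (env_gradient f x)\<^sup>2 \<partial>edge_measure) \<le> c\<^sup>2" "0 \<le> c"
  shows "(\<integral>\<omega>. \<bar>f (env_shift x \<omega>) - f \<omega>\<bar> \<partial>P) \<le> c * l1 x"
proof (rule subadditive_le_l1 [where N = "\<lambda>x. \<integral>\<omega>. \<bar>f (env_shift x \<omega>) - f \<omega>\<bar> \<partial>P"])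
  have [measurable]: "f \<in> borel_measurable P" using f by measurable
  have int: "integrable P (\<lambda>\<omega>. f (env_shift x \<omega>) - f \<omega>)" for x
    using integrable_bounded_function [OF f] integrable_shift by auto
  fix x y :: "int ^ 'd"
  have "(\<integral>\<omega>. \<bar>f (env_shift (x + y) \<omega>) - f \<omega>\<bar> \<partial>P)
    \<le> (\<integral>\<omega>. \<bar>f (env_shift x (env_shift y \<omega>)) - f (env_shift y \<omega>)\<bar> + \<bar>f (env_shift y \<omega>) - f \<omega>\<bar> \<partial>P)"
    using int integrable_shift [OF int, of x y]
    by (intro integral_mono integrable_abs Bochner_Integration.integrable_add) auto
  also have "\<dots> = (\<integral>\<omega>. \<bar>f (env_shift x (env_shift y \<omega>)) - f (env_shift y \<omega>)\<bar> \<partial>P)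
      + (\<integral>\<omega>. \<bar>f (env_shift y \<omega>) - f \<omega>\<bar> \<partial>P)"
    using int integrable_shift [OF int, of x y] by (intro Bochner_Integration.integral_add integrable_abs) auto
  also have "(\<integral>\<omega>. \<bar>f (env_shift x (env_shift y \<omega>)) - f (env_shift y \<omega>)\<bar> \<partial>P) = (\<integral>\<omega>. \<bar>f (env_shift x \<omega>) - f \<omega>\<bar> \<partial>P)"
    by (rule integral_shift [where f = "\<lambda>\<omega>. \<bar>f (env_shift x \<omega>) - f \<omega>\<bar>"]) measurable
  finally show "(\<integral>\<omega>. \<bar>f (env_shift (x + y) \<omega>) - f \<omega>\<bar> \<partial>P)
    \<le> (\<integral>\<omega>. \<bar>f (env_shift x \<omega>) - f \<omega>\<bar> \<partial>P) + (\<integral>\<omega>. \<bar>f (env_shift y \<omega>) - f \<omega>\<bar> \<partial>P)" .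
next
  have [measurable]: "f \<in> borel_measurable P" using f by measurable
  fix e :: "int ^ 'd" assume e: "l1 e = 1"
  let ?Y = "\<lambda>\<omega>. \<bar>f (env_shift e \<omega>) - f \<omega>\<bar>"
  have m: "(\<lambda>\<omega>. (env_gradient f (\<omega>, e))\<^sup>2) \<in> borel_measurable P"
    by (simp add: env_gradient_def)
  note sec = integrable_section_of_nearest_neighbour [where f = "\<lambda>x. (env_gradient f x)\<^sup>2",
      OF integrable_env_gradient_sq [OF f] zero_le_power2 e m]
  have iY: "integrable P ?Y" using integrable_bounded_function [OF f] integrable_shift by auto
  have iY2: "integrable P (\<lambda>\<omega>. (?Y \<omega>)\<^sup>2)" using sec(1) by (simp add: env_gradient_def)
  have "(expectation ?Y)\<^sup>2 \<le> expectation (\<lambda>\<omega>. (?Y \<omega>)\<^sup>2)"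
    using variance_positive [of ?Y] variance_eq [OF iY iY2] by simp
  also have "\<dots> \<le> c\<^sup>2" using sec(2) c(1) by (simp add: env_gradient_def)
  finally show "(\<integral>\<omega>. \<bar>f (env_shift e \<omega>) - f \<omega>\<bar> \<partial>P) \<le> c"
    using c(2) by (rule power2_le_imp_le)
qed simp

lemma cocycle_add_linear:
  assumes "cocycle Y"
  shows "cocycle (\<lambda>\<omega> z. real_of_int (z $ i) + Y \<omega> z)"
  using assms unfolding cocycle_def by (auto intro!: borel_measurable_add)

lemma integrable_coordinate_sq: "integrable edge_measure (\<lambda>x. (real_of_int (snd x $ i))\<^sup>2)"
proof (rule Bochner_Integration.integrable_bound [OF integrable_l1_sq])
  have "(real_of_int (z $ i))\<^sup>2 \<le> (l1 z)\<^sup>2" for z :: "int ^ 'd"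
    using abs_component_le_l1 [of z i] by (metis abs_ge_zero power2_abs power_mono)
  then show "AE x in edge_measure. norm ((real_of_int (snd x $ i))\<^sup>2) \<le> norm ((l1 (snd x))\<^sup>2)" by simp
qed (rule borel_measurable_edge, simp)

text \<open>The corrector in one coordinate direction: minus the orthogonal projection of the linear function
  onto the closure of the gradients, extended from the open edges to all displacements.\<close>

lemma scalar_corrector_exists:
  fixes i :: 'd
  obtains Y where "cocycle Y"
    and "\<And>x. integrable P (\<lambda>\<omega>. Y \<omega> x)" and "\<And>x. (\<integral>\<omega>. Y \<omega> x \<partial>P) = 0"
    and "integrable edge_measure (\<lambda>x. (Y (fst x) (snd x))\<^sup>2)"
    and "AE \<omega> in P. divergence (\<lambda>\<omega> z. real_of_int (z $ i) + Y \<omega> z) \<omega> = 0"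
proof -
  define h :: "'d env \<times> (int ^ 'd) \<Rightarrow> real" where "h x = real_of_int (snd x $ i)" for x
  have h [measurable]: "h \<in> borel_measurable edge_measure"
    unfolding h_def by (rule borel_measurable_edge) simp
  have h2: "integrable edge_measure (\<lambda>x. (h x)\<^sup>2)"
    unfolding h_def by (rule integrable_coordinate_sq)
  obtain g where g: "\<And>k. g k \<in> env_gradient ` bounded_functions"
    and cauchy: "\<And>k l. k \<le> l \<Longrightarrow> (\<integral>x. (g l x - g k x)\<^sup>2 \<partial>edge_measure) \<le> (1/4) ^ k"
    and almost_orth: "\<And>k u. u \<in> env_gradient ` bounded_functions \<Longrightarrow>
      \<bar>\<integral>x. (h x + g k x) * u x \<partial>edge_measure\<bar> \<le> (1/2) ^ k * (1 + (\<integral>x. (u x)\<^sup>2 \<partial>edge_measure))"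
  proof (rule minimizing_sequence [where G = "env_gradient ` bounded_functions", OF h h2])
    have "(\<lambda>_. 0) \<in> bounded_functions" by (auto simp: bounded_functions_def)
    then show "(\<lambda>x. 0) \<in> env_gradient ` bounded_functions"
      by (rule rev_image_eqI) (simp add: env_gradient_def [abs_def])
  next
    fix a b g u assume "g \<in> env_gradient ` bounded_functions" "u \<in> env_gradient ` bounded_functions"
    then obtain f f' where f: "f \<in> bounded_functions" "f' \<in> bounded_functions" "g = env_gradient f" "u = env_gradient f'"
      by auto
    show "(\<lambda>x. a * g x + b * u x) \<in> env_gradient ` bounded_functions"
      by (rule image_eqI [OF _ bounded_functions_linear [OF f(1,2), of a b]])
        (simp add: f env_gradient_def [abs_def] algebra_simps)
  next
    show "g \<in> borel_measurable edge_measure" if "g \<in> env_gradient ` bounded_functions" for g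
      using that bounded_functions_measurable measurable_env_gradient by auto
    show "integrable edge_measure (\<lambda>x. (g x)\<^sup>2)" if "g \<in> env_gradient ` bounded_functions" for g
      using that integrable_env_gradient_sq by auto
  qed (rule that)
  have "\<forall>k. \<exists>f\<in>bounded_functions. g k = env_gradient f" using g by blast
  then obtain f where f: "\<And>k. f k \<in> bounded_functions" and g_eq: "\<And>k. g k = env_gradient (f k)"
    by metis
  have f_meas [measurable]: "f k \<in> borel_measurable P" for k using f by measurable
  have g_meas [measurable]: "g k \<in> borel_measurable edge_measure" for k unfolding g_eq by measurable
  define D where "D k \<omega> = f (Suc k) \<omega> - f k \<omega>" for k \<omega>
  have D: "D k \<in> bounded_functions" for k
    unfolding D_def using bounded_functions_linear [OF f f, of 1 "Suc k" "-1" k] by simp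
  have D_meas [measurable]: "D k \<in> borel_measurable P" for k using D by measurable
  have gradD: "env_gradient (D k) x = g (Suc k) x - g k x" for k x
    by (simp add: g_eq env_gradient_def D_def)
  define \<delta> where "\<delta> k x \<omega> = D k (env_shift x \<omega>) - D k \<omega>" for k x \<omega>
  have \<delta>_int: "integrable P (\<delta> k x)" for k x
    unfolding \<delta>_def using integrable_bounded_function [OF D] integrable_shift by auto
  have \<delta>_meas [measurable]: "\<delta> k x \<in> borel_measurable P" for k x using \<delta>_int by auto
  have \<delta>_L1: "(\<integral>\<omega>. \<bar>\<delta> k x \<omega>\<bar> \<partial>P) \<le> (1/2) ^ k * l1 x" for k x
    unfolding \<delta>_def
  proof (rule L1_increment_le [OF D])
    have "(1/4 :: real) ^ k = ((1/2) ^ k)\<^sup>2"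
      by (simp add: power2_eq_square flip: power_mult_distrib)
    then show "(\<integral>x. (env_gradient (D k) x)\<^sup>2 \<partial>edge_measure) \<le> ((1/2) ^ k)\<^sup>2"
      using cauchy [of k "Suc k"] by (simp add: gradD)
  qed simp
  have \<delta>_L1_summable: "summable (\<lambda>k. \<integral>\<omega>. \<bar>\<delta> k x \<omega>\<bar> \<partial>P)" for x
  proof (rule summable_comparison_test')
    show "summable (\<lambda>k. (1/2) ^ k * l1 x)" by (intro summable_mult2 summable_geometric) simp
    show "norm (\<integral>\<omega>. \<bar>\<delta> k x \<omega>\<bar> \<partial>P) \<le> (1/2) ^ k * l1 x" if "k \<ge> 0" for k
      using \<delta>_L1 [of k x] by simp
  qed
  have \<delta>_summable: "AE \<omega> in P. \<forall>x. summable (\<lambda>k. \<bar>\<delta> k x \<omega>\<bar>)"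
    unfolding AE_all_countable by (intro allI AE_summable_of_L1 \<delta>_int \<delta>_L1_summable)
  \<comment> \<open>a telescoping sum for the limit of the increments of \<open>f k\<close>\<close>
  define Y where "Y \<omega> x = (f 0 (env_shift x \<omega>) - f 0 \<omega>) + (\<Sum>k. \<delta> k x \<omega>)" for \<omega> x
  have Y_meas: "(\<lambda>\<omega>. Y \<omega> x) \<in> borel_measurable P" for x
    unfolding Y_def by measurable
  have cocycle_Y: "cocycle Y"
    unfolding cocycle_def
  proof (intro conjI allI)
    show "(\<lambda>\<omega>. Y \<omega> x) \<in> borel_measurable P" for x by (rule Y_meas)
  next
    fix z :: "int ^ 'd"
    show "AE \<omega> in P. \<forall>x. Y \<omega> (x + z) - Y \<omega> z = Y (env_shift z \<omega>) x"
      using \<delta>_summable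
    proof eventually_elim
      case (elim \<omega>)
      show ?case
      proof
        fix x :: "int ^ 'd"
        have "(\<Sum>k. \<delta> k (x + z) \<omega>) - (\<Sum>k. \<delta> k z \<omega>) = (\<Sum>k. \<delta> k (x + z) \<omega> - \<delta> k z \<omega>)"
          by (rule suminf_diff) (rule summable_rabs_cancel, rule spec [OF elim])+
        also have "\<dots> = (\<Sum>k. \<delta> k x (env_shift z \<omega>))" by (simp add: \<delta>_def)
        finally show "Y \<omega> (x + z) - Y \<omega> z = Y (env_shift z \<omega>) x" by (simp add: Y_def)
      qed
    qed
  qed
  have \<delta>_summable_at: "AE \<omega> in P. summable (\<lambda>k. norm (\<delta> k x \<omega>))" for x
    using \<delta>_summable by eventually_elim simp
  have f0_int: "integrable P (\<lambda>\<omega>. f 0 (env_shift x \<omega>) - f 0 \<omega>)" for x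
    using integrable_bounded_function [OF f] integrable_shift by auto
  have sum_int: "integrable P (\<lambda>\<omega>. \<Sum>k. \<delta> k x \<omega>)" for x
    by (rule integrable_suminf [OF \<delta>_int \<delta>_summable_at]) (simp add: \<delta>_L1_summable)
  have Y_int: "integrable P (\<lambda>\<omega>. Y \<omega> x)" for x
    unfolding Y_def by (intro Bochner_Integration.integrable_add f0_int sum_int)
  have mean_increment: "(\<integral>\<omega>. u (env_shift x \<omega>) - u \<omega> \<partial>P) = 0" if "u \<in> bounded_functions" for u x
    using integrable_bounded_function [OF that] integrable_shift integral_shift [of u x]
    by (subst Bochner_Integration.integral_diff) auto
  have Y_mean: "(\<integral>\<omega>. Y \<omega> x \<partial>P) = 0" for x
  proof -
    have "(\<integral>\<omega>. (\<Sum>k. \<delta> k x \<omega>) \<partial>P) = (\<Sum>k. (\<integral>\<omega>. \<delta> k x \<omega> \<partial>P))"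
      by (rule integral_suminf [OF \<delta>_int \<delta>_summable_at]) (simp add: \<delta>_L1_summable)
    also have "\<dots> = 0" unfolding \<delta>_def using mean_increment [OF D] by simp
    finally show ?thesis
      unfolding Y_def using mean_increment [OF f, of 0 x] f0_int sum_int by simp
  qed
  have Y_edge [measurable]: "(\<lambda>x. Y (fst x) (snd x)) \<in> borel_measurable edge_measure"
    by (rule cocycle_measurable_edge [OF cocycle_Y])
  have g_lim: "AE x in edge_measure. (\<lambda>l. g l x) \<longlonglongrightarrow> Y (fst x) (snd x)"
  proof (rule AE_edge)
    fix z :: "int ^ 'd"
    show "AE \<omega> in P. cond \<omega> 0 z = 1 \<longrightarrow> (\<lambda>l. g l (\<omega>, z)) \<longlonglongrightarrow> Y (fst (\<omega>, z)) (snd (\<omega>, z))"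
      using \<delta>_summable
    proof eventually_elim
      case (elim \<omega>)
      have "g l (\<omega>, z) = (f 0 (env_shift z \<omega>) - f 0 \<omega>) + (\<Sum>k<l. \<delta> k z \<omega>)" for l
        by (induction l) (auto simp: g_eq env_gradient_def \<delta>_def D_def)
      moreover have "(\<lambda>l. \<Sum>k<l. \<delta> k z \<omega>) \<longlonglongrightarrow> (\<Sum>k. \<delta> k z \<omega>)"
        by (rule summable_LIMSEQ, rule summable_rabs_cancel, rule spec [OF elim])
      ultimately show ?case by (auto simp: Y_def intro!: tendsto_intros)
    qed
  qed
  have g2: "integrable edge_measure (\<lambda>x. (g k x)\<^sup>2)" for k
    unfolding g_eq by (rule integrable_env_gradient_sq [OF f])
  have diff_int: "integrable edge_measure (\<lambda>x. (g l x - g k x)\<^sup>2)" for k l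
    using integrable_add_squares [of "g l" edge_measure "\<lambda>x. - g k x"] g2 by simp
  \<comment> \<open>by Fatou's lemma, the Cauchy bound passes to the pointwise limit\<close>
  have nn: "(\<integral>\<^sup>+x. ennreal ((Y (fst x) (snd x) - g k x)\<^sup>2) \<partial>edge_measure) \<le> ennreal ((1/4) ^ k)" for k
  proof -
    have "(\<integral>\<^sup>+x. ennreal ((Y (fst x) (snd x) - g k x)\<^sup>2) \<partial>edge_measure)
      = (\<integral>\<^sup>+x. liminf (\<lambda>l. ennreal ((g l x - g k x)\<^sup>2)) \<partial>edge_measure)"
    proof (rule nn_integral_cong_AE)
      show "AE x in edge_measure. ennreal ((Y (fst x) (snd x) - g k x)\<^sup>2) = liminf (\<lambda>l. ennreal ((g l x - g k x)\<^sup>2))"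
        using g_lim
      proof eventually_elim
        case (elim x)
        then have "(\<lambda>l. ennreal ((g l x - g k x)\<^sup>2)) \<longlonglongrightarrow> ennreal ((Y (fst x) (snd x) - g k x)\<^sup>2)"
          by (intro tendsto_intros)
        then show ?case by (intro lim_imp_Liminf [symmetric]) auto
      qed
    qed
    also have "\<dots> \<le> liminf (\<lambda>l. \<integral>\<^sup>+x. ennreal ((g l x - g k x)\<^sup>2) \<partial>edge_measure)"
      by (rule nn_integral_liminf) measurable
    also have "\<dots> \<le> ennreal ((1/4) ^ k)"
    proof -
      have "(\<integral>\<^sup>+x. ennreal ((g l x - g k x)\<^sup>2) \<partial>edge_measure) \<le> ennreal ((1/4) ^ k)" if "l \<ge> k" for l
        using cauchy [OF that] diff_int [of l k] by (simp add: nn_integral_eq_integral ennreal_leI)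
      then have "\<forall>\<^sub>F l in sequentially. (\<integral>\<^sup>+x. ennreal ((g l x - g k x)\<^sup>2) \<partial>edge_measure) \<le> ennreal ((1/4) ^ k)"
        unfolding eventually_sequentially by blast
      then have "liminf (\<lambda>l. \<integral>\<^sup>+x. ennreal ((g l x - g k x)\<^sup>2) \<partial>edge_measure) \<le> liminf (\<lambda>l::nat. ennreal ((1/4) ^ k))"
        by (rule Liminf_mono)
      then show ?thesis by (simp add: Liminf_const)
    qed
    finally show ?thesis .
  qed
  have Yg_int: "integrable edge_measure (\<lambda>x. (Y (fst x) (snd x) - g k x)\<^sup>2)" for k
    using nn [of k] by (intro integrableI_nonneg) (auto intro: order.strict_trans1)
  have Yg_le: "(\<integral>x. (Y (fst x) (snd x) - g k x)\<^sup>2 \<partial>edge_measure) \<le> (1/4) ^ k" for k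
    using nn [of k] by (simp add: nn_integral_eq_integral [OF Yg_int])
  have Y2: "integrable edge_measure (\<lambda>x. (Y (fst x) (snd x))\<^sup>2)"
    using integrable_add_squares [OF _ _ Yg_int [of 0] g2 [of 0]] by simp
  let ?W = "\<lambda>\<omega> z. real_of_int (z $ i) + Y \<omega> z"
  have W: "cocycle ?W" by (rule cocycle_add_linear [OF cocycle_Y])
  have W2: "integrable edge_measure (\<lambda>x. (?W (fst x) (snd x))\<^sup>2)"
    using integrable_add_squares [OF h Y_edge h2 Y2] by (simp add: h_def)
  have "AE \<omega> in P. divergence ?W \<omega> = 0"
  proof (rule divergence_eq_0_if_orthogonal [OF W W2])
    fix v assume v: "v \<in> bounded_functions"
    let ?u = "env_gradient v"
    let ?Q = "\<integral>x. (?u x)\<^sup>2 \<partial>edge_measure"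
    have v_meas [measurable]: "v \<in> borel_measurable P" using v by measurable
    have u2: "integrable edge_measure (\<lambda>x. (?u x)\<^sup>2)" by (rule integrable_env_gradient_sq [OF v])
    have bound: "\<bar>\<integral>x. ?W (fst x) (snd x) * ?u x \<partial>edge_measure\<bar> \<le> (1/2) ^ k * (2 * (1 + ?Q))" for k :: nat
    proof -
      let ?R = "\<lambda>x. Y (fst x) (snd x) - g k x"
      have i1: "integrable edge_measure (\<lambda>x. (h x + g k x) * ?u x)"
        using h2 g2 [of k] u2 by (intro integrable_mult_of_squares integrable_add_squares) auto
      have i2: "integrable edge_measure (\<lambda>x. ?R x * ?u x)"
        using Yg_int [of k] u2 by (intro integrable_mult_of_squares) auto
      have split: "(\<integral>x. ?W (fst x) (snd x) * ?u x \<partial>edge_measure)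
        = (\<integral>x. (h x + g k x) * ?u x \<partial>edge_measure) + (\<integral>x. ?R x * ?u x \<partial>edge_measure)"
        by (subst Bochner_Integration.integral_add [OF i1 i2, symmetric])
          (auto simp: h_def algebra_simps intro!: Bochner_Integration.integral_cong)
      \<comment> \<open>weights balancing \<open>\<integral> ?R\<^sup>2 \<le> (1/4) ^ k\<close> against the fixed \<open>?Q\<close>\<close>
      have young: "\<bar>a * b\<bar> \<le> 2 ^ k * a\<^sup>2 + (1/2) ^ k * b\<^sup>2" for a b :: real
      proof -
        define t :: real where "t = 2 ^ k"
        have t: "t > 0" "(1/2) ^ k = 1 / t" by (simp_all add: t_def power_one_over)
        have "0 \<le> (t * \<bar>a\<bar> - \<bar>b\<bar>)\<^sup>2" by simp
        then have "2 * t * \<bar>a * b\<bar> \<le> t\<^sup>2 * a\<^sup>2 + b\<^sup>2"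
          by (simp add: power2_eq_square algebra_simps abs_mult)
        moreover have "0 \<le> t * \<bar>a * b\<bar>" using t by simp
        ultimately have "t * \<bar>a * b\<bar> \<le> t\<^sup>2 * a\<^sup>2 + b\<^sup>2" by linarith
        also have "\<dots> = t * (t * a\<^sup>2 + 1 / t * b\<^sup>2)" using t by (simp add: power2_eq_square field_simps)
        finally show ?thesis using t unfolding t_def [symmetric] by simp
      qed
      have "\<bar>\<integral>x. ?R x * ?u x \<partial>edge_measure\<bar> \<le> (\<integral>x. \<bar>?R x * ?u x\<bar> \<partial>edge_measure)"
        by (rule integral_abs_bound)
      also have "\<dots> \<le> (\<integral>x. 2 ^ k * (?R x)\<^sup>2 + (1/2) ^ k * (?u x)\<^sup>2 \<partial>edge_measure)"
        using i2 Yg_int [of k] u2 by (intro integral_mono young) auto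
      also have "\<dots> = 2 ^ k * (\<integral>x. (?R x)\<^sup>2 \<partial>edge_measure) + (1/2) ^ k * ?Q"
        using Yg_int [of k] u2 by simp
      also have "\<dots> \<le> 2 ^ k * (1/4) ^ k + (1/2) ^ k * ?Q"
        by (intro add_right_mono mult_left_mono Yg_le) simp
      also have "(2::real) ^ k * (1/4) ^ k = (1/2) ^ k" by (simp flip: power_mult_distrib)
      finally have "\<bar>\<integral>x. ?R x * ?u x \<partial>edge_measure\<bar> \<le> (1/2) ^ k * (1 + ?Q)" by (simp add: algebra_simps)
      moreover have "\<bar>\<integral>x. (h x + g k x) * ?u x \<partial>edge_measure\<bar> \<le> (1/2) ^ k * (1 + ?Q)"
        using v by (intro almost_orth) auto
      ultimately show ?thesis unfolding split by (simp add: algebra_simps)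
    qed
    have "(\<lambda>k. (1/2) ^ k * (2 * (1 + ?Q))) \<longlonglongrightarrow> 0 * (2 * (1 + ?Q))"
      by (intro tendsto_intros LIMSEQ_power_zero) simp
    then have "\<bar>\<integral>x. ?W (fst x) (snd x) * ?u x \<partial>edge_measure\<bar> \<le> 0"
      using LIMSEQ_le_const [of _ 0] bound by fastforce
    then show "(\<integral>x. ?W (fst x) (snd x) * ?u x \<partial>edge_measure) = 0" by simp
  qed
  then show ?thesis using that cocycle_Y Y_int Y_mean Y2 by blast
qed

end

lemma harmonic_at_iff:
  fixes f :: "int ^ 'd::finite \<Rightarrow> 'b::real_normed_vector"
  assumes c01: "\<And>y. cond \<omega> x y = 0 \<or> cond \<omega> x y = 1"
    and fin: "finite {y. cond \<omega> x y = 1}" and ne: "{y. cond \<omega> x y = 1} \<noteq> {}"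
  shows "harmonic_at \<omega> f x \<longleftrightarrow> (\<Sum>y | cond \<omega> x y = 1. f y - f x) = 0"
proof -
  let ?N = "{y. cond \<omega> x y = 1}"
  have sm: "(\<lambda>y. cond \<omega> x y) summable_on UNIV"
    using c01 by (subst summable_on_cong_neutral [where T = ?N and g = "cond \<omega> x"]) (auto simp: fin)
  have smf: "(\<lambda>y. cond \<omega> x y *\<^sub>R (f y - f x)) summable_on UNIV"
    using c01 by (subst summable_on_cong_neutral [where T = ?N and g = "\<lambda>y. f y - f x"]) (auto simp: fin)
  have "total_cond \<omega> x = infsum (\<lambda>y. 1) ?N"
    unfolding total_cond_def using c01 by (intro infsum_cong_neutral) auto
  then have "total_cond \<omega> x = real (card ?N)" using fin by simp
  then have "total_cond \<omega> x \<noteq> 0" using fin ne by simp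
  moreover have "(\<Sum>\<^sub>\<infinity>y. cond \<omega> x y *\<^sub>R (f y - f x)) = infsum (\<lambda>y. f y - f x) ?N"
    using c01 by (intro infsum_cong_neutral) auto
  ultimately show ?thesis
    using fin sm smf by (simp add: harmonic_at_def generator_def)
qed

lemma norm_vec_sq: "(norm v)\<^sup>2 = (\<Sum>i\<in>UNIV. (v $ i)\<^sup>2)" for v :: "real ^ 'n::finite"
  by (simp add: norm_vec_def L2_set_def sum_nonneg)

lemma vec_lambda_eq_sum: "(\<chi> i. f i) = (\<Sum>i\<in>UNIV. f i *\<^sub>R axis i (1::real))"
  by (simp add: vec_eq_iff axis_def if_distrib [of "\<lambda>u. _ * u"] cong: if_cong)

lemma borel_measurable_vec_lambda:
  fixes f :: "'n::finite \<Rightarrow> 'a \<Rightarrow> real"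
  assumes [measurable]: "\<And>i. f i \<in> borel_measurable M"
  shows "(\<lambda>\<omega>. \<chi> i. f i \<omega>) \<in> borel_measurable M"
  unfolding vec_lambda_eq_sum by measurable

lemma borel_measurable_vec_nth:
  assumes "f \<in> borel_measurable M"
  shows "(\<lambda>\<omega>. f \<omega> $ i :: real) \<in> borel_measurable M"
  by (rule borel_measurable_continuous_on [where f = "\<lambda>v. v $ i", OF _ assms]) (intro continuous_intros)

context random_environment
begin

text \<open>On these environments the infinite sums in \<open>harmonic_at\<close> are finite sums over the open edges, with a
  positive normalisation.\<close>

definition typical :: "'d env \<Rightarrow> bool" where
  "typical \<omega> \<longleftrightarrow> (\<forall>x y. cond \<omega> x y = 0 \<or> cond \<omega> x y = 1) \<and>
     (\<forall>x. finite {y. cond \<omega> x y = 1} \<and> {y. cond \<omega> x y = 1} \<noteq> {})"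

lemma open_nbrs_shift: "{y. cond \<omega> x y = 1} = (\<lambda>z. z + x) ` open_nbrs (env_shift x \<omega>)"
proof (intro equalityI subsetI)
  fix y assume "y \<in> {y. cond \<omega> x y = 1}"
  then show "y \<in> (\<lambda>z. z + x) ` open_nbrs (env_shift x \<omega>)"
    by (intro image_eqI [of _ _ "y - x"]) auto
qed auto

lemma AE_typical: "AE \<omega> in P. typical \<omega>"
proof -
  have "AE \<omega> in P. \<forall>x. finite (open_nbrs (env_shift x \<omega>))"
    unfolding AE_all_countable by (intro allI AE_shift AE_finite_open_nbrs)
  with conductances_01 nearest_neighbours_open show ?thesis
  proof eventually_elim
    case (elim \<omega>)
    show ?case
      unfolding typical_def
    proof (intro conjI allI)
      fix x
      show "finite {y. cond \<omega> x y = 1}"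
        by (subst open_nbrs_shift) (use elim(3) in blast)
      obtain i :: 'd where True by simp
      let ?e = "axis i 1 :: int ^ 'd"
      have "l1 ?e = 1"
        by (simp add: axis_def if_distrib [of real_of_int] if_distrib [of abs] cong: if_cong)
      then have "cond \<omega> x (x + ?e) = 1" using elim(2) by simp
      then show "{y. cond \<omega> x y = 1} \<noteq> {}" by blast
    qed (use elim(1) in auto)
  qed
qed

lemma typical_sum_open:
  fixes g :: "int ^ 'd \<Rightarrow> 'b::comm_monoid_add"
  shows "(\<Sum>y | cond \<omega> x y = 1. g y) = (\<Sum>z\<in>open_nbrs (env_shift x \<omega>). g (z + x))"
  by (subst open_nbrs_shift, subst sum.reindex) (auto simp: inj_on_def)

lemma energy_eq:
  assumes X: "\<And>x. (\<lambda>\<omega>. X \<omega> x) \<in> borel_measurable P"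
  shows "(\<integral>\<^sup>+ \<omega>. (\<Sum>\<^sub>\<infinity>x. ennreal (cond \<omega> 0 x * (norm (X \<omega> x :: real ^ 'd))\<^sup>2)) \<partial>P)
    = (\<integral>\<^sup>+ x. ennreal ((norm (X (fst x) (snd x)))\<^sup>2) \<partial>edge_measure)"
proof -
  have "(\<lambda>x. ennreal ((norm (X (fst x) (snd x)))\<^sup>2)) \<in> borel_measurable edge_measure"
    by (rule borel_measurable_edge) (use X in simp)
  then have "(\<integral>\<^sup>+ x. ennreal ((norm (X (fst x) (snd x)))\<^sup>2) \<partial>edge_measure)
    = (\<integral>\<^sup>+\<omega>. \<integral>\<^sup>+z. ennreal (indicator (open_nbrs \<omega>) z) * ennreal ((norm (X \<omega> z))\<^sup>2) \<partial>count_space UNIV \<partial>P)"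
    by (subst nn_integral_edge(2)) auto
  also have "\<dots> = (\<integral>\<^sup>+ \<omega>. (\<Sum>\<^sub>\<infinity>x. ennreal (cond \<omega> 0 x * (norm (X \<omega> x))\<^sup>2)) \<partial>P)"
  proof (rule nn_integral_cong_AE, use AE_typical in eventually_elim)
    case (elim \<omega>)
    have fin: "finite (open_nbrs \<omega>)" and c01: "cond \<omega> 0 z = 0 \<or> cond \<omega> 0 z = 1" for z
      using elim by (auto simp: typical_def)
    have "(\<integral>\<^sup>+z. ennreal (indicator (open_nbrs \<omega>) z) * ennreal ((norm (X \<omega> z))\<^sup>2) \<partial>count_space UNIV)
      = (\<Sum>z\<in>open_nbrs \<omega>. ennreal (indicator (open_nbrs \<omega>) z) * ennreal ((norm (X \<omega> z))\<^sup>2))"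
      by (rule nn_integral_count_space' [OF fin]) auto
    also have "\<dots> = infsum (\<lambda>z. ennreal ((norm (X \<omega> z))\<^sup>2)) (open_nbrs \<omega>)"
      by (subst infsum_finite [OF fin]) (auto intro: sum.cong)
    also have "\<dots> = (\<Sum>\<^sub>\<infinity>x. ennreal (cond \<omega> 0 x * (norm (X \<omega> x))\<^sup>2))"
    proof (rule infsum_cong_neutral)
      fix x assume "x \<in> UNIV - open_nbrs \<omega>"
      then have "cond \<omega> 0 x = 0" using c01 [of x] by blast
      then show "ennreal (cond \<omega> 0 x * (norm (X \<omega> x))\<^sup>2) = 0" by simp
    qed auto
    finally show ?case .
  qed
  finally show ?thesis by simp
qed

lemma measurable_env_field:
  assumes [measurable]: "\<And>x. (\<lambda>\<omega>. F \<omega> x) \<in> borel_measurable P"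
  shows "(\<lambda>\<omega>. (env_shift z \<omega>, F \<omega>)) \<in> measurable P (env_algebra \<Otimes>\<^sub>M (\<Pi>\<^sub>M x\<in>(UNIV :: (int ^ 'd) set). (borel :: (real ^ 'd) measure)))"
proof (rule measurable_Pair)
  show "env_shift z \<in> measurable P env_algebra" by measurable
  show "F \<in> measurable P (\<Pi>\<^sub>M x\<in>UNIV. borel)"
    by (rule measurable_abs_UNIV [of "\<lambda>x \<omega>. F \<omega> x"]) (rule assms)
qed

text \<open>The graph of the corrector has full measure under the joint law of environment and corrector;
  stationarity of the joint law transports this to the shifted pair.\<close>

lemma corrector_cocycle:
  assumes "corrector_properties P X"
  shows "AE \<omega> in P. \<forall>x. X \<omega> (x + z) - X \<omega> z = X (env_shift z \<omega>) x"
proof -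
  have X [measurable]: "(\<lambda>\<omega>. X \<omega> x) \<in> borel_measurable P" for x
    using assms by (simp add: corrector_properties_def)
  have X' [measurable]: "(\<lambda>\<omega>. X \<omega> x) \<in> borel_measurable env_algebra" for x
    using X measurable_cong_sets [OF sets_P refl] by blast
  let ?L = "env_algebra \<Otimes>\<^sub>M (\<Pi>\<^sub>M x\<in>(UNIV :: (int ^ 'd) set). (borel :: (real ^ 'd) measure))"
  have law: "distr P ?L (\<lambda>\<omega>. (env_shift z \<omega>, \<lambda>x. X \<omega> (x + z) - X \<omega> z)) = distr P ?L (\<lambda>\<omega>. (\<omega>, X \<omega>))"
    using assms by (simp add: corrector_properties_def)
  have graph: "{x \<in> space ?L. \<forall>y. snd x y = X (fst x) y} \<in> sets ?L"
  proof -
    have "{x \<in> space ?L. snd x y = X (fst x) y} \<in> sets ?L" for y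
    proof -
      have "(\<lambda>x. snd x y) \<in> borel_measurable ?L"
        by (rule measurable_compose [OF measurable_snd measurable_component_singleton]) simp
      moreover have "(\<lambda>x. X (fst x) y) \<in> borel_measurable ?L"
        by (rule measurable_compose [OF measurable_fst X'])
      ultimately show ?thesis by measurable
    qed
    then show ?thesis by (intro sets.sets_Collect_countable_All) auto
  qed
  have m1: "(\<lambda>\<omega>. (\<omega>, X \<omega>)) \<in> measurable P ?L"
    using measurable_env_field [of X 0] X by simp
  have m2: "(\<lambda>\<omega>. (env_shift z \<omega>, \<lambda>x. X \<omega> (x + z) - X \<omega> z)) \<in> measurable P ?L"
    by (rule measurable_env_field) simp
  have "AE x in distr P ?L (\<lambda>\<omega>. (\<omega>, X \<omega>)). \<forall>y. snd x y = X (fst x) y"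
    by (subst AE_distr_iff [OF m1 graph]) simp
  then have "AE x in distr P ?L (\<lambda>\<omega>. (env_shift z \<omega>, \<lambda>x. X \<omega> (x + z) - X \<omega> z)). \<forall>y. snd x y = X (fst x) y"
    by (simp only: law)
  then show ?thesis
    by (subst (asm) AE_distr_iff [OF m2 graph]) simp
qed

lemma corrector_coordinate:
  assumes X: "corrector_properties P X"
  shows "cocycle (\<lambda>\<omega> x. X \<omega> x $ i)"
    and "integrable edge_measure (\<lambda>x. (X (fst x) (snd x) $ i)\<^sup>2)"
    and "AE \<omega> in P. divergence (\<lambda>\<omega> z. real_of_int (z $ i) + X \<omega> z $ i) \<omega> = 0"
proof -
  have Xm: "(\<lambda>\<omega>. X \<omega> x) \<in> borel_measurable P" for x
    using X by (simp add: corrector_properties_def)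
  have Xi [measurable]: "(\<lambda>\<omega>. X \<omega> x $ i) \<in> borel_measurable P" for x
    by (rule borel_measurable_vec_nth [OF Xm])
  show "cocycle (\<lambda>\<omega> x. X \<omega> x $ i)"
    unfolding cocycle_def
  proof (intro conjI allI)
    fix z
    show "AE \<omega> in P. \<forall>x. X \<omega> (x + z) $ i - X \<omega> z $ i = X (env_shift z \<omega>) x $ i"
      using corrector_cocycle [OF X, of z]
      by eventually_elim (metis vector_minus_component)
  qed (rule Xi)
  have energy: "(\<integral>\<^sup>+ x. ennreal ((norm (X (fst x) (snd x)))\<^sup>2) \<partial>edge_measure) < \<infinity>"
    using X energy_eq [OF Xm] by (simp add: corrector_properties_def)
  show "integrable edge_measure (\<lambda>x. (X (fst x) (snd x) $ i)\<^sup>2)"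
  proof (rule integrableI_nonneg)
    have "(\<integral>\<^sup>+ x. ennreal ((X (fst x) (snd x) $ i)\<^sup>2) \<partial>edge_measure)
      \<le> (\<integral>\<^sup>+ x. ennreal ((norm (X (fst x) (snd x)))\<^sup>2) \<partial>edge_measure)"
    proof (intro nn_integral_mono ennreal_leI)
      show "(v $ i)\<^sup>2 \<le> (norm v)\<^sup>2" for v :: "real ^ 'd"
        using component_le_norm_cart [of v i] by (metis abs_ge_zero power2_abs power_mono)
    qed
    then show "(\<integral>\<^sup>+ x. ennreal ((X (fst x) (snd x) $ i)\<^sup>2) \<partial>edge_measure) < \<infinity>"
      using energy by (rule order.strict_trans1)
  qed (auto intro!: borel_measurable_edge)
  have "AE \<omega> in P. X \<omega> 0 = 0" and "AE \<omega> in P. \<forall>x. harmonic_at \<omega> (\<lambda>y. emb y + X \<omega> y) x"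
    using X by (auto simp: corrector_properties_def)
  with AE_typical show "AE \<omega> in P. divergence (\<lambda>\<omega> z. real_of_int (z $ i) + X \<omega> z $ i) \<omega> = 0"
  proof eventually_elim
    case (elim \<omega>)
    have "harmonic_at \<omega> (\<lambda>y. emb y + X \<omega> y) 0" using elim(3) by blast
    then have "(\<Sum>y | cond \<omega> 0 y = 1. (emb y + X \<omega> y) - (emb 0 + X \<omega> 0)) = 0"
      using elim(1) by (subst (asm) harmonic_at_iff) (auto simp: typical_def)
    then have "(\<Sum>y | cond \<omega> 0 y = 1. (emb y + X \<omega> y) - (emb 0 + X \<omega> 0)) $ i = 0" by simp
    then show ?case
      by (simp add: divergence_def elim(2))
  qed
qed

theorem corrector_exists: "\<exists>X. is_corrector P X"
proof -
  have "\<forall>i. \<exists>Y. cocycle Y \<and> (\<forall>x. integrable P (\<lambda>\<omega>. Y \<omega> x) \<and> (\<integral>\<omega>. Y \<omega> x \<partial>P) = 0) \<and>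
      integrable edge_measure (\<lambda>x. (Y (fst x) (snd x))\<^sup>2) \<and>
      (AE \<omega> in P. divergence (\<lambda>\<omega> z. real_of_int (z $ i) + Y \<omega> z) \<omega> = 0)"
  proof
    fix i :: 'd
    show "\<exists>Y. cocycle Y \<and> (\<forall>x. integrable P (\<lambda>\<omega>. Y \<omega> x) \<and> (\<integral>\<omega>. Y \<omega> x \<partial>P) = 0) \<and>
      integrable edge_measure (\<lambda>x. (Y (fst x) (snd x))\<^sup>2) \<and>
      (AE \<omega> in P. divergence (\<lambda>\<omega> z. real_of_int (z $ i) + Y \<omega> z) \<omega> = 0)"
      by (rule scalar_corrector_exists [of i]) blast
  qed
  from choice [OF this] obtain Y where Y: "\<forall>i. cocycle (Y i) \<and> (\<forall>x. integrable P (\<lambda>\<omega>. Y i \<omega> x) \<and> (\<integral>\<omega>. Y i \<omega> x \<partial>P) = 0) \<and>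
      integrable edge_measure (\<lambda>x. (Y i (fst x) (snd x))\<^sup>2) \<and>
      (AE \<omega> in P. divergence (\<lambda>\<omega> z. real_of_int (z $ i) + Y i \<omega> z) \<omega> = 0)" ..
  define X where "X \<omega> x = (\<chi> i. Y i \<omega> x)" for \<omega> x
  have X [measurable]: "(\<lambda>\<omega>. X \<omega> x) \<in> borel_measurable P" for x
    unfolding X_def using Y by (intro borel_measurable_vec_lambda) (simp add: cocycle_measurable)
  have Y_cocycle: "AE \<omega> in P. \<forall>i x. Y i \<omega> (x + z) - Y i \<omega> z = Y i (env_shift z \<omega>) x" for z
  proof -
    have "AE \<omega> in P. \<forall>x. Y i \<omega> (x + z) - Y i \<omega> z = Y i (env_shift z \<omega>) x" for i
      using Y cocycle_AE by blast
    then have "AE \<omega> in P. \<forall>i\<in>UNIV. \<forall>x. Y i \<omega> (x + z) - Y i \<omega> z = Y i (env_shift z \<omega>) x"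
      by (subst AE_finite_all) auto
    then show ?thesis by simp
  qed
  have X_cocycle: "AE \<omega> in P. \<forall>x. X \<omega> (x + z) - X \<omega> z = X (env_shift z \<omega>) x" for z
    using Y_cocycle [of z] by eventually_elim (simp add: X_def vec_eq_iff)
  have X0: "AE \<omega> in P. X \<omega> 0 = 0"
    using X_cocycle [of 0]
  proof eventually_elim
    case (elim \<omega>)
    from spec [OF this, of 0] show ?case by simp
  qed
  let ?L = "env_algebra \<Otimes>\<^sub>M (\<Pi>\<^sub>M x\<in>(UNIV :: (int ^ 'd) set). (borel :: (real ^ 'd) measure))"
  have m1: "(\<lambda>\<omega>. (\<omega>, X \<omega>)) \<in> measurable P ?L"
    using measurable_env_field [of X 0] X by simp
  have law: "distr P ?L (\<lambda>\<omega>. (env_shift z \<omega>, \<lambda>x. X \<omega> (x + z) - X \<omega> z)) = distr P ?L (\<lambda>\<omega>. (\<omega>, X \<omega>))" for z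
  proof -
    have "distr P ?L (\<lambda>\<omega>. (env_shift z \<omega>, \<lambda>x. X \<omega> (x + z) - X \<omega> z))
      = distr P ?L ((\<lambda>\<omega>. (\<omega>, X \<omega>)) \<circ> env_shift z)"
    proof (rule distr_cong_AE)
      show "AE \<omega> in P. (env_shift z \<omega>, \<lambda>x. X \<omega> (x + z) - X \<omega> z) = ((\<lambda>\<omega>. (\<omega>, X \<omega>)) \<circ> env_shift z) \<omega>"
        using X_cocycle [of z] by eventually_elim auto
      show "(\<lambda>\<omega>. (env_shift z \<omega>, \<lambda>x. X \<omega> (x + z) - X \<omega> z)) \<in> measurable P ?L"
        by (rule measurable_env_field) simp
      show "(\<lambda>\<omega>. (\<omega>, X \<omega>)) \<circ> env_shift z \<in> measurable P ?L"
        by (rule measurable_comp [OF measurable_shift m1])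
    qed simp_all
    also have "\<dots> = distr (distr P P (env_shift z)) ?L (\<lambda>\<omega>. (\<omega>, X \<omega>))"
      by (rule distr_distr [symmetric, OF m1 measurable_shift])
    finally show ?thesis by (simp only: distr_shift)
  qed
  have "(\<integral>\<^sup>+ x. ennreal ((norm (X (fst x) (snd x)))\<^sup>2) \<partial>edge_measure) < \<infinity>"
  proof -
    have int: "integrable edge_measure (\<lambda>x. \<Sum>i\<in>UNIV. (Y i (fst x) (snd x))\<^sup>2)"
      using Y by auto
    have "(\<lambda>x. \<Sum>i\<in>UNIV. (Y i (fst x) (snd x))\<^sup>2) = (\<lambda>x. (norm (X (fst x) (snd x)))\<^sup>2)"
      by (simp add: norm_vec_sq X_def)
    with int have "integrable edge_measure (\<lambda>x. (norm (X (fst x) (snd x)))\<^sup>2)" by simp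
    then show ?thesis by (simp add: nn_integral_eq_integral)
  qed
  then have energy: "(\<integral>\<^sup>+ \<omega>. (\<Sum>\<^sub>\<infinity>x. ennreal (cond \<omega> 0 x * (norm (X \<omega> x))\<^sup>2)) \<partial>P) < \<infinity>"
    using energy_eq [OF X] by simp
  have harmonic: "AE \<omega> in P. \<forall>x. harmonic_at \<omega> (\<lambda>y. emb y + X \<omega> y) x"
    unfolding AE_all_countable
  proof
    fix x :: "int ^ 'd"
    have "AE \<omega> in P. \<forall>i\<in>UNIV. divergence (\<lambda>\<omega> z. real_of_int (z $ i) + Y i \<omega> z) \<omega> = 0"
      using Y by (subst AE_finite_all) auto
    from AE_shift [OF this, of x] AE_typical X_cocycle [of x]
    show "AE \<omega> in P. harmonic_at \<omega> (\<lambda>y. emb y + X \<omega> y) x"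
    proof eventually_elim
      case (elim \<omega>)
      have "(\<Sum>y | cond \<omega> x y = 1. (emb y + X \<omega> y) - (emb x + X \<omega> x))
        = (\<Sum>z\<in>open_nbrs (env_shift x \<omega>). emb z + X (env_shift x \<omega>) z)"
        by (subst typical_sum_open) (use elim(3) in \<open> auto intro!: sum.cong simp: emb_add algebra_simps\<close>)
      also have "\<dots> = 0"
        using elim(1) by (simp add: vec_eq_iff divergence_def X_def)
      finally show ?case
        using elim(2) by (subst harmonic_at_iff) (auto simp: typical_def)
    qed
  qed
  have X_sum: "X \<omega> x = (\<Sum>i\<in>UNIV. Y i \<omega> x *\<^sub>R axis i 1)" for \<omega> x
    unfolding X_def by (rule vec_lambda_eq_sum)
  have "integrable P (\<lambda>\<omega>. X \<omega> x) \<and> (\<integral>\<omega>. X \<omega> x \<partial>P) = 0" for x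
    unfolding X_sum using Y by (simp add: integrable_scaleR_left)
  then have "is_corrector P X"
    using X X0 law energy harmonic unfolding is_corrector_def corrector_properties_def by blast
  then show ?thesis by blast
qed

end

section \<open>Uniqueness of the corrector\<close>

text \<open>For bounded \<open>F\<close> this is clear, and truncating \<open>F\<close> costs little as \<open>g n\<close> is bounded by 1.\<close>

lemma (in finite_measure) integral_mult_vanishing:
  fixes F :: "'a \<Rightarrow> real" and g :: "nat \<Rightarrow> 'a \<Rightarrow> real"
  assumes F: "integrable M F" "\<And>x. 0 \<le> F x"
    and [measurable]: "\<And>n. g n \<in> borel_measurable M" and g: "\<And>n x. 0 \<le> g n x" "\<And>n x. g n x \<le> 1"
    and lim: "(\<lambda>n. \<integral>x. g n x \<partial>M) \<longlonglongrightarrow> 0"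
  shows "(\<lambda>n. \<integral>x. F x * g n x \<partial>M) \<longlonglongrightarrow> 0"
proof (rule LIMSEQ_I)
  fix \<epsilon> :: real assume \<epsilon>: "\<epsilon> > 0"
  have [measurable]: "F \<in> borel_measurable M" using F by auto
  have gi: "integrable M (g n)" for n
    using g by (intro integrable_const_bound [of _ 1]) auto
  have "(\<lambda>k. \<integral>x. F x - min (F x) (real k) \<partial>M) \<longlonglongrightarrow> (\<integral>x. 0 \<partial>M)"
  proof (rule integral_dominated_convergence [where w = F])
    show "AE x in M. (\<lambda>k. F x - min (F x) (real k)) \<longlonglongrightarrow> 0"
    proof (rule AE_I2)
      fix x
      have "\<forall>\<^sub>F k in sequentially. F x - min (F x) (real k) = 0"
        using eventually_ge_at_top [of "nat \<lceil>F x\<rceil>"] by eventually_elim (subst min_absorb1, linarith, simp)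
      then show "(\<lambda>k. F x - min (F x) (real k)) \<longlonglongrightarrow> 0" by (rule tendsto_eventually)
    qed
  qed (use F in auto)
  then obtain k where k: "(\<integral>x. F x - min (F x) (real k) \<partial>M) < \<epsilon> / 2"
    using LIMSEQ_D [of _ _ "\<epsilon> / 2"] \<epsilon> by fastforce
  have mi: "integrable M (\<lambda>x. min (F x) (real k))"
    using F by (intro integrable_const_bound [of _ "real k"]) auto
  have "(\<lambda>n. real k * (\<integral>x. g n x \<partial>M)) \<longlonglongrightarrow> real k * 0" by (intro tendsto_intros lim)
  then obtain N where N: "\<And>n. n \<ge> N \<Longrightarrow> real k * (\<integral>x. g n x \<partial>M) < \<epsilon> / 2"
    using LIMSEQ_D [of _ _ "\<epsilon> / 2"] \<epsilon> by fastforce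
  show "\<exists>N. \<forall>n\<ge>N. norm ((\<integral>x. F x * g n x \<partial>M) - 0) < \<epsilon>"
  proof (intro exI allI impI)
    fix n assume "n \<ge> N"
    have Fg: "integrable M (\<lambda>x. F x * g n x)"
    proof (rule Bochner_Integration.integrable_bound [OF F(1)])
      show "AE x in M. norm (F x * g n x) \<le> norm (F x)"
        using g F(2) by (auto simp: abs_mult intro!: mult_left_le)
    qed measurable
    have "(\<integral>x. F x * g n x \<partial>M) \<le> (\<integral>x. (F x - min (F x) (real k)) + real k * g n x \<partial>M)"
    proof (rule integral_mono [OF Fg])
      show "integrable M (\<lambda>x. (F x - min (F x) (real k)) + real k * g n x)" using F mi gi by auto
      fix x
      have "(F x - min (F x) (real k)) * g n x \<le> F x - min (F x) (real k)"
        using g by (intro mult_left_le) auto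
      moreover have "min (F x) (real k) * g n x \<le> real k * g n x"
        using g by (intro mult_right_mono) auto
      ultimately show "F x * g n x \<le> (F x - min (F x) (real k)) + real k * g n x"
        by (simp add: algebra_simps)
    qed
    also have "\<dots> = (\<integral>x. F x - min (F x) (real k) \<partial>M) + real k * (\<integral>x. g n x \<partial>M)"
      using F mi gi by simp
    also have "\<dots> < \<epsilon>" using k N [OF \<open>n \<ge> N\<close>] by simp
    finally have "(\<integral>x. F x * g n x \<partial>M) < \<epsilon>" .
    moreover have "0 \<le> (\<integral>x. F x * g n x \<partial>M)"
      using F g by (intro integral_nonneg_AE) auto
    ultimately show "norm ((\<integral>x. F x * g n x \<partial>M) - 0) < \<epsilon>" by simp
  qed
qed

definition clamp :: "real \<Rightarrow> real \<Rightarrow> real" where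
  "clamp K a = max (- K) (min K a)"

lemma abs_clamp_le: "0 \<le> K \<Longrightarrow> \<bar>clamp K a\<bar> \<le> K" "0 \<le> K \<Longrightarrow> \<bar>clamp K a\<bar> \<le> \<bar>a\<bar>"
  by (auto simp: clamp_def)

text \<open>The clamp changes the increment \<open>b\<close> only if one of the two values exceeds \<open>K\<close>, and then the minimum is 1.\<close>

lemma clamp_increment:
  assumes "0 < K"
  shows "\<bar>b - (clamp K a - clamp K (a - b))\<bar> \<le> \<bar>b\<bar> * min 1 ((2 * \<bar>a\<bar> + \<bar>b\<bar>) / K)"
proof (cases "\<bar>a\<bar> \<le> K \<and> \<bar>a - b\<bar> \<le> K")
  case True
  then have "clamp K a = a" "clamp K (a - b) = a - b" by (auto simp: clamp_def)
  then show ?thesis using assms by simp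
next
  case False
  then have "K \<le> 2 * \<bar>a\<bar> + \<bar>b\<bar>" by auto
  then have "min 1 ((2 * \<bar>a\<bar> + \<bar>b\<bar>) / K) = 1" using assms by (simp add: min_def field_simps)
  moreover have "\<bar>b - (clamp K a - clamp K (a - b))\<bar> \<le> \<bar>b\<bar>"
    using assms by (auto simp: clamp_def)
  ultimately show ?thesis by simp
qed

text \<open>The weight of the averages below; unlike the indicator of a ball it is Lipschitz, so that moving the window
  changes every weight little.\<close>

definition cone :: "real \<Rightarrow> int ^ 'd::finite \<Rightarrow> real" where
  "cone R v = max 0 (R - l1 v)"

abbreviation l1_ball :: "real \<Rightarrow> (int ^ 'd::finite) set" where
  "l1_ball R \<equiv> {v. l1 v \<le> R}"

lemma cone_nonneg: "0 \<le> cone R v" by (simp add: cone_def)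

lemma cone_outside: "v \<notin> l1_ball R \<Longrightarrow> cone R v = 0" by (simp add: cone_def)

lemma cone_lipschitz: "\<bar>cone R (v - z) - cone R v\<bar> \<le> l1 z"
proof -
  have "l1 v \<le> l1 (v - z) + l1 z" using l1_triangle [of "v - z" z] by simp
  moreover have "l1 (v - z) \<le> l1 v + l1 z" using l1_triangle [of v "- z"] by simp
  ultimately show ?thesis by (auto simp: cone_def max_def)
qed

text \<open>Both the number of points of an \<open>l1\<close> ball and the sum of the cone over it are compared with the volume of a
  cube. The radius \<open>2 * d * m\<close> is chosen so that the cone has height at least \<open>d * m\<close> on the cube of half-side \<open>m\<close>.\<close>

lemma card_l1_ball_le_cone_mass:
  obtains \<kappa> where "\<kappa> > 0"
    and "\<And>m. 0 < m \<Longrightarrow> 0 < (\<Sum>v\<in>l1_ball (2 * real CARD('d) * real m). cone (2 * real CARD('d) * real m) (v :: int ^ 'd::finite))"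
    and "\<And>m. 0 < m \<Longrightarrow> real m * real (card (l1_ball (2 * real CARD('d) * real m) :: (int ^ 'd) set))
      \<le> \<kappa> * (\<Sum>v\<in>l1_ball (2 * real CARD('d) * real m). cone (2 * real CARD('d) * real m) (v :: int ^ 'd))"
proof
  let ?d = "real CARD('d)"
  let ?\<kappa> = "(3 * ?d) ^ CARD('d) / ?d"
  have d: "?d \<ge> 1" by (simp add: Suc_leI)
  then show "?\<kappa> > 0" by simp
  fix m :: nat assume m: "0 < m"
  let ?R = "2 * ?d * real m"
  let ?W = "\<Sum>v\<in>l1_ball ?R. cone ?R (v :: int ^ 'd)"
  let ?I = "{v :: int ^ 'd. \<forall>i. v $ i \<in> {- int m..int m}}"
  let ?O = "{v :: int ^ 'd. \<forall>i. v $ i \<in> {- int (2 * CARD('d) * m)..int (2 * CARD('d) * m)}}"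
  have I: "l1 v \<le> ?d * real m" if "v \<in> ?I" for v
  proof -
    have "\<bar>real_of_int (v $ i)\<bar> \<le> real m" for i
    proof -
      have "- int m \<le> v $ i" "v $ i \<le> int m" using that by auto
      then show ?thesis by linarith
    qed
    then have "l1 v \<le> (\<Sum>i\<in>(UNIV :: 'd set). real m)" by (intro sum_mono)
    then show ?thesis by simp
  qed
  have "real (card ?I) = (2 * real m + 1) ^ CARD('d)"
    by (subst card_box) (auto simp: algebra_simps)
  then have "(2 * real m) ^ CARD('d) \<le> real (card ?I)"
    by (simp only:) (intro power_mono, auto)
  then have "(2 * real m) ^ CARD('d) * (?d * real m) \<le> real (card ?I) * (?d * real m)"
    by (rule mult_right_mono) simp
  also have "\<dots> = (\<Sum>v\<in>?I. ?d * real m)" by simp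
  also have "\<dots> \<le> (\<Sum>v\<in>?I. cone ?R v)"
    using I by (intro sum_mono) (force simp: cone_def)
  also have "\<dots> \<le> ?W"
  proof (rule sum_mono2 [OF finite_l1_ball])
    show "?I \<subseteq> l1_ball ?R"
    proof
      fix v assume "v \<in> ?I"
      then have "l1 v \<le> ?d * real m" by (rule I)
      also have "\<dots> \<le> ?R" by simp
      finally show "v \<in> l1_ball ?R" by simp
    qed
  qed (simp add: cone_nonneg)
  finally have W: "(2 * real m) ^ CARD('d) * (?d * real m) \<le> ?W" .
  moreover have pos: "0 < (2 * real m) ^ CARD('d) * (?d * real m)"
    using m d by simp
  ultimately show "0 < ?W" by linarith
  have "card (l1_ball ?R :: (int ^ 'd) set) \<le> card ?O"
  proof (rule card_mono)
    show "finite ?O" by (rule finite_box) simp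
    show "l1_ball ?R \<subseteq> ?O"
    proof safe
      fix v :: "int ^ 'd" and i assume "l1 v \<le> ?R"
      then have "\<bar>real_of_int (v $ i)\<bar> \<le> real (2 * CARD('d) * m)"
        using abs_component_le_l1 [of v i] by simp
      then have "\<bar>v $ i\<bar> \<le> int (2 * CARD('d) * m)" by linarith
      then show "v $ i \<in> {- int (2 * CARD('d) * m)..int (2 * CARD('d) * m)}" by auto
    qed
  qed
  then have "real (card (l1_ball ?R :: (int ^ 'd) set)) \<le> real (card ?O)" by simp
  also have "\<dots> = (2 * ?R + 1) ^ CARD('d)"
    by (subst card_box) (auto simp: algebra_simps)
  also have "\<dots> \<le> (3 * ?d * (2 * real m)) ^ CARD('d)"
  proof (intro power_mono)
    have "1 * 1 \<le> ?d * real m" using d m by (intro mult_mono) auto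
    then show "2 * ?R + 1 \<le> 3 * ?d * (2 * real m)" by (simp add: algebra_simps)
  qed simp
  finally have "real m * real (card (l1_ball ?R :: (int ^ 'd) set)) \<le> real m * (3 * ?d * (2 * real m)) ^ CARD('d)"
    by (intro mult_left_mono) auto
  also have "(3 * ?d * (2 * real m)) ^ CARD('d) = (3 * ?d) ^ CARD('d) * (2 * real m) ^ CARD('d)"
    by (rule power_mult_distrib)
  also have "real m * ((3 * ?d) ^ CARD('d) * (2 * real m) ^ CARD('d)) = ?\<kappa> * ((2 * real m) ^ CARD('d) * (?d * real m))"
  proof -
    have "real m * (a * b) = a / ?d * (b * (?d * real m))" for a b :: real using d by simp
    then show ?thesis .
  qed
  also have "\<dots> \<le> ?\<kappa> * ?W" using W by (intro mult_left_mono) auto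
  finally show "real m * real (card (l1_ball ?R :: (int ^ 'd) set)) \<le> ?\<kappa> * ?W" .
qed

lemma subadditive_le_sum_axes:
  fixes N :: "int ^ 'd::finite \<Rightarrow> real"
  assumes sub: "\<And>x y. N (x + y) \<le> N x + N y" and zero: "N 0 = 0"
  shows "N x \<le> (\<Sum>i\<in>UNIV. N (axis i (x $ i)))"
proof -
  have "N (\<Sum>i\<in>S. axis i (x $ i)) \<le> (\<Sum>i\<in>S. N (axis i (x $ i)))" if "finite S" for S
    using that
  proof (induction S rule: finite_induct)
    case (insert j S)
    then show ?case using sub [of "axis j (x $ j)" "\<Sum>i\<in>S. axis i (x $ i)"] by simp
  qed (simp add: zero)
  moreover have "(\<Sum>i\<in>UNIV. axis i (x $ i)) = x"
    by (simp add: vec_eq_iff axis_def)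
  ultimately show ?thesis by (metis finite)
qed

context random_environment
begin

text \<open>Convergence is needed for each displacement separately only: the edge measure is finite, which allows dominated
  convergence in the sum over displacements.\<close>

lemma integral_edge_mult_vanishing:
  fixes F :: "'d env \<times> (int ^ 'd) \<Rightarrow> real" and g :: "nat \<Rightarrow> 'd env \<times> (int ^ 'd) \<Rightarrow> real"
  assumes F: "integrable edge_measure F" "\<And>x. 0 \<le> F x"
    and gm: "\<And>n z. (\<lambda>\<omega>. g n (\<omega>, z)) \<in> borel_measurable P"
    and g: "\<And>n x. 0 \<le> g n x" "\<And>n x. g n x \<le> 1"
    and lim: "\<And>z. (\<lambda>n. \<integral>\<omega>. g n (\<omega>, z) \<partial>P) \<longlonglongrightarrow> 0"
  shows "(\<lambda>n. \<integral>x. F x * g n x \<partial>edge_measure) \<longlonglongrightarrow> 0"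
proof (rule edge.integral_mult_vanishing [OF F _ g])
  show meas [measurable]: "g n \<in> borel_measurable edge_measure" for n
    by (rule borel_measurable_edge [OF gm])
  let ?u = "\<lambda>n z. \<integral>\<^sup>+\<omega>. ennreal (indicator (open_nbrs \<omega>) z) * ennreal (g n (\<omega>, z)) \<partial>P"
  let ?w = "\<lambda>z. \<integral>\<^sup>+\<omega>. ennreal (indicator (open_nbrs \<omega>) z) \<partial>P"
  have [measurable]: "(\<lambda>\<omega>. g n (\<omega>, z)) \<in> borel_measurable P" for n z by (rule gm)
  have gi: "integrable P (\<lambda>\<omega>. g n (\<omega>, z))" for n z
    using g by (intro integrable_const_bound [of _ 1]) auto
  have gie: "integrable edge_measure (g n)" for n
    using g by (intro edge.integrable_const_bound [of _ 1]) auto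
  have "(\<lambda>n. \<integral>\<^sup>+z. ?u n z \<partial>count_space UNIV) \<longlonglongrightarrow> (\<integral>\<^sup>+z. 0 \<partial>count_space (UNIV :: (int ^ 'd) set))"
  proof (rule nn_integral_dominated_convergence [where w = ?w])
    show "AE z in count_space UNIV. ?u n z \<le> ?w z" for n
    proof (rule AE_I2, rule nn_integral_mono)
      fix z \<omega>
      have "ennreal (g n (\<omega>, z)) \<le> 1" using g(2) by (simp add: ennreal_le_1)
      then show "ennreal (indicator (open_nbrs \<omega>) z) * ennreal (g n (\<omega>, z)) \<le> ennreal (indicator (open_nbrs \<omega>) z)"
        by (auto simp: indicator_def)
    qed
    have "(\<integral>\<^sup>+z. ?w z \<partial>count_space UNIV) = (\<integral>\<^sup>+x. 1 \<partial>edge_measure)"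
      by (subst nn_integral_edge(1)) auto
    then have "(\<integral>\<^sup>+z. ?w z \<partial>count_space UNIV) = emeasure edge_measure (space edge_measure)" by simp
    then show "(\<integral>\<^sup>+z. ?w z \<partial>count_space UNIV) < \<infinity>"
      by (metis edge.emeasure_finite infinity_ennreal_def top.not_eq_extremum)
    show "AE z in count_space UNIV. (\<lambda>n. ?u n z) \<longlonglongrightarrow> 0"
    proof (rule AE_I2)
      fix z :: "int ^ 'd"
      have le: "?u n z \<le> ennreal (\<integral>\<omega>. g n (\<omega>, z) \<partial>P)" for n
      proof -
        have "?u n z \<le> (\<integral>\<^sup>+\<omega>. ennreal (g n (\<omega>, z)) \<partial>P)"
          by (intro nn_integral_mono) (auto simp: indicator_def)
        then show ?thesis using g(1) by (simp add: nn_integral_eq_integral [OF gi])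
      qed
      have lim0: "(\<lambda>n. ennreal (\<integral>\<omega>. g n (\<omega>, z) \<partial>P)) \<longlonglongrightarrow> ennreal 0"
        by (intro tendsto_ennrealI lim)
      show "(\<lambda>n. ?u n z) \<longlonglongrightarrow> 0"
      proof (rule tendsto_sandwich [OF _ _ tendsto_const])
        show "\<forall>\<^sub>F n in sequentially. ?u n z \<le> ennreal (\<integral>\<omega>. g n (\<omega>, z) \<partial>P)"
          using le by simp
        show "(\<lambda>n. ennreal (\<integral>\<omega>. g n (\<omega>, z) \<partial>P)) \<longlonglongrightarrow> 0"
          using lim0 by simp
      qed simp
    qed
  qed auto
  moreover have "(\<integral>\<^sup>+z. ?u n z \<partial>count_space UNIV) = ennreal (\<integral>x. g n x \<partial>edge_measure)" for n
    using g(1) by (simp add: nn_integral_eq_integral [OF gie, symmetric] nn_integral_edge(1))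
  ultimately have "(\<lambda>n. ennreal (\<integral>x. g n x \<partial>edge_measure)) \<longlonglongrightarrow> ennreal 0" by simp
  then show "(\<lambda>n. \<integral>x. g n x \<partial>edge_measure) \<longlonglongrightarrow> 0"
    by (rule tendsto_ennrealD) (simp_all add: g)
qed

lemma cocycle_L1_subadditive:
  assumes Z: "cocycle Z" and int: "\<And>x. integrable P (\<lambda>\<omega>. Z \<omega> x)"
  shows "(\<integral>\<omega>. \<bar>Z \<omega> (x + y)\<bar> \<partial>P) \<le> (\<integral>\<omega>. \<bar>Z \<omega> x\<bar> \<partial>P) + (\<integral>\<omega>. \<bar>Z \<omega> y\<bar> \<partial>P)"
    and "(\<integral>\<omega>. \<bar>Z \<omega> 0\<bar> \<partial>P) = 0"
    and "(\<integral>\<omega>. \<bar>Z \<omega> (- x)\<bar> \<partial>P) = (\<integral>\<omega>. \<bar>Z \<omega> x\<bar> \<partial>P)"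
proof -
  have [measurable]: "(\<lambda>\<omega>. Z \<omega> x) \<in> borel_measurable P" for x using int by auto
  have "(\<integral>\<omega>. \<bar>Z \<omega> (x + y)\<bar> \<partial>P) \<le> (\<integral>\<omega>. \<bar>Z (env_shift y \<omega>) x\<bar> + \<bar>Z \<omega> y\<bar> \<partial>P)"
  proof (rule integral_mono_AE)
    show "AE \<omega> in P. \<bar>Z \<omega> (x + y)\<bar> \<le> \<bar>Z (env_shift y \<omega>) x\<bar> + \<bar>Z \<omega> y\<bar>"
      using cocycle_AE [OF Z, of y]
    proof eventually_elim
      case (elim \<omega>)
      from spec [OF this, of x] show ?case by linarith
    qed
  qed (use int integrable_shift [OF int] in auto)
  also have "\<dots> = (\<integral>\<omega>. \<bar>Z (env_shift y \<omega>) x\<bar> \<partial>P) + (\<integral>\<omega>. \<bar>Z \<omega> y\<bar> \<partial>P)"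
    using int integrable_shift [OF int] by (intro Bochner_Integration.integral_add integrable_abs)
  also have "(\<integral>\<omega>. \<bar>Z (env_shift y \<omega>) x\<bar> \<partial>P) = (\<integral>\<omega>. \<bar>Z \<omega> x\<bar> \<partial>P)"
    by (rule integral_shift [where f = "\<lambda>\<omega>. \<bar>Z \<omega> x\<bar>"]) measurable
  finally show "(\<integral>\<omega>. \<bar>Z \<omega> (x + y)\<bar> \<partial>P) \<le> (\<integral>\<omega>. \<bar>Z \<omega> x\<bar> \<partial>P) + (\<integral>\<omega>. \<bar>Z \<omega> y\<bar> \<partial>P)" .
  show "(\<integral>\<omega>. \<bar>Z \<omega> 0\<bar> \<partial>P) = 0"
    using cocycle_0 [OF Z] by (intro integral_eq_zero_AE) (auto elim: eventually_mono)
  have "(\<integral>\<omega>. \<bar>Z \<omega> (- x)\<bar> \<partial>P) = (\<integral>\<omega>. \<bar>Z (env_shift x \<omega>) (- x)\<bar> \<partial>P)"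
    by (rule integral_shift [where f = "\<lambda>\<omega>. \<bar>Z \<omega> (- x)\<bar>", symmetric]) measurable
  also have "\<dots> = (\<integral>\<omega>. \<bar>Z \<omega> x\<bar> \<partial>P)"
  proof (rule integral_cong_AE)
    show "AE \<omega> in P. \<bar>Z (env_shift x \<omega>) (- x)\<bar> = \<bar>Z \<omega> x\<bar>"
      using cocycle_AE [OF Z, of x] cocycle_0 [OF Z]
    proof eventually_elim
      case (elim \<omega>)
      from spec [OF elim(1), of "- x"] elim(2) show ?case by simp
    qed
    show "(\<lambda>\<omega>. \<bar>Z (env_shift x \<omega>) (- x)\<bar>) \<in> borel_measurable P"
      using integrable_shift [OF int, of x "- x"] by auto
  qed measurable
  finally show "(\<integral>\<omega>. \<bar>Z \<omega> (- x)\<bar> \<partial>P) = (\<integral>\<omega>. \<bar>Z \<omega> x\<bar> \<partial>P)" .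
qed

text \<open>Along an axis a cocycle is a Birkhoff sum of its increments, so the ergodic theorem makes it sublinear in
  \<open>L\<^sup>1\<close>; subadditivity extends this to all directions.\<close>

lemma cocycle_L1_sublinear:
  assumes Z: "cocycle Z" and int: "\<And>x. integrable P (\<lambda>\<omega>. Z \<omega> x)" and mean: "\<And>x. (\<integral>\<omega>. Z \<omega> x \<partial>P) = 0"
    and \<epsilon>: "\<epsilon> > 0"
  obtains C where "C \<ge> 0" and "\<And>x. (\<integral>\<omega>. \<bar>Z \<omega> x\<bar> \<partial>P) \<le> \<epsilon> * l1 x + C"
proof -
  let ?N = "\<lambda>x. \<integral>\<omega>. \<bar>Z \<omega> x\<bar> \<partial>P"
  have [measurable]: "(\<lambda>\<omega>. Z \<omega> x) \<in> borel_measurable P" for x using int by auto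
  have axis_sum: "AE \<omega> in P. Z \<omega> (axis i (int n)) = (\<Sum>k<n. Z (env_shift (axis i (int k)) \<omega>) (axis i 1))" for i n
  proof (induction n)
    case 0
    have ax0: "axis i (0::int) = 0" by (simp add: axis_def vec_eq_iff)
    show ?case using cocycle_0 [OF Z] by (simp add: ax0)
  next
    case (Suc n)
    have ax: "axis i (int (Suc n)) = axis i 1 + axis i (int n)" by (simp add: axis_def vec_eq_iff)
    from Suc cocycle_AE [OF Z, of "axis i (int n)"] show ?case
    proof eventually_elim
      case (elim \<omega>)
      from spec [OF elim(2), of "axis i 1"] elim(1) show ?case unfolding ax by simp
    qed
  qed
  have axis_bound: "\<exists>C\<ge>0. \<forall>n. ?N (axis i (int n)) \<le> \<epsilon> * real n + C" for i
  proof -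
    let ?g = "\<lambda>\<omega>. Z \<omega> (axis i 1)"
    have "L1_mean_converges P (\<lambda>k. env_shift (axis i (int k))) ?g"
      by (rule mean_ergodic [OF int])
    then have lim: "(\<lambda>n. \<integral>\<omega>. \<bar>(\<Sum>k<n. ?g (env_shift (axis i (int k)) \<omega>)) / real n\<bar> \<partial>P) \<longlonglongrightarrow> 0"
      by (simp add: L1_mean_converges_def mean)
    have eq: "(\<integral>\<omega>. \<bar>(\<Sum>k<n. ?g (env_shift (axis i (int k)) \<omega>)) / real n\<bar> \<partial>P) = ?N (axis i (int n)) / real n" for n
    proof -
      have "(\<integral>\<omega>. \<bar>(\<Sum>k<n. ?g (env_shift (axis i (int k)) \<omega>)) / real n\<bar> \<partial>P) = (\<integral>\<omega>. \<bar>Z \<omega> (axis i (int n))\<bar> / real n \<partial>P)"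
      proof (rule integral_cong_AE)
        show "AE \<omega> in P. \<bar>(\<Sum>k<n. ?g (env_shift (axis i (int k)) \<omega>)) / real n\<bar> = \<bar>Z \<omega> (axis i (int n))\<bar> / real n"
          using axis_sum [of i n] by eventually_elim simp
        show "(\<lambda>\<omega>. \<bar>(\<Sum>k<n. ?g (env_shift (axis i (int k)) \<omega>)) / real n\<bar>) \<in> borel_measurable P"
          using integrable_shift [OF int] by (intro borel_measurable_abs borel_measurable_divide borel_measurable_sum) auto
      qed measurable
      then show ?thesis by simp
    qed
    obtain n0 where n0: "\<And>n. n \<ge> n0 \<Longrightarrow> ?N (axis i (int n)) / real n < \<epsilon>"
      using LIMSEQ_D [OF lim \<epsilon>] unfolding eq by force
    have "?N (axis i (int n)) \<le> \<epsilon> * real n + (\<Sum>k\<le>n0. ?N (axis i (int k)))" for n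
    proof (cases "n \<le> n0")
      case True
      then have "?N (axis i (int n)) \<le> (\<Sum>k\<le>n0. ?N (axis i (int k)))"
        by (intro member_le_sum) auto
      moreover have "0 \<le> \<epsilon> * real n" using \<epsilon> by simp
      ultimately show ?thesis by linarith
    next
      case False
      then have "n > 0" by simp
      have "?N (axis i (int n)) / real n < \<epsilon>" using n0 [of n] False by simp
      then have "?N (axis i (int n)) < \<epsilon> * real n" using \<open>n > 0\<close> by (simp add: field_simps)
      moreover have "0 \<le> (\<Sum>k\<le>n0. ?N (axis i (int k)))" by (intro sum_nonneg) simp
      ultimately show ?thesis by linarith
    qed
    moreover have "0 \<le> (\<Sum>k\<le>n0. ?N (axis i (int k)))" by (intro sum_nonneg) simp
    ultimately show ?thesis by blast
  qed
  then have "\<forall>i. \<exists>C\<ge>0. \<forall>n. ?N (axis i (int n)) \<le> \<epsilon> * real n + C" by blast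
  from choice [OF this] obtain C where C: "\<And>i. C i \<ge> 0" "\<And>i n. ?N (axis i (int n)) \<le> \<epsilon> * real n + C i" by blast
  show ?thesis
  proof (rule that [of "\<Sum>i\<in>UNIV. C i"])
    show "0 \<le> (\<Sum>i\<in>UNIV. C i)" by (intro sum_nonneg C)
    fix x
    have coord: "?N (axis i k) \<le> \<epsilon> * \<bar>real_of_int k\<bar> + C i" for i k
    proof (cases "0 \<le> k")
      case True
      then show ?thesis using C(2) [of i "nat k"] by simp
    next
      case False
      have "axis i k = - axis i (int (nat (- k)))" using False by (simp add: axis_def vec_eq_iff)
      then have "?N (axis i k) = ?N (axis i (int (nat (- k))))"
        by (simp only: cocycle_L1_subadditive(3) [OF Z int])
      also have "\<dots> \<le> \<epsilon> * real (nat (- k)) + C i" by (rule C(2))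
      finally show ?thesis using False by simp
    qed
    have "?N x \<le> (\<Sum>i\<in>UNIV. ?N (axis i (x $ i)))"
      by (rule subadditive_le_sum_axes [where N = ?N]) (use cocycle_L1_subadditive [OF Z int] in auto)
    also have "\<dots> \<le> (\<Sum>i\<in>UNIV. \<epsilon> * \<bar>real_of_int (x $ i)\<bar> + C i)"
      by (intro sum_mono coord)
    also have "\<dots> = \<epsilon> * l1 x + (\<Sum>i\<in>UNIV. C i)"
      by (simp add: sum.distrib sum_distrib_left)
    finally show "?N x \<le> \<epsilon> * l1 x + (\<Sum>i\<in>UNIV. C i)" .
  qed
qed

end

context random_environment
begin

text \<open>In a window of radius of order \<open>n\<close> a centred cocycle is of size \<open>o(n)\<close> in \<open>L\<^sup>1\<close>, hence averages of its values divided by \<open>n\<close>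
  tend to 0, for every choice of weights of total mass at most 1.\<close>

lemma weighted_averages_vanish:
  fixes a :: "nat \<Rightarrow> int ^ 'd \<Rightarrow> int ^ 'd \<Rightarrow> real" and S :: "nat \<Rightarrow> int ^ 'd \<Rightarrow> (int ^ 'd) set"
  assumes Z: "cocycle Z" and int: "\<And>x. integrable P (\<lambda>\<omega>. Z \<omega> x)" and mean: "\<And>x. (\<integral>\<omega>. Z \<omega> x \<partial>P) = 0"
    and F: "integrable edge_measure F" "\<And>x. 0 \<le> F x"
    and a: "\<And>n z v. 0 \<le> a n z v" "\<And>n z. (\<Sum>v\<in>S n z. a n z v) \<le> 1"
    and S: "\<And>n z v. v \<in> S n z \<Longrightarrow> l1 v \<le> c * real (Suc n) + l1 z" and c: "0 \<le> c"
  shows "(\<lambda>n. \<integral>x. F x * (\<Sum>v\<in>S n (snd x). a n (snd x) v *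
      min 1 ((2 * \<bar>Z (fst x) v\<bar> + \<bar>Z (fst x) (snd x)\<bar>) / real (Suc n))) \<partial>edge_measure) \<longlonglongrightarrow> 0"
proof (rule integral_edge_mult_vanishing [OF F])
  have [measurable]: "(\<lambda>\<omega>. Z \<omega> x) \<in> borel_measurable P" for x using int by auto
  let ?q = "\<lambda>n \<omega> z v. min 1 ((2 * \<bar>Z \<omega> v\<bar> + \<bar>Z \<omega> z\<bar>) / real (Suc n))"
  show "(\<lambda>\<omega>. \<Sum>v\<in>S n (snd (\<omega>, z)). a n (snd (\<omega>, z)) v *
      min 1 ((2 * \<bar>Z (fst (\<omega>, z)) v\<bar> + \<bar>Z (fst (\<omega>, z)) (snd (\<omega>, z))\<bar>) / real (Suc n))) \<in> borel_measurable P" for n z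
    by simp
  show "0 \<le> (\<Sum>v\<in>S n (snd x). a n (snd x) v * ?q n (fst x) (snd x) v)" for n x
    using a(1) by (intro sum_nonneg mult_nonneg_nonneg) auto
  show "(\<Sum>v\<in>S n (snd x). a n (snd x) v * ?q n (fst x) (snd x) v) \<le> 1" for n x
  proof -
    have "(\<Sum>v\<in>S n (snd x). a n (snd x) v * ?q n (fst x) (snd x) v) \<le> (\<Sum>v\<in>S n (snd x). a n (snd x) v * 1)"
      using a(1) by (intro sum_mono mult_left_mono) auto
    then show ?thesis using a(2) [of n "snd x"] by simp
  qed
  fix z :: "int ^ 'd"
  let ?N = "\<lambda>x. \<integral>\<omega>. \<bar>Z \<omega> x\<bar> \<partial>P"
  let ?G = "\<lambda>n. \<integral>\<omega>. (\<Sum>v\<in>S n z. a n z v * ?q n \<omega> z v) \<partial>P"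
  have qi: "integrable P (\<lambda>\<omega>. ?q n \<omega> z v)" for n v
    by (rule integrable_const_bound [of _ 1]) auto
  have "(\<lambda>n. ?G n) \<longlonglongrightarrow> 0"
  proof (rule LIMSEQ_I)
    fix \<epsilon> :: real assume \<epsilon>: "\<epsilon> > 0"
    define \<delta> where "\<delta> = \<epsilon> / (4 * (c + 1))"
    have \<delta>: "\<delta> > 0" using \<epsilon> c by (simp add: \<delta>_def)
    obtain C where C: "C \<ge> 0" "\<And>x. ?N x \<le> \<delta> * l1 x + C"
      using cocycle_L1_sublinear [OF Z int mean \<delta>] by blast
    define K where "K = 2 * (\<delta> * l1 z + C) + ?N z"
    have bound: "?G n \<le> 2 * \<delta> * c + K / real (Suc n)" for n
    proof -
      have "?G n = (\<Sum>v\<in>S n z. a n z v * (\<integral>\<omega>. ?q n \<omega> z v \<partial>P))"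
        using qi by simp
      also have "\<dots> \<le> (\<Sum>v\<in>S n z. a n z v * (2 * \<delta> * c + K / real (Suc n)))"
      proof (intro sum_mono mult_left_mono a(1))
        fix v assume v: "v \<in> S n z"
        have "(\<integral>\<omega>. ?q n \<omega> z v \<partial>P) \<le> (\<integral>\<omega>. (2 * \<bar>Z \<omega> v\<bar> + \<bar>Z \<omega> z\<bar>) / real (Suc n) \<partial>P)"
          using int by (intro integral_mono qi) auto
        also have "\<dots> = (2 * ?N v + ?N z) / real (Suc n)" using int by simp
        also have "\<dots> \<le> (2 * (\<delta> * (c * real (Suc n) + l1 z) + C) + ?N z) / real (Suc n)"
        proof (intro divide_right_mono add_right_mono mult_left_mono)
          have "\<delta> * l1 v \<le> \<delta> * (c * real (Suc n) + l1 z)"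
            using S [OF v] \<delta> by (intro mult_left_mono) auto
          then show "?N v \<le> \<delta> * (c * real (Suc n) + l1 z) + C" using C(2) [of v] by linarith
        qed auto
        also have "\<dots> = 2 * \<delta> * c + K / real (Suc n)"
          by (simp add: K_def field_simps del: of_nat_Suc)
        finally show "(\<integral>\<omega>. ?q n \<omega> z v \<partial>P) \<le> 2 * \<delta> * c + K / real (Suc n)" .
      qed
      also have "\<dots> = (\<Sum>v\<in>S n z. a n z v) * (2 * \<delta> * c + K / real (Suc n))"
        by (simp add: sum_distrib_right)
      also have "\<dots> \<le> 1 * (2 * \<delta> * c + K / real (Suc n))"
      proof (rule mult_right_mono [OF a(2)])
        have "0 \<le> K" unfolding K_def using C(1) \<delta>
          by (intro add_nonneg_nonneg mult_nonneg_nonneg) (auto simp: l1_nonneg)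
        then show "0 \<le> 2 * \<delta> * c + K / real (Suc n)" using \<delta> c by simp
      qed
      finally show ?thesis by simp
    qed
    have "(\<lambda>n. K / real (Suc n)) \<longlonglongrightarrow> 0" by (rule LIMSEQ_Suc [OF lim_const_over_n])
    then obtain n0 where n0: "\<And>n. n \<ge> n0 \<Longrightarrow> \<bar>K / real (Suc n)\<bar> < \<epsilon> / 2"
      using LIMSEQ_D [of _ 0 "\<epsilon> / 2"] \<epsilon> by fastforce
    have "2 * \<delta> * c \<le> \<epsilon> / 2" using \<epsilon> c by (simp add: \<delta>_def field_simps)
    then have "?G n < \<epsilon>" if "n \<ge> n0" for n using bound [of n] n0 [OF that] by linarith
    moreover have "0 \<le> ?G n" for n
      using a(1) by (intro integral_nonneg_AE AE_I2 sum_nonneg mult_nonneg_nonneg) auto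
    ultimately show "\<exists>n0. \<forall>n\<ge>n0. norm (?G n - 0) < \<epsilon>" by (intro exI [of _ n0]) auto
  qed
  then show "(\<lambda>n. \<integral>\<omega>. (\<Sum>v\<in>S n (snd (\<omega>, z)). a n (snd (\<omega>, z)) v *
      min 1 ((2 * \<bar>Z (fst (\<omega>, z)) v\<bar> + \<bar>Z (fst (\<omega>, z)) (snd (\<omega>, z))\<bar>) / real (Suc n))) \<partial>P) \<longlonglongrightarrow> 0"
    by simp
qed

text \<open>Without the clamp, the shift by \<open>z\<close> would replace \<open>Z \<omega> v\<close> by \<open>Z \<omega> (v + z) - Z \<omega> z\<close> in the average \<open>f\<close>, so
  that its gradient would be \<open>Z \<omega> z\<close> up to the motion of the window. The first error term below is due to the clamp,
  the second to the different weights of a point before and after the shift.\<close>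

lemma gradient_approximation:
  fixes z :: "int ^ 'd" and R K :: real
  assumes coc: "\<And>u. Z (env_shift z \<omega>) u = Z \<omega> (u + z) - Z \<omega> z"
    and K: "0 < K" and W: "0 < W" "W = (\<Sum>v\<in>l1_ball R. cone R (v :: int ^ 'd))"
    and f: "\<And>\<omega>. f \<omega> = - (\<Sum>v\<in>l1_ball R. cone R v * clamp K (Z \<omega> v)) / W"
  defines "q \<equiv> \<lambda>v. min 1 ((2 * \<bar>Z \<omega> v\<bar> + \<bar>Z \<omega> z\<bar>) / K)"
  shows "\<bar>Z \<omega> z - env_gradient f (\<omega>, z)\<bar> \<le> \<bar>Z \<omega> z\<bar> * (\<Sum>v\<in>l1_ball R. cone R v / W * q v)
    + l1 z * (K / W * (\<Sum>v\<in>l1_ball R \<union> (\<lambda>u. u + z) ` l1_ball R. q v))"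
proof -
  let ?B = "l1_ball R :: (int ^ 'd) set" and ?T = "clamp K"
  let ?B' = "?B \<union> (\<lambda>u. u + z) ` ?B"
  have fin: "finite ?B" "finite ?B'" using finite_l1_ball by auto
  have shifted: "(\<Sum>u\<in>?B. cone R u * ?T (Z (env_shift z \<omega>) u)) = (\<Sum>v\<in>?B'. cone R (v - z) * ?T (Z \<omega> v - Z \<omega> z))"
  proof -
    have "(\<Sum>u\<in>?B. cone R u * ?T (Z (env_shift z \<omega>) u)) = (\<Sum>v\<in>(\<lambda>u. u + z) ` ?B. cone R (v - z) * ?T (Z \<omega> v - Z \<omega> z))"
      by (subst sum.reindex) (auto simp: inj_on_def coc)
    also have "\<dots> = (\<Sum>v\<in>?B'. cone R (v - z) * ?T (Z \<omega> v - Z \<omega> z))"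
    proof (rule sum.mono_neutral_left [OF fin(2)])
      show "\<forall>v\<in>?B' - (\<lambda>u. u + z) ` ?B. cone R (v - z) * ?T (Z \<omega> v - Z \<omega> z) = 0"
      proof
        fix v assume v: "v \<in> ?B' - (\<lambda>u. u + z) ` ?B"
        have "v - z \<notin> ?B"
        proof
          assume "v - z \<in> ?B"
          then have "v - z + z \<in> (\<lambda>u. u + z) ` ?B" by (rule imageI)
          then show False using v by simp
        qed
        from cone_outside [OF this] show "cone R (v - z) * ?T (Z \<omega> v - Z \<omega> z) = 0" by simp
      qed
    qed auto
    finally show ?thesis .
  qed
  have unshifted: "(\<Sum>v\<in>?B. cone R v * ?T (Z \<omega> v - Z \<omega> z)) = (\<Sum>v\<in>?B'. cone R v * ?T (Z \<omega> v - Z \<omega> z))"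
    by (rule sum.mono_neutral_left [OF fin(2)]) (auto simp: cone_def)
  have decomp: "W * (Z \<omega> z - env_gradient f (\<omega>, z)) = (\<Sum>v\<in>?B. cone R v * (Z \<omega> z - (?T (Z \<omega> v) - ?T (Z \<omega> v - Z \<omega> z))))
      + (\<Sum>v\<in>?B'. (cone R (v - z) - cone R v) * ?T (Z \<omega> v - Z \<omega> z))"
  proof -
    have "W * env_gradient f (\<omega>, z) = (\<Sum>v\<in>?B. cone R v * ?T (Z \<omega> v)) - (\<Sum>v\<in>?B'. cone R (v - z) * ?T (Z \<omega> v - Z \<omega> z))"
      using W(1) by (simp add: env_gradient_def f shifted field_simps)
    moreover have "W * Z \<omega> z = (\<Sum>v\<in>?B. cone R v * Z \<omega> z)"
      by (simp add: W(2) sum_distrib_right)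
    ultimately show ?thesis
      by (simp add: right_diff_distrib left_diff_distrib sum_subtractf unshifted)
  qed
  have "W * \<bar>Z \<omega> z - env_gradient f (\<omega>, z)\<bar>
    = \<bar>(\<Sum>v\<in>?B. cone R v * (Z \<omega> z - (?T (Z \<omega> v) - ?T (Z \<omega> v - Z \<omega> z))))
      + (\<Sum>v\<in>?B'. (cone R (v - z) - cone R v) * ?T (Z \<omega> v - Z \<omega> z))\<bar>"
    using W(1) by (subst decomp [symmetric]) (simp add: abs_mult)
  also have "\<dots> \<le> (\<Sum>v\<in>?B. \<bar>cone R v * (Z \<omega> z - (?T (Z \<omega> v) - ?T (Z \<omega> v - Z \<omega> z)))\<bar>)
      + (\<Sum>v\<in>?B'. \<bar>(cone R (v - z) - cone R v) * ?T (Z \<omega> v - Z \<omega> z)\<bar>)"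
    by (intro order.trans [OF abs_triangle_ineq] add_mono sum_abs)
  also have "\<dots> \<le> (\<Sum>v\<in>?B. cone R v * (\<bar>Z \<omega> z\<bar> * q v)) + (\<Sum>v\<in>?B'. l1 z * (K * q v))"
  proof (intro add_mono sum_mono)
    fix v
    show "\<bar>cone R v * (Z \<omega> z - (?T (Z \<omega> v) - ?T (Z \<omega> v - Z \<omega> z)))\<bar> \<le> cone R v * (\<bar>Z \<omega> z\<bar> * q v)"
      using clamp_increment [OF K, of "Z \<omega> z" "Z \<omega> v"]
      by (simp add: abs_mult cone_nonneg mult_left_mono q_def)
    have "\<bar>?T (Z \<omega> v - Z \<omega> z)\<bar> \<le> min K (\<bar>Z \<omega> v - Z \<omega> z\<bar>)"
      using abs_clamp_le K by (simp add: less_imp_le)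
    also have "\<dots> \<le> min K (2 * \<bar>Z \<omega> v\<bar> + \<bar>Z \<omega> z\<bar>)" by (rule min.mono) auto
    also have "\<dots> = K * q v" using K by (simp add: q_def min_mult_distrib_left)
    finally show "\<bar>(cone R (v - z) - cone R v) * ?T (Z \<omega> v - Z \<omega> z)\<bar> \<le> l1 z * (K * q v)"
      unfolding abs_mult by (intro mult_mono cone_lipschitz) auto
  qed
  also have "\<dots> = W * (\<bar>Z \<omega> z\<bar> * (\<Sum>v\<in>?B. cone R v / W * q v) + l1 z * (K / W * (\<Sum>v\<in>?B'. q v)))"
    using W(1) by (simp add: sum_distrib_left distrib_left mult_ac)
  finally show ?thesis using W(1) by simp
qed

text \<open>The energy of \<open>Z\<close> is its scalar product with \<open>Z - env_gradient (f n)\<close>, for \<open>Z\<close> is orthogonal to gradients; this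
  product tends to 0. The nearest-neighbour increments then vanish, and with them all others.\<close>

theorem centred_cocycle_eq_0:
  assumes Z: "cocycle Z" and int: "\<And>x. integrable P (\<lambda>\<omega>. Z \<omega> x)" and mean: "\<And>x. (\<integral>\<omega>. Z \<omega> x \<partial>P) = 0"
    and Z2: "integrable edge_measure (\<lambda>x. (Z (fst x) (snd x))\<^sup>2)"
    and div: "AE \<omega> in P. divergence Z \<omega> = 0"
  shows "AE \<omega> in P. \<forall>x. Z \<omega> x = 0"
proof -
  let ?d = "real CARD('d)"
  define R where "R n = 2 * ?d * real (Suc n)" for n
  define W where "W n = (\<Sum>v\<in>l1_ball (R n). cone (R n) (v :: int ^ 'd))" for n
  obtain \<kappa> where \<kappa>: "\<kappa> > 0" and W: "\<And>n. 0 < W n"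
    and vol: "\<And>n. real (Suc n) * real (card (l1_ball (R n) :: (int ^ 'd) set)) \<le> \<kappa> * W n"
  proof (rule card_l1_ball_le_cone_mass [where 'd = 'd])
    fix \<kappa> :: real
    assume "\<kappa> > 0"
      and "\<And>m. 0 < m \<Longrightarrow> 0 < (\<Sum>v\<in>l1_ball (2 * ?d * real m). cone (2 * ?d * real m) (v :: int ^ 'd))"
      and "\<And>m. 0 < m \<Longrightarrow> real m * real (card (l1_ball (2 * ?d * real m) :: (int ^ 'd) set))
        \<le> \<kappa> * (\<Sum>v\<in>l1_ball (2 * ?d * real m). cone (2 * ?d * real m) (v :: int ^ 'd))"
    then show thesis by (intro that [of \<kappa>]) (simp_all only: W_def R_def zero_less_Suc)
  qed
  have [measurable]: "(\<lambda>\<omega>. Z \<omega> x) \<in> borel_measurable P" for x using int by auto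
  have Zm [measurable]: "(\<lambda>x. Z (fst x) (snd x)) \<in> borel_measurable edge_measure"
    by (rule cocycle_measurable_edge [OF Z])
  define f where "f n \<omega> = - (\<Sum>v\<in>l1_ball (R n). cone (R n) v * clamp (real (Suc n)) (Z \<omega> v)) / W n" for n \<omega>
  have f: "f n \<in> bounded_functions" for n
  proof -
    have "f n \<in> borel_measurable P" unfolding f_def clamp_def by measurable
    moreover have "\<bar>f n \<omega>\<bar> \<le> (\<Sum>v\<in>l1_ball (R n). cone (R n) (v :: int ^ 'd) * real (Suc n)) / W n" for \<omega>
    proof -
      have "\<bar>\<Sum>v\<in>l1_ball (R n). cone (R n) v * clamp (real (Suc n)) (Z \<omega> v)\<bar>
        \<le> (\<Sum>v\<in>l1_ball (R n). \<bar>cone (R n) v * clamp (real (Suc n)) (Z \<omega> v)\<bar>)" by (rule sum_abs)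
      also have "\<dots> \<le> (\<Sum>v\<in>l1_ball (R n). cone (R n) (v :: int ^ 'd) * real (Suc n))"
        by (intro sum_mono) (simp add: abs_mult cone_nonneg abs_clamp_le mult_left_mono del: of_nat_Suc)
      finally show ?thesis using W [of n] by (simp add: f_def divide_right_mono del: of_nat_Suc)
    qed
    ultimately show ?thesis unfolding bounded_functions_def by blast
  qed
  define q where "q n x v = min 1 ((2 * \<bar>Z (fst x) v\<bar> + \<bar>Z (fst x) (snd x)\<bar>) / real (Suc n))"
    for n and x :: "'d env \<times> (int ^ 'd)" and v
  \<comment> \<open>two averages of total weight at most 1, for the two error terms of the approximation\<close>
  define g where "g n x = (\<Sum>v\<in>l1_ball (R n). cone (R n) v / W n * q n x v)" for n x
  let ?S = "\<lambda>n z. l1_ball (R n) \<union> (\<lambda>u. u + z) ` l1_ball (R n)"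
  define h where "h n x = (\<Sum>v\<in>?S n (snd x). real (Suc n) / (2 * \<kappa> * W n) * q n x v)" for n x
  have grad: "AE x in edge_measure. \<bar>Z (fst x) (snd x) - env_gradient (f n) x\<bar>
    \<le> \<bar>Z (fst x) (snd x)\<bar> * g n x + 2 * \<kappa> * l1 (snd x) * h n x" for n
  proof (rule AE_edge)
    fix z :: "int ^ 'd"
    show "AE \<omega> in P. cond \<omega> 0 z = 1 \<longrightarrow> \<bar>Z (fst (\<omega>, z)) (snd (\<omega>, z)) - env_gradient (f n) (\<omega>, z)\<bar>
      \<le> \<bar>Z (fst (\<omega>, z)) (snd (\<omega>, z))\<bar> * g n (\<omega>, z) + 2 * \<kappa> * l1 (snd (\<omega>, z)) * h n (\<omega>, z)"
      using cocycle_AE [OF Z, of z]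
    proof eventually_elim
      case (elim \<omega>)
      have "\<bar>Z \<omega> z - env_gradient (f n) (\<omega>, z)\<bar> \<le> \<bar>Z \<omega> z\<bar> * (\<Sum>v\<in>l1_ball (R n). cone (R n) v / W n * q n (\<omega>, z) v)
        + l1 z * (real (Suc n) / W n * (\<Sum>v\<in>?S n z. q n (\<omega>, z) v))"
        unfolding q_def fst_conv snd_conv
        by (rule gradient_approximation) (use elim W in \<open>auto simp: W_def f_def\<close>)
      also have "l1 z * (real (Suc n) / W n * (\<Sum>v\<in>?S n z. q n (\<omega>, z) v)) = 2 * \<kappa> * l1 z * h n (\<omega>, z)"
        unfolding h_def snd_conv sum_distrib_left [symmetric] using \<kappa> W [of n] by (simp del: of_nat_Suc)
      finally show ?case by (simp add: g_def)
    qed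
  qed
  have card_S: "real (card (?S n z)) \<le> 2 * real (card (l1_ball (R n) :: (int ^ 'd) set))" for n and z :: "int ^ 'd"
  proof -
    have "card (?S n z) \<le> card (l1_ball (R n) :: (int ^ 'd) set) + card ((\<lambda>u. u + z) ` l1_ball (R n))"
      by (rule card_Un_le)
    also have "card ((\<lambda>u. u + z) ` l1_ball (R n)) \<le> card (l1_ball (R n) :: (int ^ 'd) set)"
      by (rule card_image_le [OF finite_l1_ball])
    finally show ?thesis by simp
  qed
  have h_mass: "(\<Sum>v\<in>?S n z. real (Suc n) / (2 * \<kappa> * W n)) \<le> 1" for n and z :: "int ^ 'd"
  proof -
    have "real (card (?S n z)) * real (Suc n) \<le> 2 * real (card (l1_ball (R n) :: (int ^ 'd) set)) * real (Suc n)"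
      by (intro mult_right_mono card_S) simp
    also have "\<dots> \<le> 2 * (\<kappa> * W n)" using vol [of n] by (simp add: mult_ac del: of_nat_Suc)
    finally show ?thesis using W [of n] \<kappa> by (simp add: field_simps del: of_nat_Suc)
  qed
  have q01: "0 \<le> q n x v" "q n x v \<le> 1" for n x v by (auto simp: q_def)
  have lim_g: "(\<lambda>n. \<integral>x. (Z (fst x) (snd x))\<^sup>2 * g n x \<partial>edge_measure) \<longlonglongrightarrow> 0"
    unfolding g_def q_def
  proof (rule weighted_averages_vanish [OF Z int mean Z2, where a = "\<lambda>n z v. cone (R n) v / W n"
        and S = "\<lambda>n z. l1_ball (R n)" and c = "2 * ?d"])
    show "0 \<le> cone (R n) v / W n" for n v using W [of n] by (simp add: cone_nonneg)
    show "(\<Sum>v\<in>l1_ball (R n). cone (R n) (v :: int ^ 'd) / W n) \<le> 1" for n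
      using W [of n] by (simp add: sum_divide_distrib [symmetric] W_def [symmetric])
    show "l1 v \<le> 2 * ?d * real (Suc n) + l1 z" if "v \<in> l1_ball (R n)" for n v and z :: "int ^ 'd"
      using that l1_nonneg [of z] unfolding R_def by (simp only: mem_Collect_eq)
  qed auto
  have l1Z: "integrable edge_measure (\<lambda>x. l1 (snd x) * \<bar>Z (fst x) (snd x)\<bar>)"
    by (rule integrable_mult_of_squares) (auto simp: integrable_l1_sq Z2 intro!: borel_measurable_edge)
  have lim_h: "(\<lambda>n. \<integral>x. (2 * \<kappa> * (l1 (snd x) * \<bar>Z (fst x) (snd x)\<bar>)) * h n x \<partial>edge_measure) \<longlonglongrightarrow> 0"
    unfolding h_def q_def
  proof (rule weighted_averages_vanish [OF Z int mean, where a = "\<lambda>n z v. real (Suc n) / (2 * \<kappa> * W n)"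
        and S = ?S and c = "2 * ?d"])
    show "integrable edge_measure (\<lambda>x. 2 * \<kappa> * (l1 (snd x) * \<bar>Z (fst x) (snd x)\<bar>))"
      using l1Z by simp
    show "0 \<le> 2 * \<kappa> * (l1 (snd x) * \<bar>Z (fst x) (snd x)\<bar>)" for x :: "'d env \<times> (int ^ 'd)"
      using \<kappa> by (intro mult_nonneg_nonneg) auto
    show "0 \<le> real (Suc n) / (2 * \<kappa> * W n)" for n using W [of n] \<kappa> by simp
    show "(\<Sum>v\<in>?S n z. real (Suc n) / (2 * \<kappa> * W n)) \<le> 1" for n and z :: "int ^ 'd"
      by (rule h_mass)
    show "l1 v \<le> 2 * ?d * real (Suc n) + l1 z" if "v \<in> ?S n z" for n v and z :: "int ^ 'd"
    proof -
      have "l1 v \<le> R n + l1 z"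
        using that
      proof
        assume "v \<in> l1_ball (R n)"
        then show ?thesis using l1_nonneg [of z] by (simp only: mem_Collect_eq)
      next
        assume "v \<in> (\<lambda>u. u + z) ` l1_ball (R n)"
        then obtain u where "v = u + z" "l1 u \<le> R n" by blast
        then show ?thesis using l1_triangle [of u z] by (simp only:)
      qed
      then show ?thesis by (simp only: R_def)
    qed
  qed simp
  have gm: "g n \<in> borel_measurable edge_measure" for n
    unfolding g_def q_def by (rule borel_measurable_edge) simp
  have hm: "h n \<in> borel_measurable edge_measure" for n
    unfolding h_def q_def by (rule borel_measurable_edge) simp
  have energy: "(\<integral>x. (Z (fst x) (snd x))\<^sup>2 \<partial>edge_measure) \<le> (\<integral>x. (Z (fst x) (snd x))\<^sup>2 * g n x \<partial>edge_measure)
    + (\<integral>x. (2 * \<kappa> * (l1 (snd x) * \<bar>Z (fst x) (snd x)\<bar>)) * h n x \<partial>edge_measure)" for n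
  proof -
    have [measurable]: "f n \<in> borel_measurable P" using f by measurable
    note gm [measurable] hm [measurable]
    have g1: "0 \<le> g n x" "g n x \<le> 1" for x
    proof -
      show "0 \<le> g n x" unfolding g_def using W [of n] q01
        by (intro sum_nonneg mult_nonneg_nonneg) (auto simp: cone_nonneg)
      have "g n x \<le> (\<Sum>v\<in>l1_ball (R n). cone (R n) (v :: int ^ 'd) / W n)"
        unfolding g_def using W [of n] q01 by (intro sum_mono mult_left_le) (auto simp: cone_nonneg)
      also have "\<dots> = 1" using W [of n] by (simp add: sum_divide_distrib [symmetric] W_def [symmetric])
      finally show "g n x \<le> 1" .
    qed
    have h0: "0 \<le> h n x" for x
      unfolding h_def using W [of n] q01 \<kappa> by (intro sum_nonneg mult_nonneg_nonneg) auto
    have h1: "h n x \<le> 1" for x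
    proof -
      have "h n x \<le> (\<Sum>v\<in>?S n (snd x). real (Suc n) / (2 * \<kappa> * W n))"
        unfolding h_def using W [of n] q01 \<kappa> by (intro sum_mono mult_left_le) auto
      also have "\<dots> \<le> 1" by (rule h_mass)
      finally show ?thesis .
    qed
    have i_grad: "integrable edge_measure (\<lambda>x. Z (fst x) (snd x) * env_gradient (f n) x)"
      by (rule integrable_mult_of_squares [OF Zm _ Z2 integrable_env_gradient_sq [OF f]]) measurable
    have i_g: "integrable edge_measure (\<lambda>x. (Z (fst x) (snd x))\<^sup>2 * g n x)"
      by (rule Bochner_Integration.integrable_bound [OF Z2]) (use g1 in \<open>auto simp: abs_mult intro!: mult_left_le\<close>)
    have i_h: "integrable edge_measure (\<lambda>x. (2 * \<kappa> * (l1 (snd x) * \<bar>Z (fst x) (snd x)\<bar>)) * h n x)"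
    proof (rule Bochner_Integration.integrable_bound)
      show "integrable edge_measure (\<lambda>x. 2 * \<kappa> * (l1 (snd x) * \<bar>Z (fst x) (snd x)\<bar>))" using l1Z by simp
      then show "(\<lambda>x. (2 * \<kappa> * (l1 (snd x) * \<bar>Z (fst x) (snd x)\<bar>)) * h n x) \<in> borel_measurable edge_measure"
        by (intro borel_measurable_times) auto
      show "AE x in edge_measure. norm (2 * \<kappa> * (l1 (snd x) * \<bar>Z (fst x) (snd x)\<bar>) * h n x)
          \<le> norm (2 * \<kappa> * (l1 (snd x) * \<bar>Z (fst x) (snd x)\<bar>))"
      proof (rule AE_I2)
        fix x
        have "norm (a * b) \<le> norm a" if "0 \<le> b" "b \<le> 1" for a b :: real
          using that by (simp add: abs_mult mult_left_le)
        from this [OF h0 h1]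
        show "norm (2 * \<kappa> * (l1 (snd x) * \<bar>Z (fst x) (snd x)\<bar>) * h n x)
          \<le> norm (2 * \<kappa> * (l1 (snd x) * \<bar>Z (fst x) (snd x)\<bar>))" .
      qed
    qed
    have "(\<integral>x. (Z (fst x) (snd x))\<^sup>2 \<partial>edge_measure)
      = (\<integral>x. (Z (fst x) (snd x))\<^sup>2 \<partial>edge_measure) - (\<integral>x. Z (fst x) (snd x) * env_gradient (f n) x \<partial>edge_measure)"
      by (simp add: orthogonal_if_divergence_eq_0 [OF Z Z2 div f])
    also have "\<dots> = (\<integral>x. (Z (fst x) (snd x))\<^sup>2 - Z (fst x) (snd x) * env_gradient (f n) x \<partial>edge_measure)"
      by (rule Bochner_Integration.integral_diff [OF Z2 i_grad, symmetric])
    also have "\<dots> \<le> (\<integral>x. (Z (fst x) (snd x))\<^sup>2 * g n x + (2 * \<kappa> * (l1 (snd x) * \<bar>Z (fst x) (snd x)\<bar>)) * h n x \<partial>edge_measure)"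
    proof (rule integral_mono_AE)
      show "AE x in edge_measure. (Z (fst x) (snd x))\<^sup>2 - Z (fst x) (snd x) * env_gradient (f n) x
        \<le> (Z (fst x) (snd x))\<^sup>2 * g n x + (2 * \<kappa> * (l1 (snd x) * \<bar>Z (fst x) (snd x)\<bar>)) * h n x"
        using grad [of n]
      proof eventually_elim
        case (elim x)
        let ?z = "Z (fst x) (snd x)"
        have sq: "\<bar>?z\<bar> * \<bar>?z\<bar> = ?z\<^sup>2" by (simp add: power2_eq_square)
        have "?z\<^sup>2 - ?z * env_gradient (f n) x = ?z * (?z - env_gradient (f n) x)"
          by (simp add: power2_eq_square right_diff_distrib)
        also have "\<dots> \<le> \<bar>?z\<bar> * \<bar>?z - env_gradient (f n) x\<bar>"
          unfolding abs_mult [symmetric] by (rule abs_ge_self)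
        also have "\<dots> \<le> \<bar>?z\<bar> * (\<bar>?z\<bar> * g n x + 2 * \<kappa> * l1 (snd x) * h n x)"
          by (intro mult_left_mono elim) simp
        also have "\<dots> = (\<bar>?z\<bar> * \<bar>?z\<bar>) * g n x + (2 * \<kappa> * (l1 (snd x) * \<bar>?z\<bar>)) * h n x"
          by (simp only: distrib_left mult_ac)
        also have "\<dots> = ?z\<^sup>2 * g n x + (2 * \<kappa> * (l1 (snd x) * \<bar>?z\<bar>)) * h n x"
          by (simp only: sq)
        finally show ?case .
      qed
    qed (use Z2 i_grad i_g i_h in auto)
    also have "\<dots> = (\<integral>x. (Z (fst x) (snd x))\<^sup>2 * g n x \<partial>edge_measure)
      + (\<integral>x. (2 * \<kappa> * (l1 (snd x) * \<bar>Z (fst x) (snd x)\<bar>)) * h n x \<partial>edge_measure)"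
      by (rule Bochner_Integration.integral_add [OF i_g i_h])
    finally show ?thesis .
  qed
  have "(\<integral>x. (Z (fst x) (snd x))\<^sup>2 \<partial>edge_measure) \<le> 0 + 0"
    by (rule LIMSEQ_le_const [OF tendsto_add [OF lim_g lim_h]]) (use energy in blast)
  then have le0: "(\<integral>x. (Z (fst x) (snd x))\<^sup>2 \<partial>edge_measure) \<le> 0" by simp
  have unit: "(\<integral>\<omega>. \<bar>Z \<omega> e\<bar> \<partial>P) \<le> 0" if e: "l1 e = 1" for e
  proof -
    have m: "(\<lambda>\<omega>. (Z (fst (\<omega>, e)) (snd (\<omega>, e)))\<^sup>2) \<in> borel_measurable P" by simp
    note sec = integrable_section_of_nearest_neighbour [where f = "\<lambda>x. (Z (fst x) (snd x))\<^sup>2",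
        OF Z2 zero_le_power2 e m]
    have i2: "integrable P (\<lambda>\<omega>. (Z \<omega> e)\<^sup>2)" using sec(1) by simp
    have "(\<integral>\<omega>. (Z \<omega> e)\<^sup>2 \<partial>P) \<le> 0" using sec(2) le0 by simp
    then have "(\<integral>\<omega>. (Z \<omega> e)\<^sup>2 \<partial>P) = 0" by (simp add: order.antisym)
    then have "AE \<omega> in P. (Z \<omega> e)\<^sup>2 = 0"
      using i2 by (subst (asm) integral_nonneg_eq_0_iff_AE) auto
    then have "(\<integral>\<omega>. \<bar>Z \<omega> e\<bar> \<partial>P) = 0" by (intro integral_eq_zero_AE) (auto elim: eventually_mono)
    then show ?thesis by simp
  qed
  have "(\<integral>\<omega>. \<bar>Z \<omega> x\<bar> \<partial>P) \<le> 0 * l1 x" for x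
    by (rule subadditive_le_l1 [where N = "\<lambda>x. \<integral>\<omega>. \<bar>Z \<omega> x\<bar> \<partial>P"])
      (use cocycle_L1_subadditive [OF Z int] unit in auto)
  then have zero: "(\<integral>\<omega>. \<bar>Z \<omega> x\<bar> \<partial>P) = 0" for x by (simp add: order.antisym)
  show ?thesis
    unfolding AE_all_countable
  proof
    fix x
    have "AE \<omega> in P. \<bar>Z \<omega> x\<bar> = 0"
      using zero [of x] int by (subst (asm) integral_nonneg_eq_0_iff_AE) auto
    then show "AE \<omega> in P. Z \<omega> x = 0" by simp
  qed
qed

theorem corrector_unique:
  assumes X: "is_corrector P X" and Y: "is_corrector P Y"
  shows "AE \<omega> in P. \<forall>x. X \<omega> x = Y \<omega> x"
proof -
  have XP: "corrector_properties P X" and YP: "corrector_properties P Y"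
    using X Y by (auto simp: is_corrector_def)
  have coord: "AE \<omega> in P. \<forall>x. X \<omega> x $ i - Y \<omega> x $ i = 0" for i
  proof (rule centred_cocycle_eq_0)
    note Xc = corrector_coordinate [OF XP, of i] and Yc = corrector_coordinate [OF YP, of i]
    show "cocycle (\<lambda>\<omega> x. X \<omega> x $ i - Y \<omega> x $ i)"
      unfolding cocycle_def
    proof (intro conjI allI)
      show "(\<lambda>\<omega>. X \<omega> x $ i - Y \<omega> x $ i) \<in> borel_measurable P" for x
        using Xc(1) Yc(1) by (intro borel_measurable_diff) (simp_all add: cocycle_def)
    next
      fix z
      show "AE \<omega> in P. \<forall>x. X \<omega> (x + z) $ i - Y \<omega> (x + z) $ i - (X \<omega> z $ i - Y \<omega> z $ i)
          = X (env_shift z \<omega>) x $ i - Y (env_shift z \<omega>) x $ i"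
        using cocycle_AE [OF Xc(1), of z] cocycle_AE [OF Yc(1), of z]
      proof eventually_elim
        case (elim \<omega>)
        show ?case
        proof
          fix x
          show "X \<omega> (x + z) $ i - Y \<omega> (x + z) $ i - (X \<omega> z $ i - Y \<omega> z $ i)
            = X (env_shift z \<omega>) x $ i - Y (env_shift z \<omega>) x $ i"
            using spec [OF elim(1), of x] spec [OF elim(2), of x] by linarith
        qed
      qed
    qed
    have lin: "integrable P (\<lambda>\<omega>. V \<omega> x $ i) \<and> (\<integral>\<omega>. V \<omega> x $ i \<partial>P) = 0" if "is_corrector P V" for V x
    proof -
      have "integrable P (\<lambda>\<omega>. V \<omega> x)" "(\<integral>\<omega>. V \<omega> x \<partial>P) = 0" using that by (auto simp: is_corrector_def)
      then show ?thesis
        using integrable_bounded_linear [OF bounded_linear_vec_nth, of P "\<lambda>\<omega>. V \<omega> x" i]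
          integral_bounded_linear [OF bounded_linear_vec_nth, of P "\<lambda>\<omega>. V \<omega> x" i] by simp
    qed
    show "integrable P (\<lambda>\<omega>. X \<omega> x $ i - Y \<omega> x $ i)" for x using lin X Y by simp
    show "(\<integral>\<omega>. X \<omega> x $ i - Y \<omega> x $ i \<partial>P) = 0" for x using lin [OF X] lin [OF Y] by simp
    have "integrable edge_measure (\<lambda>x. (X (fst x) (snd x) $ i + - Y (fst x) (snd x) $ i)\<^sup>2)"
      using Xc(2) Yc(2) cocycle_measurable_edge [OF Xc(1)] cocycle_measurable_edge [OF Yc(1)]
      by (intro integrable_add_squares) auto
    then show "integrable edge_measure (\<lambda>x. (X (fst x) (snd x) $ i - Y (fst x) (snd x) $ i)\<^sup>2)" by simp
    show "AE \<omega> in P. divergence (\<lambda>\<omega> x. X \<omega> x $ i - Y \<omega> x $ i) \<omega> = 0"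
      using Xc(3) Yc(3)
      by eventually_elim (simp add: divergence_def sum_subtractf sum.distrib)
  qed
  have "AE \<omega> in P. \<forall>i\<in>UNIV. \<forall>x. X \<omega> x $ i - Y \<omega> x $ i = 0"
    using coord by (subst AE_finite_all) auto
  then show ?thesis by eventually_elim (simp add: vec_eq_iff)
qed

theorem corrector_well_defined: "corrector_well_defined P"
  unfolding corrector_well_defined_def using corrector_exists corrector_unique by blast

end

section \<open>Long edges rule out sublinearity\<close>

text \<open>Two cubes of side \<open>m\<close> whose coordinates in direction \<open>j\<close> differ by between \<open>3 * m\<close> and \<open>5 * m\<close>. Edges from the near to
  the far box therefore all point in the same direction, and several of them at one vertex reinforce each other.\<close>

definition near_box :: "nat \<Rightarrow> (int ^ 'd::finite) set" where
  "near_box m = {x. \<forall>i. x $ i \<in> {0..int m}}"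

definition far_box :: "'d \<Rightarrow> nat \<Rightarrow> (int ^ 'd::finite) set" where
  "far_box j m = (\<lambda>x. x + axis j (4 * int m)) ` near_box m"

lemma finite_near_box: "finite (near_box m)"
  unfolding near_box_def by (rule finite_box) simp

lemma finite_far_box: "finite (far_box j m)"
  unfolding far_box_def using finite_near_box by blast

lemma card_near_box: "card (near_box m :: (int ^ 'd::finite) set) = (m + 1) ^ CARD('d)"
  unfolding near_box_def by (subst card_box) (auto simp: nat_add_distrib)

lemma card_far_box: "card (far_box j m :: (int ^ 'd::finite) set) = (m + 1) ^ CARD('d)"
  unfolding far_box_def by (subst card_image) (auto simp: inj_on_def card_near_box)

lemma far_box_coordinate: "y \<in> far_box j m \<Longrightarrow> 4 * int m \<le> y $ j"
  by (auto simp: far_box_def near_box_def axis_def)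

lemma near_box_coordinate: "x \<in> near_box m \<Longrightarrow> 0 \<le> x $ j \<and> x $ j \<le> int m"
  by (auto simp: near_box_def)

lemma l1_axis: "l1 (axis j k) = \<bar>real_of_int k\<bar>"
  by (simp add: axis_def if_distrib [of real_of_int] if_distrib [of abs] cong: if_cong)

lemma l1_near_box: "x \<in> near_box m \<Longrightarrow> l1 (x :: int ^ 'd::finite) \<le> real CARD('d) * real m"
proof -
  assume "x \<in> near_box m"
  then have "\<bar>real_of_int (x $ i)\<bar> \<le> real m" for i
    using near_box_coordinate [of x m i] by linarith
  then have "l1 x \<le> (\<Sum>i\<in>(UNIV :: 'd set). real m)" by (intro sum_mono)
  then show ?thesis by simp
qed

lemma l1_far_box:
  assumes "y \<in> far_box j m"
  shows "l1 (y :: int ^ 'd::finite) \<le> (real CARD('d) + 4) * real m"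
proof -
  obtain x where x: "x \<in> near_box m" "y = x + axis j (4 * int m)" using assms by (auto simp: far_box_def)
  have "l1 y \<le> l1 x + l1 (axis j (4 * int m) :: int ^ 'd)" unfolding x(2) by (rule l1_triangle)
  also have "l1 (axis j (4 * int m) :: int ^ 'd) = 4 * real m" by (simp only: l1_axis)
  finally show ?thesis using l1_near_box [OF x(1)] by (simp add: algebra_simps)
qed

lemma l1_near_far:
  assumes "x \<in> near_box m" "y \<in> far_box j m"
  shows "l1 (y - x :: int ^ 'd::finite) \<le> (real CARD('d) + 4) * real m"
proof -
  obtain u where u: "u \<in> near_box m" "y = u + axis j (4 * int m)" using assms by (auto simp: far_box_def)
  have "\<bar>real_of_int ((u - x) $ i)\<bar> \<le> real m" for i
    using near_box_coordinate [OF u(1), of i] near_box_coordinate [OF assms(1), of i]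
    unfolding vector_minus_component by linarith
  then have "l1 (u - x) \<le> (\<Sum>i\<in>(UNIV :: 'd set). real m)" by (intro sum_mono)
  then have "l1 (u - x) \<le> real CARD('d) * real m" by simp
  moreover have "l1 (y - x) \<le> l1 (u - x) + l1 (axis j (4 * int m) :: int ^ 'd)"
  proof -
    have "y - x = (u - x) + axis j (4 * int m)" by (simp add: u(2))
    then show ?thesis by (simp only: l1_triangle)
  qed
  moreover have "l1 (axis j (4 * int m) :: int ^ 'd) = 4 * real m" by (simp only: l1_axis)
  ultimately show ?thesis unfolding distrib_right by linarith
qed

lemma lnorm_near_far_ge:
  assumes "x \<in> near_box m" "y \<in> far_box j m"
  shows "3 * real m \<le> lnorm (y - x)"
proof -
  have "3 * real m \<le> \<bar>real_of_int ((y - x) $ j)\<bar>"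
    using far_box_coordinate [OF assms(2)] near_box_coordinate [OF assms(1), of j]
    unfolding vector_minus_component by linarith
  also have "\<dots> \<le> lnorm (y - x)" by (rule abs_component_le_lnorm)
  finally show ?thesis .
qed

definition isolated_long_edge :: "'d::finite \<Rightarrow> real \<Rightarrow> nat \<Rightarrow> 'd env \<Rightarrow> int ^ 'd \<Rightarrow> int ^ 'd \<Rightarrow> bool" where
  "isolated_long_edge j r m \<omega> x y \<longleftrightarrow> cond \<omega> x y = 1 \<and>
     (\<forall>u. cond \<omega> x u = 1 \<longrightarrow> u \<in> far_box j m \<or> l1 (u - x) \<le> r)"

text \<open>If \<open>x\<close> has a long edge and otherwise only short ones, harmonicity at \<open>x\<close> excludes a sublinear perturbation of
  the identity: the long edges produce a drift of order \<open>m\<close> in direction \<open>j\<close>, which boundedly many short edges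
  cannot compensate.\<close>

lemma no_isolated_long_edge_if_sublinear:
  fixes X :: "int ^ 'd::finite \<Rightarrow> real ^ 'd"
  assumes c01: "\<And>x y. cond \<omega> x y = 0 \<or> cond \<omega> x y = 1"
    and fin: "\<And>x. finite {y. cond \<omega> x y = 1}"
    and harm: "\<And>x. harmonic_at \<omega> (\<lambda>y. emb y + X y) x"
    and sub: "sublinear_everywhere X" and r: "0 \<le> r"
  shows "\<forall>\<^sub>F m in sequentially. \<not> (\<exists>x\<in>near_box m. \<exists>y\<in>far_box j m. isolated_long_edge j r m \<omega> x y)"
proof -
  let ?D = "CARD('d) + 5"
  define b where "b = real (card (l1_ball r :: (int ^ 'd) set))"
  define Mx where "Mx n = Max ((\<lambda>x. norm (X x)) ` {x. lnorm x \<le> real n})" for n :: nat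
  have b: "0 \<le> b" by (simp add: b_def)
  have "(\<lambda>n. (1 / real n) * Mx n) \<longlonglongrightarrow> 0"
    using sub by (simp add: sublinear_everywhere_def Mx_def)
  moreover have "filterlim (\<lambda>m. ?D * m) sequentially sequentially"
    by (rule filterlim_subseq) (simp add: strict_mono_def)
  ultimately have lim: "(\<lambda>m. (1 / real (?D * m)) * Mx (?D * m)) \<longlonglongrightarrow> 0"
    by (rule filterlim_compose)
  define \<epsilon> where "\<epsilon> = 1 / (2 * (b + 1) * real ?D)"
  have "\<epsilon> > 0" using b by (simp add: \<epsilon>_def)
  from tendstoD [OF lim this]
  have "\<forall>\<^sub>F m in sequentially. \<bar>(1 / real (?D * m)) * Mx (?D * m)\<bar> < \<epsilon>" by simp
  moreover have "\<forall>\<^sub>F m in sequentially. b * r + r + 1 \<le> real m"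
    using eventually_ge_at_top [of "nat \<lceil>b * r + r + 1\<rceil>"] by eventually_elim linarith
  ultimately show ?thesis
  proof eventually_elim
    case (elim m)
    have br: "0 \<le> b * r" using b r by simp
    have m: "0 < m" "r \<le> real m" "b * r < real m" using elim(2) br r by (auto intro: gr0I)
    let ?M = "Mx (?D * m)"
    have M: "norm (X x) \<le> ?M" if "l1 x \<le> real (?D * m)" for x
      unfolding Mx_def
    proof (rule Max_ge)
      show "finite ((\<lambda>x. norm (X x)) ` {x. lnorm x \<le> real (?D * m)})"
        by (intro finite_imageI finite_lnorm_ball)
      show "norm (X x) \<in> (\<lambda>x. norm (X x)) ` {x. lnorm x \<le> real (?D * m)}"
        using that lnorm_le_l1 [of x] by auto
    qed
    have "(1 / real (?D * m)) * ?M < \<epsilon>" using elim(1) by linarith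
    then have "?M < \<epsilon> * real (?D * m)"
    proof -
      have "?M < \<epsilon> * a" if "0 < a" "(1 / a) * ?M < \<epsilon>" for a using that by (simp add: field_simps)
      moreover have "0 < real (?D * m)" using m by simp
      ultimately show ?thesis using \<open>(1 / real (?D * m)) * ?M < \<epsilon>\<close> by blast
    qed
    \<comment> \<open>so small that the \<open>b\<close> short edges and the long edge together lose less than \<open>m\<close>\<close>
    also have "\<dots> = real m / (2 * (b + 1))"
    proof -
      have "1 / (2 * (b + 1) * a) * (a * t) = t / (2 * (b + 1))" if "0 < a" for a t :: real
        using that b by simp
      then show ?thesis unfolding \<epsilon>_def of_nat_mult by simp
    qed
    finally have Mm: "2 * ?M * (b + 1) < real m" using b by (simp add: field_simps)
    have M0: "0 \<le> ?M" by (rule order.trans [OF norm_ge_zero M [of 0]]) simp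
    show ?case
    proof
      assume "\<exists>x\<in>near_box m. \<exists>y\<in>far_box j m. isolated_long_edge j r m \<omega> x y"
      then obtain x y where x: "x \<in> near_box m" and y: "y \<in> far_box j m" and xy: "cond \<omega> x y = 1"
        and iso: "\<And>u. cond \<omega> x u = 1 \<Longrightarrow> u \<in> far_box j m \<or> l1 (u - x) \<le> r"
        by (auto simp: isolated_long_edge_def)
      let ?N = "{u. cond \<omega> x u = 1}"
      let ?t = "\<lambda>u. real_of_int (u $ j) - real_of_int (x $ j) + X u $ j - X x $ j"
      have "(\<Sum>u\<in>?N. (emb u + X u) - (emb x + X x)) = 0"
        using harm [of x] xy by (subst (asm) harmonic_at_iff) (use c01 fin in auto)
      then have "(\<Sum>u\<in>?N. (emb u + X u) - (emb x + X x)) $ j = 0" by simp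
      then have sum0: "(\<Sum>u\<in>?N. ?t u) = 0" by (simp add: algebra_simps)
      have Mcomp: "\<bar>X u $ j\<bar> \<le> ?M" if "l1 u \<le> real (?D * m)" for u
        using M [OF that] component_le_norm_cart [of "X u" j] by linarith
      have l1x: "l1 x \<le> (real CARD('d) + 4) * real m"
        using l1_near_box [OF x] by (simp add: algebra_simps)
      have Xx: "\<bar>X x $ j\<bar> \<le> ?M"
        by (rule Mcomp) (use l1x in \<open>simp add: algebra_simps\<close>)
      have long: "3 * real m - 2 * ?M \<le> ?t u" if "u \<in> far_box j m" for u
      proof -
        have "\<bar>X u $ j\<bar> \<le> ?M"
          by (rule Mcomp) (use l1_far_box [OF that] in \<open>simp add: algebra_simps\<close>)
        moreover have "3 * real m \<le> real_of_int (u $ j) - real_of_int (x $ j)"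
          using far_box_coordinate [OF that] near_box_coordinate [OF x, of j] by linarith
        ultimately show ?thesis using Xx by linarith
      qed
      have short: "- (r + 2 * ?M) \<le> ?t u" if "l1 (u - x) \<le> r" for u
      proof -
        have "l1 u \<le> l1 (u - x) + l1 x" using l1_triangle [of "u - x" x] by simp
        then have "l1 u \<le> real (?D * m)" using that l1x m by (simp add: algebra_simps)
        then have "\<bar>X u $ j\<bar> \<le> ?M" by (rule Mcomp)
        moreover have "\<bar>real_of_int ((u - x) $ j)\<bar> \<le> r"
          using abs_component_le_l1 [of "u - x" j] that by linarith
        ultimately show ?thesis using Xx by simp
      qed
      have "(b + 1) * (2 * ?M) = 2 * ?M * (b + 1)" by simp
      then have M2: "2 * ?M + b * (2 * ?M) < real m" using Mm by (simp add: algebra_simps)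
      have Mb: "0 \<le> b * (2 * ?M)" using M0 b by simp
      have A: "3 * real m - 2 * ?M \<le> (\<Sum>u\<in>?N \<inter> far_box j m. ?t u)"
      proof -
        have "3 * real m - 2 * ?M \<le> ?t y" by (rule long [OF y])
        also have "\<dots> \<le> (\<Sum>u\<in>?N \<inter> far_box j m. ?t u)"
        proof (rule member_le_sum)
          show "y \<in> ?N \<inter> far_box j m" using xy y by simp
          show "finite (?N \<inter> far_box j m)" using fin by blast
          fix u assume "u \<in> ?N \<inter> far_box j m - {y}"
          then have "3 * real m - 2 * ?M \<le> ?t u" by (intro long) auto
          then show "0 \<le> ?t u" using M2 Mb m by linarith
        qed
        finally show ?thesis .
      qed
      have B: "- (b * (r + 2 * ?M)) \<le> (\<Sum>u\<in>?N - far_box j m. ?t u)"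
      proof -
        have "?N - far_box j m \<subseteq> (\<lambda>v. v + x) ` l1_ball r"
        proof
          fix u assume "u \<in> ?N - far_box j m"
          then have "l1 (u - x) \<le> r" using iso [of u] by blast
          then have "u - x \<in> l1_ball r" by (simp only: mem_Collect_eq)
          then have "u - x + x \<in> (\<lambda>v. v + x) ` l1_ball r" by (rule imageI)
          then show "u \<in> (\<lambda>v. v + x) ` l1_ball r" by simp
        qed
        then have "card (?N - far_box j m) \<le> card ((\<lambda>v. v + x) ` l1_ball r)"
          by (intro card_mono finite_imageI finite_l1_ball)
        also have "\<dots> \<le> card (l1_ball r :: (int ^ 'd) set)" by (rule card_image_le [OF finite_l1_ball])
        finally have "real (card (?N - far_box j m)) \<le> b" by (simp add: b_def)
        then have "real (card (?N - far_box j m)) * (r + 2 * ?M) \<le> b * (r + 2 * ?M)"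
          using r M0 by (intro mult_right_mono) auto
        then have "- (b * (r + 2 * ?M)) \<le> (\<Sum>u\<in>?N - far_box j m. - (r + 2 * ?M))"
          by (simp only: sum_constant mult_minus_right neg_le_iff_le)
        also have "\<dots> \<le> (\<Sum>u\<in>?N - far_box j m. ?t u)"
          by (intro sum_mono short) (use iso in blast)
        finally show ?thesis .
      qed
      have "(\<Sum>u\<in>?N. ?t u) = (\<Sum>u\<in>?N \<inter> far_box j m. ?t u) + (\<Sum>u\<in>?N - far_box j m. ?t u)"
        using sum.Int_Diff [OF fin] by blast
      moreover have "b * (r + 2 * ?M) = b * r + b * (2 * ?M)" by (simp add: algebra_simps)
      ultimately show False using A B sum0 M2 m by linarith
    qed
  qed
qed

context percolation
begin

lemma measurable_open [measurable]: "{\<omega>. cond \<omega> x y = 1} \<in> sets P"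
  using measurable_sets [OF measurable_cond, of "{1}" x y] by (simp add: sets_P vimage_def)

lemma p_bounds: "0 \<le> p x" "p x \<le> 1"
  using prob_open [of 0 x] measure_nonneg [of P] prob_le_1 by (metis diff_zero)+

definition pattern :: "((int ^ 'd) \<times> (int ^ 'd)) set \<Rightarrow> ((int ^ 'd) \<times> (int ^ 'd)) set \<Rightarrow> 'd env set" where
  "pattern S T = {\<omega>. \<forall>e\<in>S. cond \<omega> (fst e) (snd e) = 1 \<longleftrightarrow> e \<in> T}"

lemma sets_pattern [measurable]: "finite S \<Longrightarrow> pattern S T \<in> sets P"
proof -
  assume S: "finite S"
  have "{\<omega> \<in> space P. cond \<omega> (fst e) (snd e) = 1 \<longleftrightarrow> e \<in> T} \<in> sets P" for e
    using sets.compl_sets [OF measurable_open [of "fst e" "snd e"]] measurable_open [of "fst e" "snd e"]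
    by (cases "e \<in> T") (auto simp: Compl_eq_Diff_UNIV [symmetric] Collect_neg_eq)
  then have "{\<omega> \<in> space P. \<forall>e\<in>S. cond \<omega> (fst e) (snd e) = 1 \<longleftrightarrow> e \<in> T} \<in> sets P"
    by (intro sets.sets_Collect_finite_All S) auto
  then show ?thesis by (simp add: pattern_def)
qed

lemma prob_pattern_open:
  assumes S: "finite S" and e: "Upair x y \<notin> (\<lambda>e. Upair (fst e) (snd e)) ` S"
  shows "prob (pattern S T \<inter> {\<omega>. cond \<omega> x y = 1}) = prob (pattern S T) * p (y - x)"
proof -
  let ?J = "(\<lambda>e. Upair (fst e) (snd e)) ` S" and ?K = "{Upair x y}"
  let ?A = "{f \<in> space (\<Pi>\<^sub>M e\<in>?J. borel). \<forall>e\<in>S. f (Upair (fst e) (snd e)) = (1::real) \<longleftrightarrow> e \<in> T}"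
  let ?B = "{f \<in> space (\<Pi>\<^sub>M e\<in>?K. borel). f (Upair x y) = (1::real)}"
  have "{f \<in> space (\<Pi>\<^sub>M e\<in>?J. borel). f (Upair (fst e) (snd e)) = (1::real) \<longleftrightarrow> e \<in> T} \<in> sets (\<Pi>\<^sub>M e\<in>?J. borel)"
    if "e \<in> S" for e
  proof -
    have [measurable]: "(\<lambda>f. f (Upair (fst e) (snd e))) \<in> borel_measurable (\<Pi>\<^sub>M e\<in>?J. (borel :: real measure))"
      by (rule measurable_component_singleton) (use that in blast)
    show ?thesis by measurable
  qed
  then have A: "?A \<in> sets (\<Pi>\<^sub>M e\<in>?J. borel)" by (intro sets.sets_Collect_finite_All S)
  have [measurable]: "(\<lambda>f. f (Upair x y)) \<in> borel_measurable (\<Pi>\<^sub>M e\<in>?K. (borel :: real measure))"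
    by (rule measurable_component_singleton) simp
  have B: "?B \<in> sets (\<Pi>\<^sub>M e\<in>?K. borel)" by measurable
  have "?J \<inter> ?K = {}" using e by auto
  from indep_disjoint_edges [OF this A B]
  have *: "prob {\<omega>. restrict \<omega> ?J \<in> ?A \<and> restrict \<omega> ?K \<in> ?B} = prob {\<omega>. restrict \<omega> ?J \<in> ?A} * prob {\<omega>. restrict \<omega> ?K \<in> ?B}" .
  have rA: "restrict \<omega> ?J \<in> ?A \<longleftrightarrow> \<omega> \<in> pattern S T" for \<omega>
    by (auto simp: pattern_def cond_def space_PiM PiE_iff)
  have rB: "restrict \<omega> ?K \<in> ?B \<longleftrightarrow> cond \<omega> x y = 1" for \<omega>
    by (auto simp: cond_def space_PiM PiE_iff)
  show ?thesis
    using * unfolding rA rB by (simp add: prob_open Int_def)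
qed

lemma prob_all_closed_le:
  assumes S: "finite S" and inj: "inj_on (\<lambda>e. Upair (fst e) (snd e)) S"
  shows "prob (pattern S {}) \<le> exp (- (\<Sum>e\<in>S. p (snd e - fst e)))"
  using S inj
proof (induction S rule: finite_induct)
  case (insert e S)
  let ?O = "{\<omega>. cond \<omega> (fst e) (snd e) = 1}" and ?q = "p (snd e - fst e)"
  have notin: "Upair (fst e) (snd e) \<notin> (\<lambda>e. Upair (fst e) (snd e)) ` S"
    using insert(2,4) by (auto simp: inj_on_def)
  have "pattern (insert e S) {} = pattern S {} - pattern S {} \<inter> ?O"
    by (auto simp: pattern_def)
  then have "prob (pattern (insert e S) {}) = prob (pattern S {}) - prob (pattern S {} \<inter> ?O)"
    using insert(1) by (simp add: finite_measure_Diff)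
  also have "\<dots> = prob (pattern S {}) * (1 - ?q)"
    by (simp add: prob_pattern_open [OF insert(1) notin] algebra_simps)
  also have "\<dots> \<le> exp (- (\<Sum>e\<in>S. p (snd e - fst e))) * exp (- ?q)"
  proof (rule mult_mono)
    show "prob (pattern S {}) \<le> exp (- (\<Sum>e\<in>S. p (snd e - fst e)))"
      using insert by (simp add: inj_on_def)
    show "1 - ?q \<le> exp (- ?q)" using exp_ge_add_one_self [of "- ?q"] by simp
  qed (use p_bounds in auto)
  also have "\<dots> = exp (- (\<Sum>e\<in>insert e S. p (snd e - fst e)))"
    using insert by (simp add: exp_add [symmetric])
  finally show ?case .
qed simp

definition only_short_or_far :: "'d \<Rightarrow> real \<Rightarrow> nat \<Rightarrow> int ^ 'd \<Rightarrow> 'd env set" where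
  "only_short_or_far j r m x = {\<omega>. \<forall>u. cond \<omega> x u = 1 \<longrightarrow> u \<in> far_box j m \<or> l1 (u - x) \<le> r}"

lemma sets_only_short_or_far [measurable]: "only_short_or_far j r m x \<in> sets P"
proof -
  have [simp]: "UNIV \<in> sets P" using sets.top [of P] by simp
  have "{\<omega> \<in> space P. cond \<omega> x u = 1 \<longrightarrow> u \<in> far_box j m \<or> l1 (u - x) \<le> r} \<in> sets P" for u
    using sets.compl_sets [OF measurable_open [of x u]]
    by (cases "u \<in> far_box j m \<or> l1 (u - x) \<le> r") (auto simp: Compl_eq_Diff_UNIV [symmetric] Collect_neg_eq)
  then have "{\<omega> \<in> space P. \<forall>u. cond \<omega> x u = 1 \<longrightarrow> u \<in> far_box j m \<or> l1 (u - x) \<le> r} \<in> sets P"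
    by (intro sets.sets_Collect_countable_All)
  then show ?thesis by (simp add: only_short_or_far_def)
qed

text \<open>The other long edges at \<open>x\<close> do not join the two boxes, so they are independent of anything prescribed there; a
  union bound shows that all of them are absent with conditional probability at least one half.\<close>

lemma prob_pattern_only_short_or_far:
  assumes tail: "(\<integral>\<^sup>+z. ennreal (p z) * indicator {z. r < l1 z} z \<partial>count_space UNIV) \<le> ennreal (1/2)"
    and S: "S \<subseteq> near_box m \<times> far_box j m" and x: "x \<in> near_box m" "x \<notin> far_box j m"
  shows "prob (pattern S T) / 2 \<le> prob (pattern S T \<inter> only_short_or_far j r m x)"
proof -
  have finS: "finite S" using S finite_near_box finite_far_box by (meson finite_SigmaI finite_subset)
  have [measurable]: "pattern S T \<in> sets P" by (rule sets_pattern [OF finS])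
  let ?A = "pattern S T" and ?F = "only_short_or_far j r m x"
  let ?Y = "{u. u \<notin> far_box j m \<and> r < l1 (u - x)}"
  have "emeasure P (?A - ?F) = (\<integral>\<^sup>+\<omega>. indicator (?A - ?F) \<omega> \<partial>P)" by simp
  also have "\<dots> \<le> (\<integral>\<^sup>+\<omega>. (\<integral>\<^sup>+u. indicator (?A \<inter> {\<omega>. cond \<omega> x u = 1}) \<omega> * indicator ?Y u \<partial>count_space UNIV) \<partial>P)"
  proof (rule nn_integral_mono)
    fix \<omega>
    show "indicator (?A - ?F) \<omega> \<le> (\<integral>\<^sup>+u. indicator (?A \<inter> {\<omega>. cond \<omega> x u = 1}) \<omega> * indicator ?Y u \<partial>count_space UNIV)"
    proof (cases "\<omega> \<in> ?A - ?F")
      case True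
      then obtain u where u: "cond \<omega> x u = 1" "u \<in> ?Y" "\<omega> \<in> ?A" by (auto simp: only_short_or_far_def not_le)
      then have "1 = indicator (?A \<inter> {\<omega>. cond \<omega> x u = 1}) \<omega> * (indicator ?Y u :: ennreal)" by simp
      also have "\<dots> \<le> (\<integral>\<^sup>+u. indicator (?A \<inter> {\<omega>. cond \<omega> x u = 1}) \<omega> * indicator ?Y u \<partial>count_space UNIV)"
        by (rule nn_integral_ge_point) simp
      finally show ?thesis using True by simp
    qed simp
  qed
  also have "\<dots> = (\<integral>\<^sup>+u. (\<integral>\<^sup>+\<omega>. indicator (?A \<inter> {\<omega>. cond \<omega> x u = 1}) \<omega> * indicator ?Y u \<partial>P) \<partial>count_space UNIV)"
    by (rule nn_integral_count_space_nn_integral) auto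
  also have "\<dots> = (\<integral>\<^sup>+u. emeasure P (?A \<inter> {\<omega>. cond \<omega> x u = 1}) * indicator ?Y u \<partial>count_space UNIV)"
    by (intro nn_integral_cong) (simp add: nn_integral_multc)
  also have "\<dots> \<le> (\<integral>\<^sup>+u. emeasure P ?A * (ennreal (p (u - x)) * indicator {z. r < l1 z} (u - x)) \<partial>count_space UNIV)"
  proof (rule nn_integral_mono)
    fix u
    show "emeasure P (?A \<inter> {\<omega>. cond \<omega> x u = 1}) * indicator ?Y u
      \<le> emeasure P ?A * (ennreal (p (u - x)) * indicator {z. r < l1 z} (u - x))"
    proof (cases "u \<in> ?Y")
      case True
      have "Upair x u \<notin> (\<lambda>e. Upair (fst e) (snd e)) ` S"
        using S x True by auto
      from prob_pattern_open [OF finS this, of T] True show ?thesis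
        by (simp add: emeasure_eq_measure ennreal_mult p_bounds)
    qed simp
  qed
  also have "\<dots> = emeasure P ?A * (\<integral>\<^sup>+u. ennreal (p (u - x)) * indicator {z. r < l1 z} (u - x) \<partial>count_space UNIV)"
    by (rule nn_integral_cmult) simp
  also have "(\<integral>\<^sup>+u. ennreal (p (u - x)) * indicator {z. r < l1 z} (u - x) \<partial>count_space UNIV)
    = (\<integral>\<^sup>+z. ennreal (p z) * indicator {z. r < l1 z} z \<partial>count_space UNIV)"
    by (rule nn_integral_bij_count_space [where g = "\<lambda>u. u - x" and f = "\<lambda>z. ennreal (p z) * indicator {z. r < l1 z} z"])
      (rule bij_betw_byWitness [where f' = "\<lambda>u. u + x"], auto)
  also have "emeasure P ?A * \<dots> \<le> emeasure P ?A * ennreal (1/2)" by (rule mult_left_mono [OF tail]) simp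
  also have "emeasure P ?A * ennreal (1/2) = ennreal (prob ?A * (1/2))"
    by (subst ennreal_mult) (simp_all only: emeasure_eq_measure, auto)
  finally have "ennreal (prob (?A - ?F)) \<le> ennreal (prob ?A * (1/2))"
    by (simp only: emeasure_eq_measure)
  then have "prob (?A - ?F) \<le> prob ?A * (1/2)" by (simp add: ennreal_le_iff)
  moreover have "prob ?A = prob (?A \<inter> ?F) + prob (?A - ?F)"
    by (subst finite_measure_Union [symmetric]) (auto intro!: arg_cong [where f = prob])
  ultimately show ?thesis by linarith
qed

text \<open>If the edges between the boxes are examined one after the other, the first open one is isolated with conditional
  probability at least one half, as the examination reveals nothing about other edges. In the
  induction the new edge \<open>e\<close> is examined last: it matters when all edges in \<open>S\<close> are closed.\<close>

lemma prob_isolated_long_edge_ge: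
  assumes tail: "(\<integral>\<^sup>+z. ennreal (p z) * indicator {z. r < l1 z} z \<partial>count_space UNIV) \<le> ennreal (1/2)"
    and m: "0 < m" and S: "finite S" "S \<subseteq> near_box m \<times> far_box j m"
  shows "(1 - prob (pattern S {})) / 2 \<le> prob {\<omega>. \<exists>e\<in>S. isolated_long_edge j r m \<omega> (fst e) (snd e)}"
  using S
proof (induction S rule: finite_induct)
  case empty
  show ?case by (simp add: pattern_def prob_space [simplified space_P])
next
  case (insert e S)
  define x where "x = fst e"
  let ?H = "\<lambda>S. {\<omega>. \<exists>e\<in>S. isolated_long_edge j r m \<omega> (fst e) (snd e)}"
  let ?A = "pattern (insert e S) {e}" and ?F = "only_short_or_far j r m x"
  have iso_eq: "?H S = (\<Union>e\<in>S. {\<omega>. cond \<omega> (fst e) (snd e) = 1} \<inter> only_short_or_far j r m (fst e))" for S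
    by (auto simp: isolated_long_edge_def only_short_or_far_def)
  have H_sets: "?H S \<in> sets P" if "finite S" for S
    unfolding iso_eq using that by (intro sets.finite_UN sets.Int measurable_open sets_only_short_or_far)
  have fin: "finite S" "finite (insert e S)" using insert by auto
  have A_sets: "?A \<in> sets P" by (rule sets_pattern [OF fin(2)])
  have x: "x \<in> near_box m" "x \<notin> far_box j m"
  proof -
    show "x \<in> near_box m" using insert by (auto simp: x_def)
    then show "x \<notin> far_box j m"
      using near_box_coordinate [of x m j] far_box_coordinate [of x j m] m by force
  qed
  have split: "pattern S {} = pattern (insert e S) {} \<union> ?A"
    using insert(2) by (auto simp: pattern_def)
  have "prob (pattern S {}) = prob (pattern (insert e S) {}) + prob ?A"
    unfolding split
  proof (rule finite_measure_Union)
    show "pattern (insert e S) {} \<in> sets P" by (rule sets_pattern [OF fin(2)])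
    show "pattern (insert e S) {} \<inter> ?A = {}" by (auto simp: pattern_def)
  qed (rule A_sets)
  then have "(1 - prob (pattern (insert e S) {})) / 2 = (1 - prob (pattern S {})) / 2 + prob ?A / 2"
    by (simp add: diff_divide_distrib add_divide_distrib)
  also have "\<dots> \<le> prob (?H S) + prob (?A \<inter> ?F)"
    using insert.IH insert.prems prob_pattern_only_short_or_far [OF tail insert.prems x] by (intro add_mono) auto
  also have "\<dots> = prob (?H S \<union> ?A \<inter> ?F)"
  proof (rule finite_measure_Union [symmetric])
    show "?H S \<inter> (?A \<inter> ?F) = {}"
      using insert(2) by (auto simp: isolated_long_edge_def pattern_def)
  qed (use H_sets [OF fin(1)] A_sets in auto)
  also have "\<dots> \<le> prob (?H (insert e S))"
  proof (rule finite_measure_mono)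
    show "?H S \<union> ?A \<inter> ?F \<subseteq> ?H (insert e S)"
      by (auto simp: isolated_long_edge_def pattern_def only_short_or_far_def x_def)
    show "?H (insert e S) \<in> sets P" by (rule H_sets [OF fin(2)])
  qed
  finally show ?case .
qed

text \<open>By the second moment, \<open>p\<close> has arbitrarily small mass far from the origin.\<close>

lemma tail_radius:
  assumes moment: "(\<lambda>x. p x * (l1 x)\<^sup>2) summable_on UNIV"
  obtains r where "0 \<le> r" and "(\<integral>\<^sup>+z. ennreal (p z) * indicator {z. r < l1 z} z \<partial>count_space UNIV) \<le> ennreal (1/2)"
proof -
  have int: "integrable (count_space UNIV) (\<lambda>z. p z * (l1 z)\<^sup>2)"
    using moment by (subst abs_summable_on_def [symmetric], subst abs_summable_equivalent [symmetric])
      (simp add: abs_mult p_bounds)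
  define S where "S = (\<integral>z. p z * (l1 z)\<^sup>2 \<partial>count_space UNIV)"
  define r where "r = max 1 (2 * S)"
  have r: "1 \<le> r" "2 * S \<le> r" by (auto simp: r_def)
  have "(\<integral>\<^sup>+z. ennreal (p z) * indicator {z. r < l1 z} z \<partial>count_space UNIV)
    \<le> (\<integral>\<^sup>+z. ennreal (1 / r * (p z * (l1 z)\<^sup>2)) \<partial>count_space UNIV)"
  proof (rule nn_integral_mono)
    fix z :: "int ^ 'd"
    show "ennreal (p z) * indicator {z. r < l1 z} z \<le> ennreal (1 / r * (p z * (l1 z)\<^sup>2))"
    proof (cases "r < l1 z")
      case True
      have "r * 1 \<le> l1 z * l1 z" using True r by (intro mult_mono) auto
      then have "1 \<le> 1 / r * (l1 z)\<^sup>2" using r by (simp add: power2_eq_square field_simps)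
      then have "p z * 1 \<le> p z * (1 / r * (l1 z)\<^sup>2)" by (intro mult_left_mono p_bounds)
      then show ?thesis using True by (simp add: ennreal_leI mult.left_commute)
    qed simp
  qed
  also have "\<dots> = ennreal (\<integral>z. 1 / r * (p z * (l1 z)\<^sup>2) \<partial>count_space UNIV)"
    using int r p_bounds by (intro nn_integral_eq_integral) auto
  also have "(\<integral>z. 1 / r * (p z * (l1 z)\<^sup>2) \<partial>count_space UNIV) = 1 / r * S"
    unfolding S_def by (rule integral_mult_right_zero)
  also have "ennreal (1 / r * S) \<le> ennreal (1/2)"
    using r by (intro ennreal_leI) (simp add: field_simps)
  finally show ?thesis using that [of r] r by simp
qed

text \<open>There are of order \<open>m ^ (2 * d)\<close> pairs between the boxes, each joined with probability at least
  \<open>m powr (- s - o(1))\<close>; as \<open>s < 2 * d\<close>, the expected number of edges diverges.\<close>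

lemma boxes_eventually_joined:
  assumes dec: "decays_with_exponent p s" and s: "0 \<le> s" "s < 2 * real CARD('d)"
  shows "\<forall>\<^sub>F m in sequentially. prob (pattern (near_box m \<times> far_box j m) {}) \<le> 1/2"
proof -
  let ?d = "real CARD('d)"
  define \<delta> where "\<delta> = (2 * ?d - s) / 2"
  define a where "a = s + \<delta>"
  define c where "c = ?d + 4"
  have \<delta>: "0 < \<delta>" and a: "0 \<le> a" and c: "0 < c" using s by (auto simp: \<delta>_def a_def c_def)
  obtain r where r: "r \<ge> 1" "\<And>x. r \<le> lnorm x \<Longrightarrow> lnorm x powr (- s - \<delta>) \<le> p x"
    using decays_with_exponent_bounds [OF dec \<delta>] by metis
  define K where "K = (c powr a) powr (1 / \<delta>)"
  have "\<forall>\<^sub>F m in sequentially. r \<le> real m \<and> K \<le> real m"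
    using eventually_ge_at_top [of "nat \<lceil>max r K\<rceil>"] by eventually_elim linarith
  then show ?thesis
  proof eventually_elim
    case (elim m)
    have m: "0 < real m" using elim r by linarith
    let ?S = "near_box m \<times> far_box j m :: ((int ^ 'd) \<times> (int ^ 'd)) set"
    have finS: "finite ?S" by (intro finite_cartesian_product finite_near_box finite_far_box)
    have disj: "x \<noteq> y" if "x \<in> near_box m" "y \<in> far_box j m" for x y :: "int ^ 'd"
      using near_box_coordinate [OF that(1), of j] far_box_coordinate [OF that(2)] m by auto
    have inj: "inj_on (\<lambda>e. Upair (fst e) (snd e)) ?S"
      using disj by (auto simp: inj_on_def)
    have p_ge: "c powr (- a) * real m powr (- a) \<le> p (snd e - fst e)" if "e \<in> ?S" for e
    proof -
      have xy: "fst e \<in> near_box m" "snd e \<in> far_box j m" using that by auto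
      have lo: "3 * real m \<le> lnorm (snd e - fst e)" by (rule lnorm_near_far_ge [OF xy])
      have "lnorm (snd e - fst e) \<le> c * real m"
        using order.trans [OF lnorm_le_l1 l1_near_far [OF xy]] by (simp add: c_def)
      then have "(c * real m) powr (- a) \<le> lnorm (snd e - fst e) powr (- a)"
        using lo m a by (intro powr_mono2') auto
      also have "\<dots> \<le> p (snd e - fst e)" using r(2) [of "snd e - fst e"] lo elim m by (simp add: a_def)
      finally show ?thesis using c m by (simp add: powr_mult)
    qed
    have "1 \<le> c powr (- a) * real m powr \<delta>"
    proof -
      have "c powr a = K powr \<delta>" using \<delta> c by (simp add: K_def powr_powr)
      also have "\<dots> \<le> real m powr \<delta>" using elim \<delta> by (intro powr_mono2) (auto simp: K_def)
      finally have "c powr (- a) * c powr a \<le> c powr (- a) * real m powr \<delta>" by (intro mult_left_mono) auto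
      then show ?thesis using c by (simp add: powr_add [symmetric])
    qed
    also have "real m powr \<delta> = real m powr (2 * ?d) * real m powr (- a)"
      using m by (simp add: powr_add [symmetric] a_def \<delta>_def field_simps)
    also have "c powr (- a) * (real m powr (2 * ?d) * real m powr (- a))
      \<le> real (card ?S) * (c powr (- a) * real m powr (- a))"
    proof -
      have "real m powr (2 * ?d) = real m ^ (2 * CARD('d))" using m by (subst powr_realpow [symmetric]) auto
      also have "\<dots> \<le> real (m + 1) ^ (2 * CARD('d))" by (intro power_mono) auto
      also have "\<dots> = real (card ?S)"
        by (simp add: card_cartesian_product card_near_box card_far_box mult_2 power_add)
      finally have "real m powr (2 * ?d) * (c powr (- a) * real m powr (- a)) \<le> real (card ?S) * (c powr (- a) * real m powr (- a))"
        by (rule mult_right_mono) simp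
      then show ?thesis by (simp add: mult_ac)
    qed
    also have "\<dots> = (\<Sum>e\<in>?S. c powr (- a) * real m powr (- a))" by simp
    also have "\<dots> \<le> (\<Sum>e\<in>?S. p (snd e - fst e))" by (intro sum_mono p_ge)
    finally have "1 \<le> (\<Sum>e\<in>?S. p (snd e - fst e))" .
    then have "exp (- (\<Sum>e\<in>?S. p (snd e - fst e))) \<le> exp (- 1)" by simp
    moreover have "exp (- 1 :: real) \<le> 1 / 2"
      using exp_ge_add_one_self [of "1 :: real"] by (simp add: exp_minus field_simps)
    ultimately show "prob (pattern ?S {}) \<le> 1 / 2"
      using prob_all_closed_le [OF finS inj] by linarith
  qed
qed

theorem not_sublinear_everywhere:
  assumes env: "random_environment P"
    and moment: "(\<lambda>x. p x * (l1 x)\<^sup>2) summable_on UNIV"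
    and dec: "decays_with_exponent p s" and s: "0 \<le> s" "s < 2 * real CARD('d)"
    and harm: "AE \<omega> in P. \<forall>x. harmonic_at \<omega> (\<lambda>y. emb y + X \<omega> y) x"
  shows "\<not> (AE \<omega> in P. sublinear_everywhere (X \<omega>))"
proof
  assume sub: "AE \<omega> in P. sublinear_everywhere (X \<omega>)"
  obtain j :: 'd where True by simp
  obtain r where r: "0 \<le> r"
    and tail: "(\<integral>\<^sup>+z. ennreal (p z) * indicator {z. r < l1 z} z \<partial>count_space UNIV) \<le> ennreal (1/2)"
    using tail_radius [OF moment] by blast
  define H where "H m = {\<omega>. \<exists>e\<in>near_box m \<times> far_box j m. isolated_long_edge j r m \<omega> (fst e) (snd e)}" for m
  have fin: "finite (near_box m \<times> far_box j m :: ((int ^ 'd) \<times> (int ^ 'd)) set)" for m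
    by (intro finite_cartesian_product finite_near_box finite_far_box)
  have "H m = (\<Union>e\<in>near_box m \<times> far_box j m. {\<omega>. cond \<omega> (fst e) (snd e) = 1} \<inter> only_short_or_far j r m (fst e))" for m
    unfolding H_def isolated_long_edge_def only_short_or_far_def by blast
  then have H_sets [measurable]: "H m \<in> sets P" for m
    using fin by (simp add: sets.finite_UN sets.Int measurable_open sets_only_short_or_far)
  have "AE \<omega> in P. (\<lambda>m. indicat_real (H m) \<omega>) \<longlonglongrightarrow> 0"
    using sub harm random_environment.AE_typical [OF env]
  proof eventually_elim
    case (elim \<omega>)
    have "\<forall>\<^sub>F m in sequentially. \<not> (\<exists>x\<in>near_box m. \<exists>y\<in>far_box j m. isolated_long_edge j r m \<omega> x y)"
      by (rule no_isolated_long_edge_if_sublinear [where X = "X \<omega>"])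
        (use elim r in \<open>auto simp: random_environment.typical_def [OF env]\<close>)
    then have "\<forall>\<^sub>F m in sequentially. indicat_real (H m) \<omega> = 0"
      by eventually_elim (auto simp: H_def)
    then show ?case by (rule tendsto_eventually)
  qed
  then have "(\<lambda>m. \<integral>\<omega>. indicat_real (H m) \<omega> \<partial>P) \<longlonglongrightarrow> (\<integral>\<omega>. 0 \<partial>P)"
    by (intro integral_dominated_convergence [where w = "\<lambda>_. 1"]) auto
  then have lim: "(\<lambda>m. prob (H m)) \<longlonglongrightarrow> 0" by simp
  have "\<forall>\<^sub>F m in sequentially. 1/4 \<le> prob (H m)"
    using boxes_eventually_joined [OF dec s, of j] eventually_gt_at_top [of 0]
  proof eventually_elim
    case (elim m)
    have "(1 - prob (pattern (near_box m \<times> far_box j m) {})) / 2 \<le> prob (H m)"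
      unfolding H_def by (rule prob_isolated_long_edge_ge [OF tail elim(2) fin order_refl])
    then show ?case using elim(1) by simp
  qed
  then have "1/4 \<le> (0 :: real)" by (rule tendsto_lowerbound [OF lim]) simp
  then show False by simp
qed

end

theorem theorem2p5:
  fixes p :: "int ^ ('d::finite) \<Rightarrow> real" and s :: real and P :: "('d::finite) env measure"
  assumes "CARD('d) \<ge> 3"
    and "real CARD('d) + 2 < s" and "s < 2 * real CARD('d)"
    and "\<And>x. 0 \<le> p x \<and> p x \<le> 1"
    and "\<And>x. p x = p (- x)"
    and "p 0 = 0"
    and "\<And>x. lnorm x = 1 \<Longrightarrow> p x = 1"
    and "decays_with_exponent p s"
    and "long_range_percolation p P"
  shows "corrector_well_defined P \<and>
         (\<forall>X. is_corrector P X \<longrightarrow> \<not> (AE \<omega> in P. sublinear_everywhere (X \<omega>))) \<and>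
         (\<forall>X. corrector_properties P X \<longrightarrow> \<not> (AE \<omega> in P. sublinear_everywhere (X \<omega>)))"
proof -
  interpret percolation p P by unfold_locales (rule assms(9))
  have moment: "(\<lambda>x. p x * (l1 x)\<^sup>2) summable_on UNIV"
    using assms(2,4,8) by (intro decay_second_moment) auto
  have env: "random_environment P"
    by (rule random_environment_percolation [OF assms(7) moment])
  have not_sub: "\<not> (AE \<omega> in P. sublinear_everywhere (X \<omega>))" if "corrector_properties P X" for X
  proof (rule not_sublinear_everywhere [OF env moment assms(8) _ assms(3)])
    show "0 \<le> s" using assms(2) by simp
    show "AE \<omega> in P. \<forall>x. harmonic_at \<omega> (\<lambda>y. emb y + X \<omega> y) x"
      using that by (simp add: corrector_properties_def)
  qed
  then show ?thesis
    using random_environment.corrector_well_defined [OF env] by (simp add: is_corrector_def)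
qed

end
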